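(* Let $d=2$ and consider a constant magnetic field with field strength $B>0$, with magnetic potential $\mathbf A(x)=\frac B2(x_2,-x_1)$, $x=(x_1,x_2)\in\mathbb R^2$. Given any $p\in(2,+\infty)$ and any $\alpha>-B$, let $\mu_{\mathbf B}(\alpha)$ be the largest constant such that $$\|\nabla_{\mathbf A}\psi\|_2^2+\alpha\|\psi\|_2^2\ge\mu_{\mathbf B}(\alpha)\,\|\psi\|_p^2\quad\forall\,\psi\in\mathrm H^1_{\mathbf A}(\mathbb R^2).$$ Then $$\mu_{\mathbf B}(\alpha)\ge\mathsf C_p\,(1-c^2)^{1-\frac2p}\,(\alpha+c\,B)^{\frac2p}=:\mu_{\mathrm{LT}}(\alpha),$$ with $$c=c(p,\eta)=\frac{\sqrt{\eta^2+p-1}-\eta}{p-1}=\frac1{\eta+\sqrt{\eta^2+p-1}}\in(0,1)\quad\text{and}\quad\eta=\frac{\alpha\,(p-2)}{2B}.$$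
   Context: $\|\cdot\|_q$ is the norm of $\mathrm L^q(\mathbb R^2)$. $\nabla_{\mathbf A}:=\nabla+i\mathbf A$ and $\mathrm H^1_{\mathbf A}(\mathbb R^2):=\{\psi\in\mathrm L^2(\mathbb R^2;\mathbb C):\nabla_{\mathbf A}\psi\in\mathrm L^2(\mathbb R^2)\}$. For $p\in(2,+\infty)$, $\mathsf C_p:=\min_{u\in\mathrm H^1(\mathbb R^2)\setminus\{0\}}\frac{\|\nabla u\|_2^2+\|u\|_2^2}{\|u\|_p^2}$. *)

theory Defs
  imports "HOL-Analysis.Analysis"
begin

text \<open>
  Functions on the plane are represented by Borel functions, and integrals are taken with respect
  to \<^const>\<open>lborel\<close>; every class of Lebesgue measurable functions modulo null sets has such a
  representative.
\<close>

definition in_Lq :: "real \<Rightarrow> (real^2 \<Rightarrow> 'b::euclidean_space) \<Rightarrow> bool" where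
  "in_Lq q f \<longleftrightarrow> f \<in> borel_measurable lborel \<and> integrable lborel (\<lambda>x. norm (f x) powr q)"

text \<open>
  The value is meaningful when \<^term>\<open>in_Lq q f\<close>; otherwise the Bochner integral defaults to 0.
  Below, the norm of order \<open>p\<close> is only applied to elements of \<open>H\<^sup>1\<close> and \<open>H\<^sup>1\<^sub>A\<close>, which are in
  \<open>L\<^sup>p\<close> for all finite \<open>p \<ge> 2\<close> by the Sobolev embedding and the diamagnetic inequality.
\<close>
definition Lq_norm :: "real \<Rightarrow> (real^2 \<Rightarrow> 'b::euclidean_space) \<Rightarrow> real" where
  "Lq_norm q f = (LINT x|lborel. norm (f x) powr q) powr (1 / q)"

definition locally_integrable :: "(real^2 \<Rightarrow> 'b::euclidean_space) \<Rightarrow> bool" where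
  "locally_integrable f \<longleftrightarrow> (\<forall>K. compact K \<longrightarrow> set_integrable lborel K f)"

definition partial_deriv :: "2 \<Rightarrow> (real^2 \<Rightarrow> real) \<Rightarrow> real^2 \<Rightarrow> real" where
  "partial_deriv j f x = frechet_derivative f (at x) (axis j 1)"

primrec Ck :: "nat \<Rightarrow> (real^2 \<Rightarrow> real) \<Rightarrow> bool" where
  "Ck 0 f \<longleftrightarrow> continuous_on UNIV f"
| "Ck (Suc k) f \<longleftrightarrow> f differentiable_on UNIV \<and> (\<forall>j. Ck k (partial_deriv j f))"

definition test_function :: "(real^2 \<Rightarrow> real) \<Rightarrow> bool" where
  "test_function \<phi> \<longleftrightarrow> (\<forall>k. Ck k \<phi>) \<and> compact (closure {x. \<phi> x \<noteq> 0})"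

text \<open>\<open>G = \<nabla>u\<close> in the sense of distributions.\<close>
definition is_weak_grad :: "(real^2 \<Rightarrow> 'b::euclidean_space) \<Rightarrow> (real^2 \<Rightarrow> 'b^2) \<Rightarrow> bool" where
  "is_weak_grad u G \<longleftrightarrow> locally_integrable u \<and> locally_integrable G \<and>
     (\<forall>\<phi> j. test_function \<phi> \<longrightarrow>
        (LINT x|lborel. partial_deriv j \<phi> x *\<^sub>R u x) = - (LINT x|lborel. \<phi> x *\<^sub>R (G x $ j)))"

text \<open>A weak gradient is unique up to null sets, so the choice of representative is immaterial.\<close>
definition weak_grad :: "(real^2 \<Rightarrow> 'b::euclidean_space) \<Rightarrow> real^2 \<Rightarrow> 'b^2" where
  "weak_grad u = (SOME G. is_weak_grad u G)"

definition H1 :: "(real^2 \<Rightarrow> real) set" where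
  "H1 = {u. in_Lq 2 u \<and> (\<exists>G. is_weak_grad u G) \<and> in_Lq 2 (weak_grad u)}"

definition mag_grad :: "(real^2 \<Rightarrow> real^2) \<Rightarrow> (real^2 \<Rightarrow> complex) \<Rightarrow> real^2 \<Rightarrow> complex^2" where
  "mag_grad A \<psi> x = (\<chi> j. weak_grad \<psi> x $ j + \<i> * complex_of_real (A x $ j) * \<psi> x)"

text \<open>
  For locally bounded \<open>A\<close> and \<open>\<psi> \<in> L\<^sup>2\<close> the product \<open>A \<psi>\<close> is locally integrable.  Hence the
  distribution \<open>\<nabla>\<psi> + i A \<psi>\<close> can only be in \<open>L\<^sup>2\<close> if \<open>\<nabla>\<psi>\<close> is itself a locally integrable
  function, so requiring the weak gradient to exist is no restriction.
\<close>
definition H1_mag :: "(real^2 \<Rightarrow> real^2) \<Rightarrow> (real^2 \<Rightarrow> complex) set" where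
  "H1_mag A = {\<psi>. in_Lq 2 \<psi> \<and> (\<exists>G. is_weak_grad \<psi> G) \<and> in_Lq 2 (mag_grad A \<psi>)}"

text \<open>
  The minimum is written as an infimum (of a nonempty set of nonnegative reals); the two agree
  since the minimum is attained.  The condition \<open>u \<noteq> 0\<close> is understood in \<open>L\<^sup>2\<close>, that is, modulo
  null sets.
\<close>
definition C_p :: "real \<Rightarrow> real" where
  "C_p p = Inf {((Lq_norm 2 (weak_grad u))\<^sup>2 + (Lq_norm 2 u)\<^sup>2) / (Lq_norm p u)\<^sup>2 | u.
                u \<in> H1 \<and> \<not> (AE x in lborel. u x = 0)}"

definition A_const :: "real \<Rightarrow> real^2 \<Rightarrow> real^2" where
  "A_const B x = (B / 2) *\<^sub>R vector [x $ 2, - x $ 1]"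

definition mu_B :: "real \<Rightarrow> real \<Rightarrow> real \<Rightarrow> real" where
  "mu_B p B \<alpha> = (GREATEST \<mu>. \<forall>\<psi> \<in> H1_mag (A_const B).
     (Lq_norm 2 (mag_grad (A_const B) \<psi>))\<^sup>2 + \<alpha> * (Lq_norm 2 \<psi>)\<^sup>2 \<ge> \<mu> * (Lq_norm p \<psi>)\<^sup>2)"

end

theory Submission
  imports Defs "HOL-Computational_Algebra.Polynomial"
begin

text \<open>
  For \<open>D = \<nabla>\<^sub>A \<psi>\<close> and \<open>g = \<nabla>|\<psi>|\<close>, completing a square gives pointwise
  \<open>|D|\<^sup>2 \<ge> (1 - c\<^sup>2) |g|\<^sup>2 + 2 c Im (cnj D\<^sub>1 D\<^sub>2)\<close>, and the commutator of the two magnetic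
  derivatives yields \<open>2 \<integral> Im (cnj D\<^sub>1 D\<^sub>2) = B \<integral> |\<psi>|\<^sup>2\<close>. Hence the left-hand side of the magnetic
  inequality is at least \<open>(1 - c\<^sup>2) \<integral> |\<nabla>|\<psi>||\<^sup>2 + (\<alpha> + c B) \<integral> |\<psi>|\<^sup>2\<close>, and the definition of \<open>C\<^sub>p\<close>
  applied to a dilation of \<open>|\<psi>|\<close> concludes.

  Both facts about the nonsmooth function \<open>\<psi>\<close> are read off from the unitary magnetic translations
  \<open>(U\<^sub>j(s) \<psi>)(x) = exp(i s A\<^sub>j(x)) \<psi>(x + s e\<^sub>j)\<close>, where \<open>A\<^sub>j\<close> does not depend on \<open>x\<^sub>j\<close>: their difference
  quotients converge to \<open>D\<^sub>j\<close> in \<open>L\<^sup>2\<close>, one has \<open>|U\<^sub>j(s) \<psi>|(x) = |\<psi>|(x + s e\<^sub>j)\<close>, and \<open>U\<^sub>1(s)\<close>,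
  \<open>U\<^sub>2(t)\<close> commute up to the phase \<open>exp(- i B s t)\<close>. Neither mollification nor the Sobolev
  embedding is needed.
\<close>

section \<open>Smooth functions and bump functions\<close>

text \<open>The constant \<open>c\<close> maximises \<open>(1 - c\<^sup>2) powr (1 - 2 / p) *
  (\<alpha> + c * B) powr (2 / p)\<close> among the c in [0, 1) with \<alpha> + c B > 0: a vanishing
  logarithmic derivative means (p - 2) c (\<alpha> + c B) = B (1 - c^2), that is (p - 1) c^2 + 2
  \<eta> c = 1, and the given c is its positive root. The obstacle is the low regularity of \<psi>.
  Formally the commutator identity is D_1 D_2 - D_2 D_1 = - i B integrated by parts, but D_j \<psi>
  is merely in L^2 and need not be differentiable. Moreover A is unbounded, so the ordinary gradient
  of \<psi> need not be in L^2, and ordinary difference quotients need not converge there. The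
  translations U_j absorb A: they form the one-parameter group generated by D_j, so their quotients
  converge as soon as D_j \<psi> is in L^2, and commuting them is an exact identity between unitary
  operators, whose limit is the infinitesimal one. The modulus ignores the phases, which links it to
  plain translations; what remains delicate there is the zero set of \<psi>, where the modulus is
  not differentiable.\<close>

lemma partial_deriv_eqI:
  assumes "(f has_derivative f') (at x)"
  shows "partial_deriv j f x = f' (axis j 1)"
  unfolding partial_deriv_def using frechet_derivative_at[OF assms] by simp

lemma differentiable_on_UNIV_has_derivative:
  assumes "f differentiable_on UNIV"
  shows "(f has_derivative frechet_derivative f (at x)) (at x)"
  using assms unfolding differentiable_on_def frechet_derivative_works by simp

lemma partial_deriv_const [simp]: "partial_deriv j (\<lambda>_. c) = (\<lambda>_. 0)"
  by (rule ext, rule partial_deriv_eqI) simp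

lemma partial_deriv_add:
  assumes "f differentiable_on UNIV" "g differentiable_on UNIV"
  shows "partial_deriv j (\<lambda>x. f x + g x) = (\<lambda>x. partial_deriv j f x + partial_deriv j g x)"
  using has_derivative_add[OF assms[THEN differentiable_on_UNIV_has_derivative]]
  by (auto simp: partial_deriv_def dest!: partial_deriv_eqI[where j=j])

lemma partial_deriv_mult:
  assumes "f differentiable_on UNIV" "g differentiable_on UNIV"
  shows "partial_deriv j (\<lambda>x. f x * g x) =
    (\<lambda>x. f x * partial_deriv j g x + partial_deriv j f x * g x)"
  using has_derivative_mult[OF assms[THEN differentiable_on_UNIV_has_derivative]]
  by (auto simp: partial_deriv_def dest!: partial_deriv_eqI[where j=j])

lemma has_derivative_affine_arg:
  assumes "f differentiable_on (UNIV :: (real^2) set)"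
  shows "((\<lambda>x. f (v + c *\<^sub>R x)) has_derivative
    (\<lambda>h. frechet_derivative f (at (v + c *\<^sub>R x)) (c *\<^sub>R h))) (at x)"
  by (rule has_derivative_compose[of "\<lambda>x. v + c *\<^sub>R x" "\<lambda>h. c *\<^sub>R h" x UNIV f])
     (auto intro!: derivative_eq_intros differentiable_on_UNIV_has_derivative[OF assms])

lemma partial_deriv_affine:
  assumes "f differentiable_on UNIV"
  shows "partial_deriv j (\<lambda>x. f (v + c *\<^sub>R x)) = (\<lambda>x. c * partial_deriv j f (v + c *\<^sub>R x))"
proof
  fix x
  have "linear (frechet_derivative f (at (v + c *\<^sub>R x)))"
    using differentiable_on_UNIV_has_derivative[OF assms] has_derivative_linear by blast
  then show "partial_deriv j (\<lambda>x. f (v + c *\<^sub>R x)) x = c * partial_deriv j f (v + c *\<^sub>R x)"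
    by (simp add: partial_deriv_eqI[OF has_derivative_affine_arg[OF assms]] linear_scale
        partial_deriv_def)
qed

lemma Ck_const: "Ck k (\<lambda>_. c)"
  by (induction k arbitrary: c) auto

lemma Ck_Suc_imp: "Ck (Suc k) f \<Longrightarrow> Ck k f"
  by (induction k arbitrary: f) (auto intro: differentiable_imp_continuous_on)

lemma Ck_add: "Ck k f \<Longrightarrow> Ck k g \<Longrightarrow> Ck k (\<lambda>x. f x + g x)"
  by (induction k arbitrary: f g)
     (auto intro!: continuous_intros derivative_intros simp: partial_deriv_add)

lemma Ck_mult: "Ck k f \<Longrightarrow> Ck k g \<Longrightarrow> Ck k (\<lambda>x. f x * g x)"
proof (induction k arbitrary: f g)
  case (Suc k)
  then show ?case
    \<comment> \<open>The product rule at order \<open>Suc k\<close> also contains the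
      undifferentiated factors, which must therefore be available at order \<open>k\<close>.\<close>
    using Ck_Suc_imp[OF Suc.prems(1)] Ck_Suc_imp[OF Suc.prems(2)]
    by (auto simp: partial_deriv_mult differentiable_on_def intro!: Ck_add derivative_intros)
qed (auto intro!: continuous_intros)

lemma Ck_prod: "(\<And>i. i \<in> I \<Longrightarrow> Ck k (f i)) \<Longrightarrow> Ck k (\<lambda>x. \<Prod>i\<in>I. f i x)"
  by (induction I rule: infinite_finite_induct) (auto intro: Ck_const Ck_mult)

lemma Ck_affine_arg: "Ck k f \<Longrightarrow> Ck k (\<lambda>x. f (v + c *\<^sub>R x))"
proof (induction k arbitrary: f)
  case 0
  then show ?case
    by (auto intro!: continuous_on_compose2[of UNIV f] continuous_intros)
next
  case (Suc k)
  then have "f differentiable_on UNIV" "\<And>j. Ck k (\<lambda>x. partial_deriv j f (v + c *\<^sub>R x))"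
    by auto
  moreover from this have "(\<lambda>x. f (v + c *\<^sub>R x)) differentiable_on UNIV"
    using has_derivative_affine_arg unfolding differentiable_on_def differentiable_def by blast
  ultimately show ?case
    by (auto simp: partial_deriv_affine intro!: Ck_mult Ck_const)
qed

text \<open>Since \<open>S\<close> is closed under differentiation, the induction on
  \<open>k\<close> can range over all its members and never needs iterated derivatives in closed
  form. This serves trigonometric functions, the functions \<open>flat P\<close> and the coordinates
  alike.\<close>

lemma Ck_coordinate:
  assumes "F \<in> S" and S: "\<And>F. F \<in> S \<Longrightarrow> \<exists>F'\<in>S. \<forall>t. (F has_real_derivative F' t) (at t)"
  shows "Ck k (\<lambda>x. F (c * x $ i + d))"
  using assms(1)
proof (induction k arbitrary: F)
  case 0
  then have "continuous_on UNIV F"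
    by (meson S DERIV_isCont continuous_at_imp_continuous_on)
  then show ?case
    by (auto intro!: continuous_on_compose2[of UNIV F] continuous_intros)
next
  case (Suc k)
  obtain F' where F': "F' \<in> S" "\<And>t. (F has_real_derivative F' t) (at t)"
    using S[OF Suc.prems] by blast
  have *: "((\<lambda>x. F (c * x $ i + d)) has_derivative (\<lambda>h. F' (c * x $ i + d) * (c * h $ i))) (at x)" for x
    by (rule has_derivative_compose[of "\<lambda>x. c * x $ i + d" "\<lambda>h. c * h $ i" x UNIV F])
       (auto intro!: derivative_eq_intros F'(2)[unfolded has_field_derivative_def]
         bounded_linear_imp_has_derivative bounded_linear_vec_nth)
  have "partial_deriv j (\<lambda>x. F (c * x $ i + d)) = (\<lambda>x. (c * axis j 1 $ i) * F' (c * x $ i + d))" for j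
    by (rule ext) (simp add: partial_deriv_eqI[OF *])
  then show ?case
    using Suc.IH[OF F'(1)] * by (auto simp: differentiable_on_def differentiable_def
        intro!: Ck_mult Ck_const)
qed

lemma Ck_sin_cos:
  "Ck k (\<lambda>x. cos (c * x $ i + d))" "Ck k (\<lambda>x. sin (c * x $ i + d))"
proof -
  let ?S = "{cos, sin, \<lambda>t. - cos t, \<lambda>t. - sin t} :: (real \<Rightarrow> real) set"
  have "\<exists>F'\<in>?S. \<forall>t. (F has_real_derivative F' t) (at t)" if "F \<in> ?S" for F
    using that by (auto intro!: derivative_eq_intros)
  then show "Ck k (\<lambda>x. cos (c * x $ i + d))" "Ck k (\<lambda>x. sin (c * x $ i + d))"
    by (auto intro!: Ck_coordinate[where S="?S"])
qed

section \<open>Flat functions built from exp(-1/t)\<close>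

definition flat :: "real poly \<Rightarrow> real \<Rightarrow> real" where
  "flat P t = (if t > 0 then poly P (inverse t) * exp (- inverse t) else 0)"

lemma poly_exp_tendsto_0: "((\<lambda>x. poly P x * exp (- x)) \<longlongrightarrow> (0::real)) at_top"
proof -
  have "((\<lambda>x. \<Sum>i\<le>degree P. coeff P i * (x ^ i / exp x)) \<longlongrightarrow> (\<Sum>i\<le>degree P. coeff P i * 0)) at_top"
    by (intro tendsto_intros tendsto_power_div_exp_0)
  moreover have "(\<lambda>x. poly P x * exp (- x)) = (\<lambda>x. \<Sum>i\<le>degree P. coeff P i * (x ^ i / exp x))"
    by (rule ext) (simp add: poly_altdef sum_distrib_right exp_minus divide_inverse mult.assoc)
  ultimately show ?thesis by simp
qed

text \<open>The polynomial \<open>[:0, 0, 1:]\<close> is X^2: for t > 0 the derivative of P(1/t)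
  exp(-1/t) is t^(-2) (P - P')(1/t) exp(-1/t), again of the same form. This closure is the reason
  for carrying a polynomial factor along.\<close>

lemma flat_has_derivative:
  "(flat P has_real_derivative flat ([:0, 0, 1:] * (P - pderiv P)) t) (at t)"
proof -
  consider "t > 0" | "t < 0" | "t = 0" by linarith
  then show ?thesis
  proof cases
    case 1
    have "((\<lambda>t. poly P (inverse t) * exp (- inverse t)) has_real_derivative
        flat ([:0, 0, 1:] * (P - pderiv P)) t) (at t)"
      using 1 by (auto intro!: derivative_eq_intros poly_DERIV simp: flat_def algebra_simps power2_eq_square)
    then show ?thesis
      by (rule has_field_derivative_transform_within_open[where S="{0<..}"]) (use 1 in \<open>auto simp: flat_def\<close>)
  next
    case 2
    show ?thesis
      by (rule has_field_derivative_transform_within_open[where S="{..<0}" and f="\<lambda>_. 0"])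
         (use 2 in \<open>auto simp: flat_def\<close>)
  next
    case 3
    \<comment> \<open>The right-hand difference quotient at 0 is Q(1/h) exp(-1/h) with Q = X P, and
      the exponential beats the polynomial.\<close>
    have "((\<lambda>h. poly ([:0, 1:] * P) (inverse h) * exp (- inverse h)) \<longlongrightarrow> 0) (at_right 0)"
      using filterlim_compose[OF poly_exp_tendsto_0 filterlim_inverse_at_top_right] .
    then have r: "((\<lambda>h. (flat P h - flat P 0) / h) \<longlongrightarrow> 0) (at_right 0)"
      by (rule Lim_transform_eventually)
         (auto simp: flat_def eventually_at_filter divide_inverse algebra_simps)
    have "((\<lambda>h. (flat P h - flat P 0) / h) \<longlongrightarrow> 0) (at_left 0)"
      by (rule tendsto_eventually) (auto simp: flat_def eventually_at_filter)
    with r have "((\<lambda>h. (flat P h - flat P 0) / h) \<longlongrightarrow> 0) (at 0)"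
      by (simp add: filterlim_split_at)
    then show ?thesis
      using 3 by (simp add: has_field_derivative_iff flat_def)
  qed
qed

lemma Ck_flat: "Ck k (\<lambda>x. flat P (c * x $ i + d))"
proof (rule Ck_coordinate[where S="range flat"])
  show "\<exists>F'\<in>range flat. \<forall>t. (F has_real_derivative F' t) (at t)" if "F \<in> range flat" for F
    using that flat_has_derivative by blast
qed simp

lemma flat_1_bounds: "0 \<le> flat 1 t" "flat 1 t \<le> 1"
  by (auto simp: flat_def)

section \<open>Smooth bumps supported on boxes\<close>

lemma test_functionI:
  assumes "\<And>k. Ck k \<phi>" and "compact K" and "\<And>x. x \<notin> K \<Longrightarrow> \<phi> x = 0"
  shows "test_function \<phi>"
proof -
  have "closure {x. \<phi> x \<noteq> 0} \<subseteq> K"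
    using assms(2,3) by (intro closure_minimal) (auto simp: compact_imp_closed)
  then have "compact (K \<inter> closure {x. \<phi> x \<noteq> 0})"
    using assms(2) by (intro compact_Int_closed) auto
  then show ?thesis
    using assms(1) \<open>closure {x. \<phi> x \<noteq> 0} \<subseteq> K\<close> by (simp add: test_function_def Int_absorb1)
qed

text \<open>The parameter \<open>r\<close> only steepens the edges: for every \<open>r > 0\<close>
  the nonzero set is exactly the open box, and as \<open>r\<close> grows the bumps tend to its
  indicator. Test functions can thus reproduce integrals over boxes.\<close>

definition box_bump :: "real \<Rightarrow> real^2 \<Rightarrow> real^2 \<Rightarrow> real^2 \<Rightarrow> real" where
  "box_bump r a b x = (\<Prod>i\<in>UNIV. flat 1 (r * (x $ i - a $ i)) * flat 1 (r * (b $ i - x $ i)))"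

lemma box_bump_bounds: "0 \<le> box_bump r a b x" "box_bump r a b x \<le> 1"
  unfolding box_bump_def
  by (auto intro!: prod_nonneg prod_le_1 mult_nonneg_nonneg mult_le_one flat_1_bounds)

lemma box_bump_eq_0_iff:
  assumes "r > 0" shows "box_bump r a b x = 0 \<longleftrightarrow> x \<notin> box a b"
proof -
  have "flat 1 s = 0 \<longleftrightarrow> s \<le> 0" for s by (auto simp: flat_def)
  then show ?thesis
    using assms by (auto simp: box_bump_def mem_box_cart mult_le_0_iff not_less)
qed

lemma test_function_box_bump:
  assumes "r > 0" shows "test_function (box_bump r a b)"
proof (rule test_functionI[OF _ compact_cbox[of a b]])
  show "Ck k (box_bump r a b)" for k
    unfolding box_bump_def
    using Ck_flat[of k 1 r _ "- r * a $ _"] Ck_flat[of k 1 "- r" _ "r * b $ _"]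
    by (auto intro!: Ck_prod Ck_mult simp: algebra_simps)
  show "x \<notin> cbox a b \<Longrightarrow> box_bump r a b x = 0" for x
    using box_bump_eq_0_iff[OF assms] box_subset_cbox by blast
qed

lemma box_bump_tendsto_indicator:
  "(\<lambda>n. box_bump (real (Suc n)) a b x) \<longlonglongrightarrow> indicator (box a b) x"
proof (cases "x \<in> box a b")
  case True
  have lim: "(\<lambda>n. flat 1 (real (Suc n) * s)) \<longlonglongrightarrow> 1" if "s > 0" for s
  proof -
    have "(\<lambda>n. exp (- (inverse (real (Suc n)) * inverse s))) \<longlonglongrightarrow> exp (- (0 * inverse s))"
      by (intro tendsto_intros LIMSEQ_inverse_real_of_nat)
    then show ?thesis
      using that by (simp add: flat_def)
  qed
  have "(\<lambda>n. box_bump (real (Suc n)) a b x) \<longlonglongrightarrow> (\<Prod>i\<in>(UNIV::2 set). 1 * 1)"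
    unfolding box_bump_def using True
    by (intro tendsto_prod tendsto_mult lim) (auto simp: mem_box_cart)
  then show ?thesis using True by simp
next
  case False
  then have "box_bump (real (Suc n)) a b x = 0" for n
    by (subst box_bump_eq_0_iff) auto
  then show ?thesis
    using False by simp
qed

section \<open>Test functions and uniqueness of weak gradients\<close>

lemma test_function_support:
  assumes "test_function \<phi>"
  obtains R where "R > 0" "\<And>x. norm x \<ge> R \<Longrightarrow> \<phi> x = 0"
proof -
  have "bounded {x. \<phi> x \<noteq> 0}"
    using assms bounded_subset[OF compact_imp_bounded closure_subset]
    by (auto simp: test_function_def)
  then obtain R where "R > 0" "\<forall>x\<in>{x. \<phi> x \<noteq> 0}. norm x \<le> R"
    using bounded_pos by blast
  then show ?thesis
    by (intro that[of "R + 1"]) force+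
qed

lemma test_function_Ck: "test_function \<phi> \<Longrightarrow> Ck k \<phi>"
  by (simp add: test_function_def)

lemma test_function_differentiable: "test_function \<phi> \<Longrightarrow> \<phi> differentiable_on UNIV"
  using test_function_Ck[of \<phi> "Suc 0"] by simp

lemma test_function_continuous: "test_function \<phi> \<Longrightarrow> continuous_on A \<phi>"
  using test_function_Ck[of \<phi> 0] continuous_on_subset by auto

lemma test_function_measurable [measurable_dest]: "test_function \<phi> \<Longrightarrow> \<phi> \<in> borel_measurable borel"
  by (intro borel_measurable_continuous_onI test_function_continuous)

lemma test_functionI_ball:
  assumes "\<And>k. Ck k \<phi>" and "\<And>x. norm x \<ge> R \<Longrightarrow> \<phi> x = 0"
  shows "test_function \<phi>"
  using assms by (intro test_functionI[of _ "cball 0 R"]) auto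

lemma test_function_partial_deriv:
  assumes "test_function \<phi>" shows "test_function (partial_deriv j \<phi>)"
proof (rule test_functionI)
  show "Ck k (partial_deriv j \<phi>)" for k
    using test_function_Ck[OF assms, of "Suc k"] by simp
  show "compact (closure {x. \<phi> x \<noteq> 0})"
    using assms by (simp add: test_function_def)
  fix x assume x: "x \<notin> closure {x. \<phi> x \<noteq> 0}"
  have "(\<phi> has_derivative (\<lambda>_. 0)) (at x)"
    by (rule has_derivative_transform_within_open[where f="\<lambda>_. 0" and s="- closure {x. \<phi> x \<noteq> 0}"])
       (use x closure_subset[of "{x. \<phi> x \<noteq> 0}"] in auto)
  then show "partial_deriv j \<phi> x = 0"
    by (simp add: partial_deriv_eqI)
qed

lemma test_function_affine_arg:
  assumes "test_function \<phi>" "c \<noteq> 0" shows "test_function (\<lambda>x. \<phi> (v + c *\<^sub>R x))"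
proof -
  obtain R where R: "R > 0" "\<And>x. norm x \<ge> R \<Longrightarrow> \<phi> x = 0"
    using test_function_support[OF assms(1)] by metis
  show ?thesis
  proof (rule test_functionI_ball[where R="(R + norm v) / \<bar>c\<bar>"])
    show "Ck k (\<lambda>x. \<phi> (v + c *\<^sub>R x))" for k
      by (intro Ck_affine_arg test_function_Ck assms)
    fix x :: "real^2" assume "norm x \<ge> (R + norm v) / \<bar>c\<bar>"
    then have "R + norm v \<le> norm (c *\<^sub>R x)"
      using assms(2) by (simp add: field_simps)
    also have "\<dots> \<le> norm (v + c *\<^sub>R x) + norm v"
      by (metis add_diff_cancel_left' norm_triangle_ineq4)
    finally show "\<phi> (v + c *\<^sub>R x) = 0"
      by (intro R) simp
  qed
qed

lemma test_function_mult:
  assumes "test_function \<phi>" "\<And>k. Ck k g" shows "test_function (\<lambda>x. g x * \<phi> x)"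
proof -
  obtain R where R: "R > 0" "\<And>x. norm x \<ge> R \<Longrightarrow> \<phi> x = 0"
    using test_function_support[OF assms(1)] by metis
  show ?thesis
    by (rule test_functionI_ball[where R=R]) (auto intro: Ck_mult assms test_function_Ck R)
qed

lemma test_function_bounded:
  assumes "test_function \<phi>"
  obtains M where "M > 0" "\<And>x. \<bar>\<phi> x\<bar> \<le> M"
proof -
  obtain R where R: "R > 0" "\<And>x. norm x \<ge> R \<Longrightarrow> \<phi> x = 0"
    using test_function_support[OF assms(1)] by metis
  have "bounded (\<phi> ` cball 0 R)"
    by (intro compact_imp_bounded compact_continuous_image test_function_continuous assms) auto
  then obtain M where M: "M > 0" "\<forall>y\<in>\<phi> ` cball 0 R. norm y \<le> M"
    using bounded_pos by blast
  have "\<bar>\<phi> x\<bar> \<le> M" for x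
    using M R(2)[of x] by (cases "norm x \<le> R") (auto simp: image_iff)
  then show ?thesis
    using that M(1) by blast
qed

lemma test_function_line_derivative:
  assumes "test_function \<phi>"
  shows "((\<lambda>t. \<phi> (x + t *\<^sub>R axis j 1)) has_real_derivative
    partial_deriv j \<phi> (x + t *\<^sub>R axis j 1)) (at t)"
proof -
  let ?D = "frechet_derivative \<phi> (at (x + t *\<^sub>R axis j 1))"
  have \<phi>: "(\<phi> has_derivative ?D) (at (x + t *\<^sub>R axis j 1))"
    by (intro differentiable_on_UNIV_has_derivative test_function_differentiable assms)
  have "((\<lambda>t. \<phi> (x + t *\<^sub>R axis j 1)) has_derivative (\<lambda>h. ?D (h *\<^sub>R axis j 1))) (at t)"
    by (rule has_derivative_compose[of "\<lambda>t. x + t *\<^sub>R axis j 1" "\<lambda>h. h *\<^sub>R axis j 1" t UNIV \<phi>])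
       (auto intro!: derivative_eq_intros \<phi>)
  moreover have "?D (h *\<^sub>R axis j 1) = h * ?D (axis j 1)" for h
    using linear_scale[OF has_derivative_linear[OF \<phi>]] by simp
  ultimately show ?thesis
    unfolding has_field_derivative_def partial_deriv_def by (simp add: mult.commute[of _ "?D _"])
qed

section \<open>Local integrability and the fundamental lemma of the calculus of variations\<close>

lemma locally_integrable_ball:
  "locally_integrable f \<Longrightarrow> integrable lborel (\<lambda>x. indicator (cball 0 R) x *\<^sub>R f x)"
  unfolding locally_integrable_def set_integrable_def by auto

lemma locally_integrable_measurable:
  assumes "locally_integrable f" shows "f \<in> borel_measurable borel"
proof (rule borel_measurable_LIMSEQ_metric)
  show "(\<lambda>x. indicator (cball 0 (real n)) x *\<^sub>R f x) \<in> borel_measurable borel" for n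
    using borel_measurable_integrable[OF locally_integrable_ball[OF assms, of n]] by simp
  fix x :: "real^2"
  obtain N where "norm x \<le> real N" using real_arch_simple by blast
  then have "\<forall>\<^sub>F n in sequentially. indicator (cball 0 (real n)) x *\<^sub>R f x = f x"
    by (intro eventually_sequentiallyI[of N]) (auto simp: indicator_def)
  then show "(\<lambda>n. indicator (cball 0 (real n)) x *\<^sub>R f x) \<longlonglongrightarrow> f x"
    by (rule tendsto_eventually)
qed

lemma locally_integrableI:
  assumes f: "f \<in> borel_measurable borel"
    and "\<And>R. integrable lborel (\<lambda>x. indicator (cball 0 R) x *\<^sub>R f x)"
  shows "locally_integrable f"
  unfolding locally_integrable_def set_integrable_def
proof (intro allI impI)
  fix K :: "(real^2) set" assume K: "compact K"
  then obtain R where "\<forall>x\<in>K. norm x \<le> R"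
    using bounded_iff compact_imp_bounded by blast
  moreover have [measurable]: "K \<in> sets borel" using K borel_compact by blast
  ultimately show "integrable lborel (\<lambda>x. indicator K x *\<^sub>R f x)"
    using f by (intro Bochner_Integration.integrable_bound[OF assms(2)[of R]])
      (auto simp: indicator_def)
qed

lemma locally_integrable_component:
  fixes G :: "real^2 \<Rightarrow> 'b::euclidean_space^2"
  assumes "locally_integrable G" shows "locally_integrable (\<lambda>x. G x $ j)"
  using assms integrable_bounded_linear[OF bounded_linear_vec_nth]
  unfolding locally_integrable_def set_integrable_def by fastforce

lemma integrable_test_function_scaleR:
  fixes f :: "real^2 \<Rightarrow> 'b::euclidean_space"
  assumes \<phi>: "test_function \<phi>" and f: "locally_integrable f"
  shows "integrable lborel (\<lambda>x. \<phi> x *\<^sub>R f x)"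
proof -
  obtain R where R: "R > 0" "\<And>x. norm x \<ge> R \<Longrightarrow> \<phi> x = 0"
    using test_function_support[OF \<phi>] by metis
  obtain M where M: "M > 0" "\<And>x. \<bar>\<phi> x\<bar> \<le> M"
    using test_function_bounded[OF \<phi>] by metis
  note [measurable] = test_function_measurable[OF \<phi>] locally_integrable_measurable[OF f]
  show ?thesis
  proof (rule Bochner_Integration.integrable_bound)
    show "integrable lborel (\<lambda>x. M *\<^sub>R (indicator (cball 0 R) x *\<^sub>R f x))"
      by (intro integrable_scaleR_right locally_integrable_ball f)
    show "AE x in lborel. norm (\<phi> x *\<^sub>R f x) \<le> norm (M *\<^sub>R indicator (cball 0 R) x *\<^sub>R f x)"
      using M R by (intro AE_I2) (auto simp: indicator_def intro!: mult_right_mono)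
  qed measurable
qed

lemma locally_integrable_continuous:
  assumes "continuous_on UNIV f" shows "locally_integrable f"
  using borel_integrable_compact[OF _ continuous_on_subset[OF assms]]
  unfolding locally_integrable_def set_integrable_def by auto

lemma integrable_test_function:
  assumes "test_function \<phi>" shows "integrable lborel \<phi>"
  using integrable_test_function_scaleR[OF assms locally_integrable_continuous[of "\<lambda>_. 1::real"]]
  by simp

text \<open>The sets over which \<open>f\<close> integrates to zero are closed under complements and
  countable disjoint unions, and the boxes are an intersection-stable generator of the Borel sets.
  Complements require the total integral to vanish, which holds because \<open>f\<close> lives in a
  single box.\<close>

lemma AE_eq_0_if_box_integrals_eq_0:
  fixes f :: "'a::euclidean_space \<Rightarrow> 'b::euclidean_space"
  assumes f: "integrable lborel f"
    and Q: "\<And>x. x \<notin> box c d \<Longrightarrow> f x = 0"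
    and box: "\<And>a b. (LINT x|lborel. indicator (box a b) x *\<^sub>R f x) = 0"
  shows "AE x in lborel. f x = 0"
proof (rule sigma_finite_measure.density_zero[OF sigma_finite_lborel f])
  fix A :: "'a set" assume "A \<in> sets lborel"
  then have A: "A \<in> sigma_sets UNIV (range (\<lambda>(a, b). box a b))"
    by (metis borel_eq_box sets_lborel sets_measure_of_conv top_greatest Pow_UNIV)
  have sets: "A \<in> sets lborel" if "A \<in> sigma_sets UNIV (range (\<lambda>(a, b). box a b))" for A :: "'a set"
    using that by (metis borel_eq_box sets_lborel sets_measure_of_conv top_greatest Pow_UNIV)
  have int: "set_integrable lborel A f" if "A \<in> sets lborel" for A
    using integrable_mult_indicator[OF that f] by (simp add: set_integrable_def)
  have all: "(LINT x|lborel. f x) = 0"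
    using box[of c d] Q by (metis (mono_tags, lifting) Bochner_Integration.integral_cong indicator_simps scaleR_one scaleR_zero_left)
  have stable: "Int_stable (range (\<lambda>(a, b). box a b :: 'a set))"
    by (auto simp: Int_stable_def Int_interval box_Int_box)
  have sub: "range (\<lambda>(a, b). box a b :: 'a set) \<subseteq> Pow UNIV"
    by simp
  from stable sub A show "set_lebesgue_integral lborel A f = 0"
  proof (induction rule: sigma_sets_induct_disjoint)
    case (basic A)
    then show ?case using box by (auto simp: set_lebesgue_integral_def)
  next
    case (compl A)
    have "set_lebesgue_integral lborel (A \<union> (UNIV - A)) f =
        set_lebesgue_integral lborel A f + set_lebesgue_integral lborel (UNIV - A) f"
      using sets[OF compl(1)] by (intro set_integral_Un int) auto
    then show ?case
      using compl all by (simp add: set_lebesgue_integral_def)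
  next
    case (union A)
    have A: "A i \<in> sets lborel" for i
      using union sets by blast
    have "set_lebesgue_integral lborel (\<Union>i. A i) f = (\<Sum>i. set_lebesgue_integral lborel (A i) f)"
      using union(1) A by (intro lebesgue_integral_countable_add int sets.countable_UN)
        (auto simp: disjoint_family_on_def)
    then show ?case using union by simp
  qed (auto simp: set_lebesgue_integral_def)
qed

text \<open>Steepening bumps turn the test integrals into box integrals by dominated convergence. As
  \<open>f\<close> is only locally integrable, the box criterion is applied to its restrictions to
  growing cubes; this is possible because two boxes intersect in a box.\<close>

lemma AE_eq_0_if_test_integrals_eq_0:
  fixes f :: "real^2 \<Rightarrow> 'b::euclidean_space"
  assumes f: "locally_integrable f"
    and 0: "\<And>\<phi>. test_function \<phi> \<Longrightarrow> (LINT x|lborel. \<phi> x *\<^sub>R f x) = 0"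
  shows "AE x in lborel. f x = 0"
proof -
  note [measurable] = locally_integrable_measurable[OF f]
  have int: "integrable lborel (\<lambda>x. indicator (box a b) x *\<^sub>R f x)" for a b :: "real^2"
  proof (rule Bochner_Integration.integrable_bound)
    show "integrable lborel (\<lambda>x. indicator (cbox a b) x *\<^sub>R f x)"
      using f unfolding locally_integrable_def set_integrable_def by auto
  qed (use box_subset_cbox in \<open>auto simp: indicator_def intro!: AE_I2\<close>)
  have box: "(LINT x|lborel. indicator (box a b) x *\<^sub>R f x) = 0" for a b :: "real^2"
  proof -
    have "(\<lambda>n. LINT x|lborel. box_bump (real (Suc n)) a b x *\<^sub>R f x)
        \<longlonglongrightarrow> (LINT x|lborel. indicator (box a b) x *\<^sub>R f x)"
    proof (rule integral_dominated_convergence[where w="\<lambda>x. norm (indicator (box a b) x *\<^sub>R f x)"])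
      show "AE x in lborel. (\<lambda>n. box_bump (real (Suc n)) a b x *\<^sub>R f x) \<longlonglongrightarrow> indicator (box a b) x *\<^sub>R f x"
        by (intro AE_I2 tendsto_intros box_bump_tendsto_indicator)
      show "AE x in lborel. norm (box_bump (real (Suc n)) a b x *\<^sub>R f x) \<le> norm (indicator (box a b) x *\<^sub>R f x)" for n
      proof (rule AE_I2)
        fix x
        have "box_bump (real (Suc n)) a b x \<le> indicator (box a b) x"
          using box_bump_bounds(2)[of "real (Suc n)" a b x] box_bump_eq_0_iff[of "real (Suc n)" a b x]
          by (cases "x \<in> box a b") (auto simp del: of_nat_Suc)
        then show "norm (box_bump (real (Suc n)) a b x *\<^sub>R f x) \<le> norm (indicator (box a b) x *\<^sub>R f x)"
          using box_bump_bounds(1)[of "real (Suc n)" a b x]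
          by (auto intro!: mult_right_mono simp del: of_nat_Suc)
      qed
      show "(\<lambda>x. box_bump (real (Suc n)) a b x *\<^sub>R f x) \<in> borel_measurable lborel" for n
        using test_function_measurable[OF test_function_box_bump[of "real (Suc n)" a b]] by simp
      show "integrable lborel (\<lambda>x. norm (indicator (box a b) x *\<^sub>R f x))"
        by (rule integrable_norm[OF int])
    qed auto
    then show ?thesis
      using 0[OF test_function_box_bump] by (simp add: LIMSEQ_const_iff)
  qed
  have "AE x in lborel. \<forall>n. indicator (box (vec (- real n)) (vec (real n))) x *\<^sub>R f x = 0"
    unfolding AE_all_countable
  proof
    fix n
    let ?Q = "box (vec (- real n)) (vec (real n)) :: (real^2) set"
    have "(LINT x|lborel. indicator (box a b) x *\<^sub>R indicator ?Q x *\<^sub>R f x) = 0" for a b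
    proof -
      obtain a' b' where "box a b \<inter> ?Q = box a' b'"
        unfolding box_Int_box by blast
      then have "indicator (box a' b') x = indicator (box a b) x * (indicator ?Q x :: real)" for x
        by (metis indicator_inter_arith)
      then show ?thesis using box[of a' b'] by simp
    qed
    then show "AE x in lborel. indicator ?Q x *\<^sub>R f x = 0"
      by (intro AE_eq_0_if_box_integrals_eq_0[OF int, where c="vec (- real n)" and d="vec (real n)"]) auto
  qed
  then show ?thesis
  proof eventually_elim
    case (elim x)
    obtain n where n: "norm x < real n" using reals_Archimedean2 by blast
    have "x \<in> box (vec (- real n)) (vec (real n))"
      unfolding mem_box_cart
    proof
      fix i
      show "vec (- real n) $ i < x $ i \<and> x $ i < vec (real n) $ i"
        using component_le_norm_cart[of x i] n by auto
    qed
    then show ?case using elim[rule_format, of n] by simp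
  qed
qed

section \<open>Uniqueness of weak gradients\<close>

lemma is_weak_grad_unique:
  fixes u :: "real^2 \<Rightarrow> 'b::euclidean_space"
  assumes G: "is_weak_grad u G" and G': "is_weak_grad u G'"
  shows "AE x in lborel. G x = G' x"
proof -
  have li: "locally_integrable (\<lambda>x. G x $ j)" "locally_integrable (\<lambda>x. G' x $ j)" for j
    using assms locally_integrable_component by (auto simp: is_weak_grad_def)
  have "AE x in lborel. \<forall>j\<in>UNIV. G x $ j - G' x $ j = 0"
  proof (rule AE_finite_allI)
    fix j
    show "AE x in lborel. G x $ j - G' x $ j = 0"
    proof (rule AE_eq_0_if_test_integrals_eq_0)
      show "locally_integrable (\<lambda>x. G x $ j - G' x $ j)"
        using li[of j] unfolding locally_integrable_def by (auto intro: set_integral_diff)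
      show "(LINT x|lborel. \<phi> x *\<^sub>R (G x $ j - G' x $ j)) = 0" if \<phi>: "test_function \<phi>" for \<phi>
        using assms \<phi> integrable_test_function_scaleR[OF \<phi> li(1)[of j]]
          integrable_test_function_scaleR[OF \<phi> li(2)[of j]]
        by (simp add: scaleR_diff_right is_weak_grad_def)
    qed
  qed simp
  then show ?thesis
    by eventually_elim (simp add: vec_eq_iff)
qed

text \<open>Makes the \<open>SOME\<close> in \<open>weak_grad\<close> harmless: any explicit weak
  gradient may be substituted for it under an integral.\<close>

lemma weak_grad_AE_eq:
  assumes "is_weak_grad u G" shows "AE x in lborel. weak_grad u x = G x"
  using is_weak_grad_unique[OF _ assms] someI[of "is_weak_grad u", OF assms]
  unfolding weak_grad_def by blast

lemma is_weak_grad_weak_grad: "\<exists>G. is_weak_grad u G \<Longrightarrow> is_weak_grad u (weak_grad u)"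
  unfolding weak_grad_def by (rule someI_ex[of "is_weak_grad u"])

section \<open>Translations and difference quotients of test functions\<close>

lemma lborel_translate:
  fixes f :: "'a::euclidean_space \<Rightarrow> 'b::{banach, second_countable_topology}"
  assumes "f \<in> borel_measurable borel"
  shows "(LINT x|lborel. f (x + c)) = (LINT x|lborel. f x)"
    and "integrable lborel (\<lambda>x. f (x + c)) \<longleftrightarrow> integrable lborel f"
  using integral_distr[of "(+) c" lborel borel f] integrable_distr_eq[of "(+) c" lborel borel f] assms
  by (auto simp: lborel_distr_plus add.commute)

text \<open>The mean value theorem bounds the quotients, and steps of size at most 1 keep all the
  shifted supports in one ball. Together this gives a dominating function although \<open>f\<close>
  is only locally integrable.\<close>

lemma test_quotient_tendsto:
  fixes f :: "real^2 \<Rightarrow> 'b::euclidean_space"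
  assumes \<phi>: "test_function \<phi>" and f: "locally_integrable f"
    and X: "X \<longlonglongrightarrow> 0" "\<And>n. X n \<noteq> 0" "\<And>n. \<bar>X n\<bar> \<le> 1"
  shows "(\<lambda>n. LINT x|lborel. ((\<phi> (x + X n *\<^sub>R axis j 1) - \<phi> x) / X n) *\<^sub>R f x)
    \<longlonglongrightarrow> (LINT x|lborel. partial_deriv j \<phi> x *\<^sub>R f x)"
proof -
  obtain R where R: "R > 0" "\<And>x. norm x \<ge> R \<Longrightarrow> \<phi> x = 0"
    using test_function_support[OF \<phi>] by metis
  obtain M where M: "M > 0" "\<And>x. \<bar>partial_deriv j \<phi> x\<bar> \<le> M"
    using test_function_bounded[OF test_function_partial_deriv[OF \<phi>]] by metis
  note [measurable] = test_function_measurable[OF \<phi>] locally_integrable_measurable[OF f]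
    test_function_measurable[OF test_function_partial_deriv[OF \<phi>]]
  let ?e = "axis j 1 :: real^2"
  let ?q = "\<lambda>n x. (\<phi> (x + X n *\<^sub>R ?e) - \<phi> x) / X n"
  have "filterlim X (at 0) sequentially"
    using X by (intro filterlim_atI) auto
  have q_lim: "(\<lambda>n. ?q n x) \<longlonglongrightarrow> partial_deriv j \<phi> x" for x
  proof -
    have "((\<lambda>h. (\<phi> (x + h *\<^sub>R ?e) - \<phi> x) / h) \<longlongrightarrow> partial_deriv j \<phi> x) (at 0)"
      using test_function_line_derivative[OF \<phi>, of x j 0]
      by (simp add: has_field_derivative_iff)
    then show ?thesis
      using \<open>filterlim X (at 0) sequentially\<close> by (rule filterlim_compose)
  qed
  have q_le: "\<bar>?q n x\<bar> \<le> indicator (cball 0 (R + 1)) x * M" for n x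
  proof (cases "norm x \<le> R + 1")
    case True
    have "\<bar>\<phi> (x + s *\<^sub>R ?e) - \<phi> (x + 0 *\<^sub>R ?e)\<bar> \<le> M * \<bar>s - 0\<bar>" for s
      using field_differentiable_bound[of UNIV "\<lambda>t. \<phi> (x + t *\<^sub>R ?e)" "\<lambda>t. partial_deriv j \<phi> (x + t *\<^sub>R ?e)" M s 0]
        test_function_line_derivative[OF \<phi>] M(2) by simp
    from this[of "X n"] show ?thesis
      using True X(2)[of n] by (simp add: field_simps)
  next
    case False
    have "norm x \<le> norm (x + X n *\<^sub>R ?e) + norm (X n *\<^sub>R ?e)"
      by (metis add_diff_cancel_right' norm_triangle_ineq4)
    moreover have "norm (X n *\<^sub>R ?e) \<le> 1"
      using X(3)[of n] by simp
    ultimately show ?thesis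
      using R(2)[of x] R(2)[of "x + X n *\<^sub>R ?e"] False by simp
  qed
  show ?thesis
  proof (rule integral_dominated_convergence[where w="\<lambda>x. M * norm (indicator (cball 0 (R + 1)) x *\<^sub>R f x)"])
    show "AE x in lborel. (\<lambda>n. ?q n x *\<^sub>R f x) \<longlonglongrightarrow> partial_deriv j \<phi> x *\<^sub>R f x"
      by (intro AE_I2 tendsto_scaleR q_lim tendsto_const)
    show "AE x in lborel. norm (?q n x *\<^sub>R f x) \<le> M * norm (indicator (cball 0 (R + 1)) x *\<^sub>R f x)" for n
    proof (rule AE_I2)
      fix x
      show "norm (?q n x *\<^sub>R f x) \<le> M * norm (indicator (cball 0 (R + 1)) x *\<^sub>R f x)"
        using mult_right_mono[OF q_le[of x n] norm_ge_zero[of "f x"]] by (simp add: mult_ac)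
    qed
    show "integrable lborel (\<lambda>x. M * norm (indicator (cball 0 (R + 1)) x *\<^sub>R f x))"
      by (intro integrable_mult_right integrable_norm locally_integrable_ball f)
  qed measurable
qed

text \<open>Translation invariance makes the integral of every difference quotient zero, and the
  limit inherits this. Applied to a product of two test functions it becomes integration by
  parts.\<close>

lemma integral_partial_deriv_eq_0:
  assumes \<phi>: "test_function \<phi>"
  shows "(LINT x|lborel. partial_deriv j \<phi> x) = 0"
proof -
  let ?h = "\<lambda>n. inverse (real (Suc n))"
  have "(LINT x|lborel. (\<phi> (x + ?h n *\<^sub>R axis j 1) - \<phi> x) / ?h n) = 0" for n
    using lborel_translate[OF test_function_measurable[OF \<phi>], of "?h n *\<^sub>R axis j 1"]
      integrable_test_function[OF \<phi>] by simp
  moreover have "(\<lambda>n. LINT x|lborel. ((\<phi> (x + ?h n *\<^sub>R axis j 1) - \<phi> x) / ?h n) *\<^sub>R (1::real))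
      \<longlonglongrightarrow> (LINT x|lborel. partial_deriv j \<phi> x *\<^sub>R 1)"
    by (rule test_quotient_tendsto[OF \<phi> locally_integrable_continuous])
       (auto simp: LIMSEQ_inverse_real_of_nat inverse_le_1_iff simp del: of_nat_Suc)
  ultimately show ?thesis
    by (simp add: LIMSEQ_const_iff del: of_nat_Suc)
qed

section \<open>Square integrable functions and magnetic translations\<close>

definition square_integrable :: "(real^2 \<Rightarrow> 'b::euclidean_space) \<Rightarrow> bool" where
  "square_integrable f \<longleftrightarrow> f \<in> borel_measurable borel \<and> integrable lborel (\<lambda>x. (norm (f x))\<^sup>2)"

text \<open>The squared norm is kept without a root. The triangle inequality then costs a factor 2,
  which is harmless where only convergence to 0 matters.\<close>

definition norm2_sq :: "(real^2 \<Rightarrow> 'b::euclidean_space) \<Rightarrow> real" where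
  "norm2_sq f = (LINT x|lborel. (norm (f x))\<^sup>2)"

lemma in_Lq_2_iff: "in_Lq 2 f \<longleftrightarrow> square_integrable f"
  by (simp add: in_Lq_def square_integrable_def)

lemma norm2_sq_nonneg [simp]: "norm2_sq f \<ge> 0"
  by (simp add: norm2_sq_def)

lemma Lq_norm_2_sq: "(Lq_norm 2 f)\<^sup>2 = norm2_sq f"
  using norm2_sq_nonneg[of f] by (simp add: Lq_norm_def norm2_sq_def powr_half_sqrt)

lemma square_integrable_measurable [measurable_dest]:
  "square_integrable f \<Longrightarrow> f \<in> borel_measurable borel"
  by (simp add: square_integrable_def)

lemma square_integrable_bound:
  assumes "integrable lborel w" "f \<in> borel_measurable borel" "\<And>x. (norm (f x))\<^sup>2 \<le> w x"
  shows "square_integrable f" "norm2_sq f \<le> (LINT x|lborel. w x)"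
proof -
  have "w x \<ge> 0" for x using assms(3)[of x] by (meson order_trans zero_le_power2)
  then have *: "integrable lborel (\<lambda>x. (norm (f x))\<^sup>2)"
    using assms by (intro Bochner_Integration.integrable_bound[OF assms(1)]) auto
  then show "square_integrable f" using assms(2) by (simp add: square_integrable_def)
  show "norm2_sq f \<le> (LINT x|lborel. w x)"
    unfolding norm2_sq_def by (intro integral_mono * assms)
qed

lemma norm_add_sq_le: "(norm (x + y))\<^sup>2 \<le> 2 * (norm x)\<^sup>2 + 2 * (norm (y::'a::real_normed_vector))\<^sup>2"
proof -
  have "(norm (x + y))\<^sup>2 \<le> (norm x + norm y)\<^sup>2"
    by (intro power_mono norm_triangle_ineq) auto
  then show ?thesis
    using sum_squares_bound[of "norm x" "norm y"] by (simp add: power2_sum)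
qed

lemma square_integrable_add:
  assumes "square_integrable f" "square_integrable g"
  shows "square_integrable (\<lambda>x. f x + g x)" "norm2_sq (\<lambda>x. f x + g x) \<le> 2 * norm2_sq f + 2 * norm2_sq g"
proof -
  have w: "integrable lborel (\<lambda>x. 2 * (norm (f x))\<^sup>2 + 2 * (norm (g x))\<^sup>2)"
    using assms by (auto simp: square_integrable_def)
  have m: "(\<lambda>x. f x + g x) \<in> borel_measurable borel"
    using assms by (auto simp: square_integrable_def)
  note b = square_integrable_bound[OF w m norm_add_sq_le]
  show "square_integrable (\<lambda>x. f x + g x)" by (rule b)
  show "norm2_sq (\<lambda>x. f x + g x) \<le> 2 * norm2_sq f + 2 * norm2_sq g"
    using b(2) assms by (simp add: norm2_sq_def square_integrable_def)
qed

lemma square_integrable_scaleR: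
  assumes "square_integrable f"
  shows "square_integrable (\<lambda>x. c *\<^sub>R f x)" "norm2_sq (\<lambda>x. c *\<^sub>R f x) = c\<^sup>2 * norm2_sq f"
  using assms by (auto simp: square_integrable_def norm2_sq_def power_mult_distrib)

lemma square_integrable_minus:
  assumes "square_integrable f"
  shows "square_integrable (\<lambda>x. - f x)" "norm2_sq (\<lambda>x. - f x) = norm2_sq f"
  using assms by (auto simp: square_integrable_def norm2_sq_def)

lemma norm2_sq_commute: "norm2_sq (\<lambda>x. f x - g x) = norm2_sq (\<lambda>x. g x - f x)"
  by (simp add: norm2_sq_def norm_minus_commute)

lemma square_integrable_diff:
  assumes "square_integrable f" "square_integrable g"
  shows "square_integrable (\<lambda>x. f x - g x)" "norm2_sq (\<lambda>x. f x - g x) \<le> 2 * norm2_sq f + 2 * norm2_sq g"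
  using square_integrable_add[OF assms(1) square_integrable_minus(1)[OF assms(2)]]
    square_integrable_minus[OF assms(2)] by auto

lemma norm2_sq_triangle:
  assumes "square_integrable f" "square_integrable g" "square_integrable h"
  shows "norm2_sq (\<lambda>x. f x - h x) \<le> 2 * norm2_sq (\<lambda>x. f x - g x) + 2 * norm2_sq (\<lambda>x. g x - h x)"
  using square_integrable_add(2)[OF square_integrable_diff(1)[OF assms(1,2)] square_integrable_diff(1)[OF assms(2,3)]]
  by simp

lemma square_integrable_norm_mult:
  assumes "square_integrable f" "square_integrable g"
  shows "integrable lborel (\<lambda>x. norm (f x) * norm (g x))"
proof (rule Bochner_Integration.integrable_bound)
  note [measurable] = assms[THEN square_integrable_measurable]
  show "integrable lborel (\<lambda>x. (norm (f x))\<^sup>2 + (norm (g x))\<^sup>2)"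
    using assms by (auto simp: square_integrable_def)
  show "AE x in lborel. norm (norm (f x) * norm (g x)) \<le> norm ((norm (f x))\<^sup>2 + (norm (g x))\<^sup>2)"
  proof (rule AE_I2)
    fix x
    have "norm (f x) * norm (g x) \<le> (norm (f x))\<^sup>2 + (norm (g x))\<^sup>2"
      using sum_squares_bound[of "norm (f x)" "norm (g x)"]
        mult_nonneg_nonneg[OF norm_ge_zero norm_ge_zero, of "f x" "g x"] by linarith
    then show "norm (norm (f x) * norm (g x)) \<le> norm ((norm (f x))\<^sup>2 + (norm (g x))\<^sup>2)"
      by simp
  qed
  show "(\<lambda>x. norm (f x) * norm (g x)) \<in> borel_measurable lborel"
    by measurable
qed

lemma Cauchy_Schwarz_norm2_sq:
  assumes f: "square_integrable f" and g: "square_integrable g"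
  shows "(LINT x|lborel. norm (f x) * norm (g x)) \<le> sqrt (norm2_sq f) * sqrt (norm2_sq g)"
proof -
  note [measurable] = assms[THEN square_integrable_measurable]
  let ?I = "LINT x|lborel. norm (f x) * norm (g x)"
  have nn: "(\<integral>\<^sup>+x. (ennreal (norm (h x)))\<^sup>2 \<partial>lborel) = ennreal (norm2_sq h)"
    if "square_integrable h" for h :: "real^2 \<Rightarrow> 'c::euclidean_space"
    using that unfolding norm2_sq_def square_integrable_def
    by (subst nn_integral_eq_integral[symmetric]) (auto simp: ennreal_power)
  have "(\<integral>\<^sup>+x. ennreal (norm (f x)) * ennreal (norm (g x)) \<partial>lborel) = ennreal ?I"
    by (subst nn_integral_eq_integral[symmetric])
       (auto simp: ennreal_mult intro!: square_integrable_norm_mult f g)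
  then have "(ennreal ?I)\<^sup>2 \<le> ennreal (norm2_sq f) * ennreal (norm2_sq g)"
    using Cauchy_Schwarz_nn_integral[of "\<lambda>x. ennreal (norm (f x))" lborel "\<lambda>x. ennreal (norm (g x))"]
    by (simp add: nn f g)
  moreover have "?I \<ge> 0" by simp
  ultimately have "?I\<^sup>2 \<le> norm2_sq f * norm2_sq g"
    by (simp add: ennreal_power ennreal_mult[symmetric])
  then have "sqrt (?I\<^sup>2) \<le> sqrt (norm2_sq f * norm2_sq g)"
    by (rule real_sqrt_le_mono)
  then show ?thesis
    using \<open>?I \<ge> 0\<close> by (simp add: real_sqrt_mult)
qed

text \<open>Continuity of the L^2 inner product: the error splits into the products of f' - f with
  g' - g, of f with g' - g, and of f' - f with g, each estimated by Cauchy-Schwarz.\<close>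

lemma tendsto_integral_cnj_mult:
  fixes f g :: "real^2 \<Rightarrow> complex"
  assumes sq: "\<And>t. square_integrable (f' t)" "\<And>t. square_integrable (g' t)"
      "square_integrable f" "square_integrable g"
    and f: "((\<lambda>t. norm2_sq (\<lambda>x. f' t x - f x)) \<longlongrightarrow> 0) F"
    and g: "((\<lambda>t. norm2_sq (\<lambda>x. g' t x - g x)) \<longlongrightarrow> 0) F"
  shows "((\<lambda>t. LINT x|lborel. cnj (f' t x) * g' t x) \<longlongrightarrow> (LINT x|lborel. cnj (f x) * g x)) F"
proof (rule Lim_transform2[OF tendsto_const], rule Lim_null_comparison)
  note [measurable] = sq[THEN square_integrable_measurable]
  let ?a = "\<lambda>t. sqrt (norm2_sq (\<lambda>x. f' t x - f x))" and ?b = "\<lambda>t. sqrt (norm2_sq (\<lambda>x. g' t x - g x))"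
  have int: "integrable lborel (\<lambda>x. cnj (h x) * k x)" if "square_integrable h" "square_integrable k"
    for h k :: "real^2 \<Rightarrow> complex"
  proof (rule Bochner_Integration.integrable_bound[OF square_integrable_norm_mult[OF that]])
    note [measurable] = that[THEN square_integrable_measurable]
    have "cnj \<in> borel_measurable borel"
      by (intro borel_measurable_continuous_onI continuous_intros)
    then show "(\<lambda>x. cnj (h x) * k x) \<in> borel_measurable lborel" by measurable
  qed (auto simp: norm_mult)
  show "\<forall>\<^sub>F t in F. norm ((LINT x|lborel. cnj (f x) * g x) - (LINT x|lborel. cnj (f' t x) * g' t x))
      \<le> ?a t * ?b t + sqrt (norm2_sq f) * ?b t + ?a t * sqrt (norm2_sq g)"
  proof (intro always_eventually allI)
    fix t
    let ?df = "\<lambda>x. f' t x - f x" and ?dg = "\<lambda>x. g' t x - g x"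
    note d = square_integrable_diff(1)[OF sq(1,3), of t] square_integrable_diff(1)[OF sq(2,4), of t]
    let ?w = "\<lambda>x. norm (?df x) * norm (?dg x) + norm (f x) * norm (?dg x) + norm (?df x) * norm (g x)"
    have w: "integrable lborel ?w"
      by (intro Bochner_Integration.integrable_add square_integrable_norm_mult sq d)
    have "norm (LINT x|lborel. cnj (f x) * g x - cnj (f' t x) * g' t x) \<le> (LINT x|lborel. ?w x)"
    proof (rule Bochner_Integration.integral_norm_bound_integral[OF _ w])
      show "integrable lborel (\<lambda>x. cnj (f x) * g x - cnj (f' t x) * g' t x)"
        by (intro Bochner_Integration.integrable_diff int sq)
      fix x
      have "cnj (f x) * g x - cnj (f' t x) * g' t x =
          - (cnj (?df x) * ?dg x + cnj (f x) * ?dg x + cnj (?df x) * g x)"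
        by (simp add: algebra_simps)
      then have "norm (cnj (f x) * g x - cnj (f' t x) * g' t x) =
          norm (cnj (?df x) * ?dg x + cnj (f x) * ?dg x + cnj (?df x) * g x)"
        by (simp only: norm_minus_cancel)
      then show "norm (cnj (f x) * g x - cnj (f' t x) * g' t x) \<le> ?w x"
        using norm_triangle_ineq[of "cnj (?df x) * ?dg x + cnj (f x) * ?dg x" "cnj (?df x) * g x"]
          norm_triangle_ineq[of "cnj (?df x) * ?dg x" "cnj (f x) * ?dg x"]
        unfolding norm_mult complex_mod_cnj by linarith
    qed
    also have "(LINT x|lborel. ?w x) = (LINT x|lborel. norm (?df x) * norm (?dg x)) +
        (LINT x|lborel. norm (f x) * norm (?dg x)) + (LINT x|lborel. norm (?df x) * norm (g x))"
      by (simp add: square_integrable_norm_mult sq d)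
    also have "\<dots> \<le> ?a t * ?b t + sqrt (norm2_sq f) * ?b t + ?a t * sqrt (norm2_sq g)"
      by (intro add_mono Cauchy_Schwarz_norm2_sq sq d)
    finally show "norm ((LINT x|lborel. cnj (f x) * g x) - (LINT x|lborel. cnj (f' t x) * g' t x))
      \<le> ?a t * ?b t + sqrt (norm2_sq f) * ?b t + ?a t * sqrt (norm2_sq g)"
      by (simp add: int sq)
  qed
  have a: "(?a \<longlongrightarrow> 0) F" and b: "(?b \<longlongrightarrow> 0) F"
    using tendsto_real_sqrt[OF f] tendsto_real_sqrt[OF g] by simp_all
  have "((\<lambda>t. ?a t * ?b t + sqrt (norm2_sq f) * ?b t + ?a t * sqrt (norm2_sq g)) \<longlongrightarrow>
      0 * 0 + sqrt (norm2_sq f) * 0 + 0 * sqrt (norm2_sq g)) F"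
    by (intro tendsto_intros a b)
  then show "((\<lambda>t. ?a t * ?b t + sqrt (norm2_sq f) * ?b t + ?a t * sqrt (norm2_sq g)) \<longlongrightarrow> 0) F"
    by simp
qed

lemma norm2_sq_dominated_convergence:
  fixes f :: "nat \<Rightarrow> real^2 \<Rightarrow> 'b::euclidean_space"
  assumes [measurable]: "\<And>n. f n \<in> borel_measurable borel"
    and lim: "AE x in lborel. (\<lambda>n. f n x) \<longlonglongrightarrow> 0"
    and w: "integrable lborel w" "\<And>n x. (norm (f n x))\<^sup>2 \<le> w x"
  shows "(\<lambda>n. norm2_sq (f n)) \<longlonglongrightarrow> 0"
proof -
  have "(\<lambda>n. LINT x|lborel. (norm (f n x))\<^sup>2) \<longlonglongrightarrow> (LINT x|(lborel :: (real^2) measure). 0)"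
  proof (rule integral_dominated_convergence[where w=w])
    show "AE x in lborel. (\<lambda>n. (norm (f n x))\<^sup>2) \<longlonglongrightarrow> 0"
      using lim by eventually_elim (auto intro!: tendsto_eq_intros)
  qed (use w in auto)
  then show ?thesis by (simp add: norm2_sq_def)
qed

section \<open>Density of continuous functions with compact support\<close>

lemma integrable_ball_const: "integrable lborel (\<lambda>x :: real^2. indicator (cball 0 R) x * (M::real))"
  using locally_integrable_ball[OF locally_integrable_continuous[of "\<lambda>_. M"], of R] by simp

text \<open>Truncation first makes the function bounded with bounded support. A Lusin-type sequence
  of continuous functions then converges to it almost everywhere, and cutting these off uniformly
  makes dominated convergence applicable.\<close>

lemma square_integrable_dense:
  fixes g :: "real^2 \<Rightarrow> complex"
  assumes g: "square_integrable g" and e: "e > 0"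
  obtains k R where "continuous_on UNIV k" "R > 0" "\<And>x. norm x \<ge> R \<Longrightarrow> k x = 0"
    "square_integrable k" "norm2_sq (\<lambda>x. g x - k x) < e"
proof -
  note [measurable] = square_integrable_measurable[OF g]
  let ?t = "\<lambda>n x. if norm x \<le> real n \<and> norm (g x) \<le> real n then g x else 0"
  have "(\<lambda>n. norm2_sq (\<lambda>x. g x - ?t n x)) \<longlonglongrightarrow> 0"
  proof (rule norm2_sq_dominated_convergence)
    show "AE x in lborel. (\<lambda>n. g x - ?t n x) \<longlonglongrightarrow> 0"
    proof (rule AE_I2)
      fix x
      obtain N where "max (norm x) (norm (g x)) \<le> real N" using real_arch_simple by blast
      then have "\<forall>\<^sub>F n in sequentially. g x - ?t n x = 0"
        by (intro eventually_sequentiallyI[of N]) auto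
      then show "(\<lambda>n. g x - ?t n x) \<longlonglongrightarrow> 0" by (rule tendsto_eventually)
    qed
    show "integrable lborel (\<lambda>x. (norm (g x))\<^sup>2)" using g by (simp add: square_integrable_def)
    show "(norm (g x - ?t n x))\<^sup>2 \<le> (norm (g x))\<^sup>2" for n x by auto
  qed measurable
  then have "\<forall>\<^sub>F n in sequentially. norm2_sq (\<lambda>x. g x - ?t n x) < e / 4"
    using e by (intro order_tendstoD) auto
  then obtain n where n: "norm2_sq (\<lambda>x. g x - ?t n x) < e / 4"
    by (auto simp: eventually_sequentially)
  define t where "t = ?t n"
  define M where "M = real n + 1"
  have M: "M > 0" "\<And>x. norm (t x) \<le> M" "\<And>x. norm x > M \<Longrightarrow> t x = 0"
    by (auto simp: M_def t_def)
  have [measurable]: "t \<in> borel_measurable borel"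
    unfolding t_def by measurable
  have "t \<in> borel_measurable lebesgue"
    using measurable_completion[of t lborel borel] by simp
  then have "t measurable_on UNIV"
    using lebesgue_measurable_imp_measurable_on[of t UNIV] by (simp add: lebesgue_on_UNIV_eq)
  then obtain N h where h: "negligible N" "\<And>i. continuous_on UNIV (h i)"
    "\<And>x. x \<notin> N \<Longrightarrow> (\<lambda>i. h i x) \<longlonglongrightarrow> t x"
    unfolding measurable_on_def by auto
  \<comment> \<open>The first factor is a cut-off, equal to 1 on the ball of radius \<open>M\<close>
    and to 0 beyond radius \<open>M + 1\<close>; the second retracts the values radially onto the
    disc of radius \<open>M\<close>. Both leave \<open>t\<close> unchanged, so the limit is
    preserved while \<open>k i\<close> gains a bound uniform in \<open>i\<close>.\<close>
  define k where "k = (\<lambda>i x. (max 0 (min 1 (M + 1 - norm x)) * (M / max M (norm (h i x)))) *\<^sub>R h i x)"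
  have k_cont: "continuous_on UNIV (k i)" for i
    unfolding k_def using M(1) h(2)
    by (intro continuous_intros) (auto simp: max_def)
  have k0: "k i x = 0" if "norm x \<ge> M + 1" for i x
    using that by (simp add: k_def)
  have k_le: "norm (k i x) \<le> M" for i x
  proof -
    have "(M / max M (norm (h i x))) * norm (h i x) \<le> M"
      using M(1) by (auto simp: max_def field_simps)
    then have "\<bar>max 0 (min 1 (M + 1 - norm x))\<bar> * ((M / max M (norm (h i x))) * norm (h i x)) \<le> 1 * M"
      using M(1) by (intro mult_mono) (auto simp: max_def)
    then show ?thesis
      using M(1) by (simp add: k_def abs_mult)
  qed
  have [measurable]: "k i \<in> borel_measurable borel" for i
    by (intro borel_measurable_continuous_onI k_cont)
  have t_eq: "(max 0 (min 1 (M + 1 - norm x)) * (M / max M (norm (t x)))) *\<^sub>R t x = t x" for x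
    using M(1) M(2)[of x] M(3)[of x] by (cases "norm x > M") auto
  have "(\<lambda>i. norm2_sq (\<lambda>x. t x - k i x)) \<longlonglongrightarrow> 0"
  proof (rule norm2_sq_dominated_convergence)
    have "N \<in> null_sets lebesgue" using h(1) by (simp add: negligible_iff_null_sets)
    then have "AE x in lebesgue. x \<notin> N" by (rule AE_not_in)
    then have "AE x in lborel. x \<notin> N" by (simp add: AE_completion_iff)
    then show "AE x in lborel. (\<lambda>i. t x - k i x) \<longlonglongrightarrow> 0"
    proof eventually_elim
      case (elim x)
      have "(\<lambda>i. k i x) \<longlonglongrightarrow> (max 0 (min 1 (M + 1 - norm x)) * (M / max M (norm (t x)))) *\<^sub>R t x"
        unfolding k_def using M(1) by (intro tendsto_intros h(3) elim) auto
      then have "(\<lambda>i. t x - k i x) \<longlonglongrightarrow> t x - t x"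
        unfolding t_eq by (intro tendsto_intros)
      then show ?case by simp
    qed
    show "integrable lborel (\<lambda>x :: real^2. indicator (cball 0 (M + 1)) x * (2 * M)\<^sup>2)"
      by (rule integrable_ball_const)
    show "(norm (t x - k i x))\<^sup>2 \<le> indicator (cball 0 (M + 1)) x * (2 * M)\<^sup>2" for i x
    proof (cases "norm x \<le> M + 1")
      case True
      have "norm (t x - k i x) \<le> 2 * M"
        using norm_triangle_ineq4[of "t x" "k i x"] M(2)[of x] k_le[of i x] by simp
      then have "(norm (t x - k i x))\<^sup>2 \<le> (2 * M)\<^sup>2"
        by (rule power_mono) simp
      then show ?thesis using True by simp
    next
      case False
      then show ?thesis using M(3)[of x] k0[of x i] M(1) by simp
    qed
  qed measurable
  then have "\<forall>\<^sub>F i in sequentially. norm2_sq (\<lambda>x. t x - k i x) < e / 4"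
    using e by (intro order_tendstoD) auto
  then obtain i where i: "norm2_sq (\<lambda>x. t x - k i x) < e / 4"
    by (auto simp: eventually_sequentially)
  have bnd: "square_integrable f" if [measurable]: "f \<in> borel_measurable borel"
    and "\<And>x. norm (f x) \<le> M" "\<And>x. norm x > M + 1 \<Longrightarrow> f x = 0" for f :: "real^2 \<Rightarrow> complex"
  proof (rule square_integrable_bound(1)[OF integrable_ball_const[of "M + 1" "M\<^sup>2"]])
    show "(norm (f x))\<^sup>2 \<le> indicator (cball 0 (M + 1)) x * M\<^sup>2" for x
      using that(2)[of x] that(3)[of x] by (cases "norm x \<le> M + 1") (auto intro: power_mono)
  qed (rule that)
  have sq: "square_integrable t" "square_integrable (k i)"
    by (rule bnd, use M k_le k0 in auto)+
  have "norm2_sq (\<lambda>x. g x - k i x) < e"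
    using norm2_sq_triangle[OF g sq] n i by (simp add: t_def)
  then show ?thesis
    using that[of "k i" "M + 1"] k_cont k0 sq M(1) by auto
qed

text \<open>With \<open>a\<close> constant in direction j, the exponent \<open>s * a x\<close> is
  the line integral of the potential over the segment from x to x + s e_j. The shifts are then
  formally exp(s (\<partial>_j + i a)), so their derivative at s = 0 is the magnetic
  derivative.\<close>

definition mag_shift :: "(real^2 \<Rightarrow> real) \<Rightarrow> 2 \<Rightarrow> real \<Rightarrow> (real^2 \<Rightarrow> complex) \<Rightarrow> real^2 \<Rightarrow> complex" where
  "mag_shift a j s \<psi> x = cis (s * a x) * \<psi> (x + s *\<^sub>R axis j 1)"

lemma measurable_cis [measurable]: "cis \<in> borel_measurable borel"
  by (intro borel_measurable_continuous_onI continuous_intros)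

lemma measurable_mag_shift [measurable]:
  assumes [measurable]: "a \<in> borel_measurable borel" "\<psi> \<in> borel_measurable borel"
  shows "mag_shift a j s \<psi> \<in> borel_measurable borel"
  unfolding mag_shift_def by measurable

lemma square_integrable_mag_shift:
  assumes a: "a \<in> borel_measurable borel" and \<psi>: "square_integrable \<psi>"
  shows "square_integrable (mag_shift a j s \<psi>)" "norm2_sq (mag_shift a j s \<psi>) = norm2_sq \<psi>"
proof -
  note [measurable] = a square_integrable_measurable[OF \<psi>]
  have "(\<lambda>x. (norm (\<psi> x))\<^sup>2) \<in> borel_measurable borel" by measurable
  from lborel_translate[OF this, of "s *\<^sub>R axis j 1"] \<psi>
  show "square_integrable (mag_shift a j s \<psi>)" "norm2_sq (mag_shift a j s \<psi>) = norm2_sq \<psi>"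
    by (auto simp: square_integrable_def norm2_sq_def mag_shift_def norm_mult)
qed

lemma mag_shift_diff:
  "mag_shift a j s (\<lambda>x. f x - g x) = (\<lambda>x. mag_shift a j s f x - mag_shift a j s g x)"
  by (simp add: fun_eq_iff mag_shift_def algebra_simps)

lemma mag_shift_continuous_compact_support:
  assumes a: "continuous_on UNIV a" and k: "continuous_on UNIV k" "\<And>x. norm x \<ge> R \<Longrightarrow> k x = 0"
  shows "((\<lambda>s. norm2_sq (\<lambda>x. mag_shift a j s k x - k x)) \<longlongrightarrow> 0) (at 0)"
  unfolding tendsto_at_iff_sequentially comp_def
proof (intro allI impI)
  fix X :: "nat \<Rightarrow> real" assume X: "X \<longlonglongrightarrow> 0"
  \<comment> \<open>A convergent sequence is bounded; the ball of radius \<open>R + S\<close> then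
    contains the supports of \<open>k\<close> and of all its shifts.\<close>
  then obtain S where S: "\<And>n. \<bar>X n\<bar> \<le> S"
    by (metis BseqE convergentI convergent_imp_Bseq real_norm_def)
  have "bounded (k ` cball 0 R)"
    by (intro compact_imp_bounded compact_continuous_image continuous_on_subset[OF k(1)]) auto
  then obtain M where M: "M > 0" "\<forall>y\<in>k ` cball 0 R. norm y \<le> M"
    using bounded_pos by blast
  have M': "norm (k x) \<le> M" for x
    using M k(2)[of x] by (cases "norm x \<le> R") (auto simp: image_iff)
  have [measurable]: "a \<in> borel_measurable borel" "k \<in> borel_measurable borel"
    by (intro borel_measurable_continuous_onI a k)+
  show "(\<lambda>n. norm2_sq (\<lambda>x. mag_shift a j (X n) k x - k x)) \<longlonglongrightarrow> 0"
  proof (rule norm2_sq_dominated_convergence)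
    show "AE x in lborel. (\<lambda>n. mag_shift a j (X n) k x - k x) \<longlonglongrightarrow> 0"
    proof (rule AE_I2)
      fix x
      have "isCont k (x + 0 *\<^sub>R axis j 1)"
        using k(1) by (simp add: continuous_on_eq_continuous_at)
      moreover have "(\<lambda>n. x + X n *\<^sub>R axis j 1) \<longlonglongrightarrow> x + 0 *\<^sub>R axis j 1"
        by (intro tendsto_intros X)
      ultimately have "(\<lambda>n. k (x + X n *\<^sub>R axis j 1)) \<longlonglongrightarrow> k (x + 0 *\<^sub>R axis j 1)"
        by (rule isCont_tendsto_compose)
      moreover have "(\<lambda>n. cis (X n * a x)) \<longlonglongrightarrow> cis (0 * a x)"
        by (intro isCont_tendsto_compose[of _ cis] continuous_intros tendsto_intros X)
      ultimately have "(\<lambda>n. mag_shift a j (X n) k x - k x) \<longlonglongrightarrow> cis (0 * a x) * k (x + 0 *\<^sub>R axis j 1) - k x"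
        unfolding mag_shift_def by (intro tendsto_diff tendsto_mult tendsto_const)
      then show "(\<lambda>n. mag_shift a j (X n) k x - k x) \<longlonglongrightarrow> 0" by simp
    qed
    show "integrable lborel (\<lambda>x :: real^2. indicator (cball 0 (R + S)) x * (2 * M)\<^sup>2)"
      by (rule integrable_ball_const)
    show "(norm (mag_shift a j (X n) k x - k x))\<^sup>2 \<le> indicator (cball 0 (R + S)) x * (2 * M)\<^sup>2" for n x
    proof (cases "norm x \<le> R + S")
      case True
      have "norm (mag_shift a j (X n) k x - k x) \<le> 2 * M"
        using norm_triangle_ineq4[of "mag_shift a j (X n) k x" "k x"] M'[of x] M'[of "x + X n *\<^sub>R axis j 1"]
        by (simp add: mag_shift_def norm_mult)
      then have "(norm (mag_shift a j (X n) k x - k x))\<^sup>2 \<le> (2 * M)\<^sup>2"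
        by (rule power_mono) simp
      then show ?thesis using True by simp
    next
      case False
      have "norm x \<le> norm (x + X n *\<^sub>R axis j 1) + norm (X n *\<^sub>R axis j (1::real) :: real^2)"
        by (metis add_diff_cancel_right' norm_triangle_ineq4)
      moreover have "norm (X n *\<^sub>R axis j (1::real) :: real^2) \<le> S" using S[of n] by simp
      ultimately have "norm (x + X n *\<^sub>R axis j 1) \<ge> R" "norm x \<ge> R"
        using False S[of n] by linarith+
      then show ?thesis using k(2) by (simp add: mag_shift_def)
    qed
  qed measurable
qed

text \<open>Strong continuity passes from compactly supported continuous functions to all of L^2 by
  density, because the shifts are isometries and so do not enlarge the approximation error.\<close>

lemma mag_shift_tendsto:
  assumes a: "continuous_on UNIV a" and g: "square_integrable g"
  shows "((\<lambda>s. norm2_sq (\<lambda>x. mag_shift a j s g x - g x)) \<longlongrightarrow> 0) (at 0)"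
proof (rule tendstoI)
  fix e :: real assume e: "e > 0"
  \<comment> \<open>The two triangle inequalities below add up to less than 2 e/16 + 2 (2 e/8 + 2
    e/16) = 7 e/8.\<close>
  obtain k R where k: "continuous_on UNIV k" "R > 0" "\<And>x. norm x \<ge> R \<Longrightarrow> k x = 0"
    "square_integrable k" and gk: "norm2_sq (\<lambda>x. g x - k x) < e / 16"
    using square_integrable_dense[OF g, of "e / 16"] e by (metis divide_pos_pos zero_less_numeral)
  have am: "a \<in> borel_measurable borel" by (rule borel_measurable_continuous_onI[OF a])
  have "\<forall>\<^sub>F s in at 0. norm2_sq (\<lambda>x. mag_shift a j s k x - k x) < e / 8"
    using e by (intro order_tendstoD(2)[OF mag_shift_continuous_compact_support[OF a k(1) k(3)]]) auto
  then show "\<forall>\<^sub>F s in at 0. dist (norm2_sq (\<lambda>x. mag_shift a j s g x - g x)) 0 < e"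
  proof eventually_elim
    case (elim s)
    note U = square_integrable_mag_shift(1)[OF am]
    have "norm2_sq (\<lambda>x. mag_shift a j s g x - mag_shift a j s k x) = norm2_sq (\<lambda>x. g x - k x)"
      using square_integrable_mag_shift(2)[OF am square_integrable_diff(1)[OF g k(4)], of j s]
      by (simp add: mag_shift_diff)
    moreover have "norm2_sq (\<lambda>x. mag_shift a j s k x - g x) \<le>
        2 * norm2_sq (\<lambda>x. mag_shift a j s k x - k x) + 2 * norm2_sq (\<lambda>x. k x - g x)"
      by (intro norm2_sq_triangle U k g)
    moreover have "norm2_sq (\<lambda>x. mag_shift a j s g x - g x) \<le>
        2 * norm2_sq (\<lambda>x. mag_shift a j s g x - mag_shift a j s k x) + 2 * norm2_sq (\<lambda>x. mag_shift a j s k x - g x)"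
      by (intro norm2_sq_triangle U k g)
    ultimately show ?case
      using elim gk e by (simp add: norm2_sq_commute[of k])
  qed
qed

section \<open>Magnetic difference quotients\<close>

lemma square_integrable_locally_integrable:
  assumes "square_integrable f" shows "locally_integrable f"
proof (rule locally_integrableI)
  show [measurable]: "f \<in> borel_measurable borel" using assms by (rule square_integrable_measurable)
  fix R
  show "integrable lborel (\<lambda>x. indicator (cball 0 R) x *\<^sub>R f x)"
  proof (rule Bochner_Integration.integrable_bound)
    show "integrable lborel (\<lambda>x. indicator (cball 0 R) x * 1 + (norm (f x))\<^sup>2)"
      using assms by (intro Bochner_Integration.integrable_add integrable_ball_const)
        (simp add: square_integrable_def)
    have "norm (f x) \<le> 1 + (norm (f x))\<^sup>2" for x
      using sum_squares_bound[of 1 "norm (f x)"] norm_ge_zero[of "f x"] by (simp only: power_one mult_1_right)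
    then show "AE x in lborel. norm (indicator (cball 0 R) x *\<^sub>R f x)
        \<le> norm (indicator (cball 0 R) x * 1 + (norm (f x))\<^sup>2)"
      by (intro AE_I2) (auto simp: indicator_def)
    show "(\<lambda>x. indicator (cball 0 R) x *\<^sub>R f x) \<in> borel_measurable lborel"
      using square_integrable_measurable[OF assms]
      by (intro borel_measurable_scaleR borel_measurable_indicator) auto
  qed
qed

lemma integrable_compact_support_scaleR:
  fixes f :: "real^2 \<Rightarrow> 'b::euclidean_space"
  assumes k: "continuous_on UNIV k" "\<And>x. norm x \<ge> R \<Longrightarrow> k x = (0::real)" and f: "locally_integrable f"
  shows "integrable lborel (\<lambda>x. k x *\<^sub>R f x)"
proof -
  have "bounded (k ` cball 0 R)"
    by (intro compact_imp_bounded compact_continuous_image continuous_on_subset[OF k(1)]) auto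
  then obtain M where M: "M > 0" "\<forall>y\<in>k ` cball 0 R. norm y \<le> M"
    using bounded_pos by blast
  have [measurable]: "k \<in> borel_measurable borel" by (rule borel_measurable_continuous_onI[OF k(1)])
  note [measurable] = locally_integrable_measurable[OF f]
  show ?thesis
  proof (rule Bochner_Integration.integrable_bound)
    show "integrable lborel (\<lambda>x. M *\<^sub>R (indicator (cball 0 R) x *\<^sub>R f x))"
      by (intro integrable_scaleR_right locally_integrable_ball f)
    show "AE x in lborel. norm (k x *\<^sub>R f x) \<le> norm (M *\<^sub>R indicator (cball 0 R) x *\<^sub>R f x)"
    proof (rule AE_I2)
      fix x
      show "norm (k x *\<^sub>R f x) \<le> norm (M *\<^sub>R indicator (cball 0 R) x *\<^sub>R f x)"
        using M k(2)[of x] by (cases "norm x \<le> R") (auto intro!: mult_right_mono)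
    qed
  qed measurable
qed

lemma square_integrable_bounded_support:
  assumes f: "f \<in> borel_measurable borel" and M: "\<And>x. norm (f x) \<le> M" "\<And>x. norm x > R \<Longrightarrow> f x = 0"
  shows "square_integrable f"
proof (rule square_integrable_bound(1)[OF integrable_ball_const[of R "M\<^sup>2"] f])
  show "(norm (f x))\<^sup>2 \<le> indicator (cball 0 R) x * M\<^sup>2" for x
    using M(1)[of x] M(2)[of x] by (cases "norm x \<le> R") (auto intro: power_mono)
qed

lemma integrable_tensor:
  fixes F :: "'a::euclidean_space \<Rightarrow> real" and G :: "'b::euclidean_space \<Rightarrow> real"
  assumes F: "integrable lborel F" and G: "integrable lborel G"
  shows "integrable (lborel \<Otimes>\<^sub>M lborel) (\<lambda>(x, y). F x * G y)"
proof (rule lborel_pair.Fubini_integrable)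
  note [measurable] = borel_measurable_integrable[OF F] borel_measurable_integrable[OF G]
  show "(\<lambda>(x, y). F x * G y) \<in> borel_measurable (lborel \<Otimes>\<^sub>M lborel)" by measurable
  show "integrable lborel (\<lambda>x. LINT y|lborel. norm (case (x, y) of (x, y) \<Rightarrow> F x * G y))"
    using F by (simp add: abs_mult)
  show "AE x in lborel. integrable lborel (\<lambda>y. case (x, y) of (x, y) \<Rightarrow> F x * G y)"
    using G by simp
qed

text \<open>One direction at a time: \<open>a\<close> stands for the component A_j and
  \<open>D\<close> for the weak derivative \<partial>_j \<psi> + i a \<psi>. Smoothness is demanded
  of the cosine and sine of \<open>s * a\<close> because these multiply the test functions when a
  phase is moved onto them.\<close>

locale magnetic_direction =
  fixes a :: "real^2 \<Rightarrow> real" and j :: 2 and \<psi> D :: "real^2 \<Rightarrow> complex"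
  assumes a_continuous: "continuous_on UNIV a"
    and a_invariant: "\<And>x s. a (x + s *\<^sub>R axis j 1) = a x"
    and a_smooth: "\<And>k s. Ck k (\<lambda>x. cos (s * a x))" "\<And>k s. Ck k (\<lambda>x. sin (s * a x))"
    and \<psi>: "square_integrable \<psi>" and D: "square_integrable D"
    and weak: "\<And>\<phi>. test_function \<phi> \<Longrightarrow> (LINT x|lborel. partial_deriv j \<phi> x *\<^sub>R \<psi> x) =
      - (LINT x|lborel. \<phi> x *\<^sub>R (D x - \<i> * complex_of_real (a x) * \<psi> x))"
begin

lemma a_measurable [measurable]: "a \<in> borel_measurable borel"
  by (rule borel_measurable_continuous_onI[OF a_continuous])

lemma \<psi>_measurable [measurable]: "\<psi> \<in> borel_measurable borel"
  by (rule square_integrable_measurable[OF \<psi>])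

lemma D_measurable [measurable]: "D \<in> borel_measurable borel"
  by (rule square_integrable_measurable[OF D])

lemma integrable_test_a:
  assumes "test_function \<phi>" and f: "locally_integrable f"
  shows "integrable lborel (\<lambda>x. (\<phi> x * a x) *\<^sub>R f x)"
proof -
  obtain R where "R > 0" "\<And>x. norm x \<ge> R \<Longrightarrow> \<phi> x = 0"
    using test_function_support[OF assms(1)] by metis
  then show ?thesis
    by (intro integrable_compact_support_scaleR[OF _ _ f, where R=R])
       (auto intro!: continuous_on_mult[OF test_function_continuous[OF assms(1)] a_continuous])
qed

lemma weak_test:
  assumes \<phi>: "test_function \<phi>"
  shows "(LINT x|lborel. partial_deriv j \<phi> x *\<^sub>R \<psi> x - \<i> * (\<phi> x * a x) *\<^sub>R \<psi> x) =
    - (LINT x|lborel. \<phi> x *\<^sub>R D x)"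
proof -
  note li = square_integrable_locally_integrable[OF \<psi>] square_integrable_locally_integrable[OF D]
  have eq: "\<phi> x *\<^sub>R (D x - \<i> * complex_of_real (a x) * \<psi> x) = \<phi> x *\<^sub>R D x - \<i> * ((\<phi> x * a x) *\<^sub>R \<psi> x)" for x
    by (simp add: scaleR_conv_of_real algebra_simps)
  have int: "integrable lborel (\<lambda>x. \<i> * ((\<phi> x * a x) *\<^sub>R \<psi> x))"
    by (intro integrable_mult_right integrable_test_a \<phi> li)
  have "(LINT x|lborel. \<phi> x *\<^sub>R (D x - \<i> * complex_of_real (a x) * \<psi> x)) =
      (LINT x|lborel. \<phi> x *\<^sub>R D x) - (LINT x|lborel. \<i> * ((\<phi> x * a x) *\<^sub>R \<psi> x))"
    unfolding eq by (intro Bochner_Integration.integral_diff int integrable_test_function_scaleR \<phi> li)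
  moreover have "(LINT x|lborel. partial_deriv j \<phi> x *\<^sub>R \<psi> x - \<i> * (\<phi> x * a x) *\<^sub>R \<psi> x) =
      (LINT x|lborel. partial_deriv j \<phi> x *\<^sub>R \<psi> x) - (LINT x|lborel. \<i> * (\<phi> x * a x) *\<^sub>R \<psi> x)"
    by (intro Bochner_Integration.integral_diff int integrable_test_function_scaleR
        test_function_partial_deriv \<phi> li)
  ultimately show ?thesis
    using weak[OF \<phi>] by simp
qed

lemma partial_deriv_invariant_mult:
  assumes g: "\<And>k. Ck k g" "\<And>x s. g (x + s *\<^sub>R axis j 1) = g x" and \<phi>: "test_function \<phi>"
  shows "partial_deriv j (\<lambda>x. g x * \<phi> x) x = g x * partial_deriv j \<phi> x"
proof -
  have "((\<lambda>t. g (x + t *\<^sub>R axis j 1) * \<phi> (x + t *\<^sub>R axis j 1)) has_real_derivative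
      partial_deriv j (\<lambda>x. g x * \<phi> x) (x + 0 *\<^sub>R axis j 1)) (at 0)"
    by (rule test_function_line_derivative[OF test_function_mult[OF \<phi> g(1)]])
  moreover have "((\<lambda>t. g x * \<phi> (x + t *\<^sub>R axis j 1)) has_real_derivative
      g x * partial_deriv j \<phi> (x + 0 *\<^sub>R axis j 1)) (at 0)"
    by (rule DERIV_cmult[OF test_function_line_derivative[OF \<phi>]])
  ultimately show ?thesis
    unfolding g(2) by (auto dest: DERIV_unique)
qed

text \<open>Test functions are real, so the phase enters through its cosine and sine parts. Since
  \<open>a\<close> is constant in direction j, the derivative passes through the phase and no
  derivative of \<open>a\<close> appears.\<close>

lemma weak_phase:
  assumes \<phi>: "test_function \<phi>"
  shows "(LINT x|lborel. cis (s * a x) * (partial_deriv j \<phi> x - \<i> * (\<phi> x * a x)) * \<psi> x) =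
    - (LINT x|lborel. cis (s * a x) * \<phi> x * D x)"
proof -
  note li = square_integrable_locally_integrable[OF \<psi>] square_integrable_locally_integrable[OF D]
  let ?c = "\<lambda>x. cos (s * a x) * \<phi> x" and ?s = "\<lambda>x. sin (s * a x) * \<phi> x"
  have t: "test_function ?c" "test_function ?s"
    by (intro test_function_mult \<phi> a_smooth)+
  have d: "partial_deriv j ?c x = cos (s * a x) * partial_deriv j \<phi> x"
    "partial_deriv j ?s x = sin (s * a x) * partial_deriv j \<phi> x" for x
    by (rule partial_deriv_invariant_mult; simp add: a_smooth a_invariant \<phi>)+
  have int: "integrable lborel (\<lambda>x. partial_deriv j \<theta> x *\<^sub>R \<psi> x - \<i> * (\<theta> x * a x) *\<^sub>R \<psi> x)"
    if "test_function \<theta>" for \<theta>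
    by (intro Bochner_Integration.integrable_diff integrable_mult_right integrable_test_a
        integrable_test_function_scaleR test_function_partial_deriv that li)
  have int2: "integrable lborel (\<lambda>x. \<theta> x *\<^sub>R D x)" if "test_function \<theta>" for \<theta>
    by (intro integrable_test_function_scaleR that li)
  have "(LINT x|lborel. cis (s * a x) * (partial_deriv j \<phi> x - \<i> * (\<phi> x * a x)) * \<psi> x) =
    (LINT x|lborel. (partial_deriv j ?c x *\<^sub>R \<psi> x - \<i> * (?c x * a x) *\<^sub>R \<psi> x)
      + \<i> * (partial_deriv j ?s x *\<^sub>R \<psi> x - \<i> * (?s x * a x) *\<^sub>R \<psi> x))"
    unfolding d by (rule Bochner_Integration.integral_cong) (auto simp: complex_eq_iff algebra_simps)
  also have "\<dots> = - (LINT x|lborel. ?c x *\<^sub>R D x) + \<i> * - (LINT x|lborel. ?s x *\<^sub>R D x)"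
    by (simp only: Bochner_Integration.integral_add[OF int[OF t(1)] integrable_mult_right[OF int[OF t(2)]]]
        integral_mult_right_zero weak_test[OF t(1)] weak_test[OF t(2)])
  also have "\<dots> = - (LINT x|lborel. ?c x *\<^sub>R D x + \<i> * (?s x *\<^sub>R D x))"
    by (simp only: Bochner_Integration.integral_add[OF int2[OF t(1)] integrable_mult_right[OF int2[OF t(2)]]]
        integral_mult_right_zero) simp
  also have "(LINT x|lborel. ?c x *\<^sub>R D x + \<i> * (?s x *\<^sub>R D x)) = (LINT x|lborel. cis (s * a x) * \<phi> x * D x)"
    by (rule Bochner_Integration.integral_cong) (auto simp: complex_eq_iff algebra_simps)
  finally show ?thesis .
qed

section \<open>Averages of magnetic translates\<close>

lemma integral_mag_shift_test:
  assumes [measurable]: "g \<in> borel_measurable borel" and \<phi>: "test_function \<phi>"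
  shows "(LINT x|lborel. \<phi> x *\<^sub>R mag_shift a j s g x) =
    (LINT x|lborel. cis (s * a x) * \<phi> (x - s *\<^sub>R axis j 1) * g x)"
proof -
  note [measurable] = test_function_measurable[OF \<phi>]
  let ?f = "\<lambda>x. cis (s * a x) * \<phi> (x - s *\<^sub>R axis j 1) * g x"
  have "?f \<in> borel_measurable borel" by measurable
  from lborel_translate(1)[OF this, of "s *\<^sub>R axis j 1"]
  show ?thesis
    by (simp add: mag_shift_def a_invariant scaleR_conv_of_real[of "\<phi> _"] mult_ac)
qed

lemma measurable_mag_shift_pair:
  assumes [measurable]: "g \<in> borel_measurable borel"
  shows "(\<lambda>(t, x). mag_shift a j (t * h) g x) \<in> borel_measurable (lborel \<Otimes>\<^sub>M lborel)"
  unfolding mag_shift_def by measurable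

text \<open>Prepares Fubini: by Cauchy-Schwarz and unitarity the inner integral over x is bounded
  uniformly in t, and t is confined to the unit interval.\<close>

lemma integrable_mag_shift_pair:
  assumes k: "square_integrable (k :: real^2 \<Rightarrow> real)" and g: "square_integrable g"
  shows "integrable (lborel \<Otimes>\<^sub>M lborel)
    (\<lambda>(t, x). indicator {0..1::real} t *\<^sub>R (k x *\<^sub>R mag_shift a j (t * h) g x))"
proof (rule lborel_pair.Fubini_integrable)
  note [measurable] = k[THEN square_integrable_measurable] g[THEN square_integrable_measurable]
    measurable_mag_shift_pair[OF square_integrable_measurable[OF g]]
  note U = square_integrable_mag_shift[OF a_measurable g]
  show meas: "(\<lambda>(t, x). indicator {0..1::real} t *\<^sub>R (k x *\<^sub>R mag_shift a j (t * h) g x))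
      \<in> borel_measurable (lborel \<Otimes>\<^sub>M lborel)"
    unfolding mag_shift_def by measurable
  have int: "integrable lborel (\<lambda>x. norm (k x) * norm (mag_shift a j s g x))" for s
    by (intro square_integrable_norm_mult k U)
  show "AE t in lborel. integrable lborel
      (\<lambda>x. case (t, x) of (t, x) \<Rightarrow> indicator {0..1::real} t *\<^sub>R (k x *\<^sub>R mag_shift a j (t * h) g x))"
  proof (rule AE_I2)
    fix t
    have "integrable lborel (\<lambda>x. k x *\<^sub>R mag_shift a j (t * h) g x)"
      by (rule Bochner_Integration.integrable_bound[OF int[of "t * h"]]) auto
    then show "integrable lborel
        (\<lambda>x. case (t, x) of (t, x) \<Rightarrow> indicator {0..1::real} t *\<^sub>R (k x *\<^sub>R mag_shift a j (t * h) g x))"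
      unfolding prod.case by (rule integrable_scaleR_right)
  qed
  show "integrable lborel (\<lambda>t. LINT x|lborel. norm (case (t, x) of (t, x) \<Rightarrow>
      indicator {0..1::real} t *\<^sub>R (k x *\<^sub>R mag_shift a j (t * h) g x)))"
  proof (rule Bochner_Integration.integrable_bound)
    let ?C = "sqrt (norm2_sq k) * sqrt (norm2_sq g)"
    show "integrable lborel (\<lambda>t. indicator {0..1::real} t *\<^sub>R ?C)"
      by (intro borel_integrable_compact continuous_intros) auto
    show "(\<lambda>t. LINT x|lborel. norm (case (t, x) of (t, x) \<Rightarrow>
        indicator {0..1::real} t *\<^sub>R (k x *\<^sub>R mag_shift a j (t * h) g x))) \<in> borel_measurable lborel"
      using meas by measurable
    show "AE t in lborel. norm (LINT x|lborel. norm (case (t, x) of (t, x) \<Rightarrow>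
        indicator {0..1::real} t *\<^sub>R (k x *\<^sub>R mag_shift a j (t * h) g x))) \<le> norm (indicator {0..1::real} t *\<^sub>R ?C)"
    proof (rule AE_I2)
      fix t
      have "(LINT x|lborel. norm (k x) * norm (mag_shift a j (t * h) g x)) \<le> ?C"
        using Cauchy_Schwarz_norm2_sq[OF k U(1)] U(2) by metis
      moreover have "(LINT x|lborel. norm (k x) * norm (mag_shift a j (t * h) g x)) \<ge> 0" by simp
      ultimately show "norm (LINT x|lborel. norm (case (t, x) of (t, x) \<Rightarrow>
        indicator {0..1::real} t *\<^sub>R (k x *\<^sub>R mag_shift a j (t * h) g x))) \<le> norm (indicator {0..1::real} t *\<^sub>R ?C)"
        by (cases "t \<in> {0..1}") auto
    qed
  qed
qed

text \<open>The mean of U_j(s) D over the segment of s from 0 to h, rescaled to the unit interval so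
  that both signs of h are covered by one formula.\<close>

definition shift_average :: "real \<Rightarrow> real^2 \<Rightarrow> complex" where
  "shift_average h x = (LINT t|lborel. indicator {0..1::real} t *\<^sub>R mag_shift a j (t * h) D x)"

lemma measurable_shift_average [measurable]: "shift_average h \<in> borel_measurable borel"
proof -
  have "(\<lambda>(x, t). indicator {0..1::real} t *\<^sub>R mag_shift a j (t * h) D x)
      \<in> borel_measurable (lborel \<Otimes>\<^sub>M lborel)"
    unfolding mag_shift_def by measurable
  then show ?thesis
    unfolding shift_average_def by measurable
qed

lemma integrable_shift_average:
  assumes k: "square_integrable (k :: real^2 \<Rightarrow> real)"
  shows "integrable lborel (\<lambda>x. k x *\<^sub>R shift_average h x)"
    and "(LINT x|lborel. k x *\<^sub>R shift_average h x) =
      (LINT t|lborel. indicator {0..1::real} t *\<^sub>R (LINT x|lborel. k x *\<^sub>R mag_shift a j (t * h) D x))"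
proof -
  let ?q = "\<lambda>t x. indicator {0..1::real} t *\<^sub>R (k x *\<^sub>R mag_shift a j (t * h) D x)"
  have eq: "k x *\<^sub>R shift_average h x = (LINT t|lborel. ?q t x)" for x
    unfolding shift_average_def integral_scaleR_right[symmetric] by (simp add: mult.commute)
  note int = integrable_mag_shift_pair[OF k D, of h]
  show "integrable lborel (\<lambda>x. k x *\<^sub>R shift_average h x)"
    unfolding eq by (rule lborel_pair.integrable_snd[OF int])
  show "(LINT x|lborel. k x *\<^sub>R shift_average h x) =
      (LINT t|lborel. indicator {0..1::real} t *\<^sub>R (LINT x|lborel. k x *\<^sub>R mag_shift a j (t * h) D x))"
    unfolding eq lborel_pair.Fubini_integral[OF int] by (simp only: integral_scaleR_right)
qed

lemma locally_integrable_shift_average: "locally_integrable (shift_average h)"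
proof (rule locally_integrableI)
  show "integrable lborel (\<lambda>x. indicator (cball 0 R) x *\<^sub>R shift_average h x)" for R
    by (rule integrable_shift_average, rule square_integrable_bounded_support[of _ 1 R])
       (auto simp: indicator_def)
qed measurable

end

lemma locally_integrable_diff:
  "locally_integrable f \<Longrightarrow> locally_integrable g \<Longrightarrow> locally_integrable (\<lambda>x. f x - g x)"
  unfolding locally_integrable_def by (auto intro: set_integral_diff)

lemma locally_integrable_scaleR:
  fixes f :: "real^2 \<Rightarrow> 'b::euclidean_space"
  shows "locally_integrable f \<Longrightarrow> locally_integrable (\<lambda>x. c *\<^sub>R f x)"
  unfolding locally_integrable_def by auto

lemma nn_integral_norm2_sq:
  assumes "square_integrable f"
  shows "(\<integral>\<^sup>+x. ennreal ((norm (f x))\<^sup>2) \<partial>lborel) = ennreal (norm2_sq f)"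
  using assms unfolding norm2_sq_def square_integrable_def
  by (intro nn_integral_eq_integral) auto

lemma test_function_square_integrable:
  assumes "test_function \<phi>" shows "square_integrable \<phi>"
proof -
  obtain R where "R > 0" "\<And>x. norm x \<ge> R \<Longrightarrow> \<phi> x = 0"
    using test_function_support[OF assms] by metis
  moreover obtain M where "M > 0" "\<And>x. \<bar>\<phi> x\<bar> \<le> M"
    using test_function_bounded[OF assms] by metis
  ultimately show ?thesis
    by (intro square_integrable_bounded_support[of _ M R] test_function_measurable assms) auto
qed

text \<open>Cauchy-Schwarz on an interval of length 1. If the integrand is not integrable, the
  Bochner integral has its default value 0 and the bound is trivial.\<close>

lemma norm_integral_sq_le:
  fixes q :: "real \<Rightarrow> complex"
  assumes [measurable]: "q \<in> borel_measurable borel"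
  shows "ennreal ((norm (LINT t|lborel. indicator {0..1} t *\<^sub>R q t))\<^sup>2)
    \<le> (\<integral>\<^sup>+t. indicator {0..1} t * ennreal ((norm (q t))\<^sup>2) \<partial>lborel)"
proof (cases "integrable lborel (\<lambda>t. indicator {0..1} t *\<^sub>R q t)")
  case True
  let ?i = "indicator {0..1::real} :: real \<Rightarrow> ennreal"
  have i: "?i t * ?i t = ?i t" "ennreal (indicator {0..1} t) = ?i t" for t
    by (auto simp: indicator_def)
  have "ennreal (norm (LINT t|lborel. indicator {0..1} t *\<^sub>R q t))
      \<le> (\<integral>\<^sup>+t. ennreal (norm (indicator {0..1} t *\<^sub>R q t)) \<partial>lborel)"
    by (rule integral_norm_bound_ennreal[OF True])
  also have "\<dots> = (\<integral>\<^sup>+t. ?i t * (?i t * ennreal (norm (q t))) \<partial>lborel)"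
    by (intro nn_integral_cong) (auto simp: indicator_def)
  finally have "(ennreal (norm (LINT t|lborel. indicator {0..1} t *\<^sub>R q t)))\<^sup>2
      \<le> (\<integral>\<^sup>+t. ?i t * (?i t * ennreal (norm (q t))) \<partial>lborel)\<^sup>2"
    by (rule power_mono) simp
  also have "\<dots> \<le> (\<integral>\<^sup>+t. (?i t)\<^sup>2 \<partial>lborel) * (\<integral>\<^sup>+t. (?i t * ennreal (norm (q t)))\<^sup>2 \<partial>lborel)"
    by (rule Cauchy_Schwarz_nn_integral) measurable
  also have "(\<integral>\<^sup>+t. (?i t)\<^sup>2 \<partial>lborel) = 1"
    by (simp add: power2_eq_square i)
  also have "(\<integral>\<^sup>+t. (?i t * ennreal (norm (q t)))\<^sup>2 \<partial>lborel) = (\<integral>\<^sup>+t. ?i t * ennreal ((norm (q t))\<^sup>2) \<partial>lborel)"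
    by (intro nn_integral_cong) (auto simp: indicator_def ennreal_power)
  finally show ?thesis
    by (simp add: ennreal_power)
qed (simp add: not_integrable_integral_eq)

context magnetic_direction
begin

section \<open>The fundamental theorem of calculus along magnetic translations\<close>

lemma test_function_shift:
  assumes "test_function \<phi>"
  shows "test_function (\<lambda>x. \<phi> (x - v))"
    and "partial_deriv i (\<lambda>x. \<phi> (x - v)) = (\<lambda>x. partial_deriv i \<phi> (x - v))"
  using test_function_affine_arg[OF assms, of 1 "- v"]
    partial_deriv_affine[OF test_function_differentiable[OF assms], of i "- v" 1]
  by (simp_all add: add.commute)

text \<open>Dual form of differentiating U_j(t h) \<psi> in t: the dependence on t sits on a smooth
  function, so the classical theorem applies for each fixed x. \<open>G\<close> is \<partial>_j - i
  a applied to the transported test function cis(t h a(x)) \<phi>(x - t h e_j).\<close>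

lemma shift_test_FTC:
  fixes h :: real
  assumes \<phi>: "test_function \<phi>"
  defines "G \<equiv> \<lambda>t x. cis (t * h * a x) *
      (complex_of_real (partial_deriv j \<phi> (x - (t * h) *\<^sub>R axis j 1))
        - \<i> * (\<phi> (x - (t * h) *\<^sub>R axis j 1) * a x))"
  shows "(LINT t|lborel. indicator {0..1} t *\<^sub>R (- h *\<^sub>R G t x)) =
    cis (h * a x) * \<phi> (x - h *\<^sub>R axis j 1) - \<phi> x"
proof -
  let ?F = "\<lambda>t. cis (t * h * a x) * complex_of_real (\<phi> (x - (t * h) *\<^sub>R axis j 1))"
  have d: "((\<lambda>t. \<phi> (x - (t * h) *\<^sub>R axis j 1)) has_real_derivative
      - h * partial_deriv j \<phi> (x - (t * h) *\<^sub>R axis j 1)) (at t within A)" for t A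
  proof -
    have "((\<lambda>s. \<phi> (x + s *\<^sub>R axis j 1)) has_real_derivative
        partial_deriv j \<phi> (x + (- (t * h)) *\<^sub>R axis j 1)) (at (- (t * h)))"
      by (rule test_function_line_derivative[OF \<phi>])
    moreover have "((\<lambda>t. - (t * h)) has_real_derivative - h) (at t within A)"
      by (auto intro!: derivative_eq_intros)
    ultimately show ?thesis
      by (drule_tac DERIV_chain2) (auto simp: mult.commute)
  qed
  have "(LINT t|lborel. indicator {0..1} t *\<^sub>R (- h *\<^sub>R G t x)) = ?F 1 - ?F 0"
  proof (rule integral_FTC_atLeastAtMost)
    show "(?F has_vector_derivative - h *\<^sub>R G t x) (at t within {0..1})" for t
      unfolding has_vector_derivative_complex_iff
      by (auto intro!: derivative_eq_intros d simp: G_def algebra_simps)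
    show "continuous_on {0..1} (\<lambda>t. - h *\<^sub>R G t x)"
      unfolding G_def
      by (intro continuous_intros continuous_on_compose2[OF test_function_continuous[of \<phi> UNIV]]
          continuous_on_compose2[OF test_function_continuous[of "partial_deriv j \<phi>" UNIV]]
          test_function_partial_deriv \<phi>) auto
  qed simp
  then show ?thesis by simp
qed

lemma integrable_shift_test_pair:
  fixes h :: real
  assumes \<phi>: "test_function \<phi>"
  defines "G \<equiv> \<lambda>t x. cis (t * h * a x) *
      (complex_of_real (partial_deriv j \<phi> (x - (t * h) *\<^sub>R axis j 1))
        - \<i> * (\<phi> (x - (t * h) *\<^sub>R axis j 1) * a x))"
  shows "integrable (lborel \<Otimes>\<^sub>M lborel) (\<lambda>(t, x). (indicator {0..1::real} t *\<^sub>R (- h *\<^sub>R G t x)) * \<psi> x)"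
proof -
  note \<phi>' = test_function_partial_deriv[OF \<phi>, of j]
  obtain R1 where R1: "R1 > 0" "\<And>x. norm x \<ge> R1 \<Longrightarrow> \<phi> x = 0"
    using test_function_support[OF \<phi>] by metis
  obtain R2 where R2: "R2 > 0" "\<And>x. norm x \<ge> R2 \<Longrightarrow> partial_deriv j \<phi> x = 0"
    using test_function_support[OF \<phi>'] by metis
  \<comment> \<open>Large enough for the supports of all the translates by t h with 0 \<le> t \<le>
    1; on this ball the potential is bounded.\<close>
  define R where "R = max R1 R2 + \<bar>h\<bar>"
  obtain M1 where M1: "M1 > 0" "\<And>x. \<bar>\<phi> x\<bar> \<le> M1"
    using test_function_bounded[OF \<phi>] by metis
  obtain M2 where M2: "M2 > 0" "\<And>x. \<bar>partial_deriv j \<phi> x\<bar> \<le> M2"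
    using test_function_bounded[OF \<phi>'] by metis
  have "bounded (a ` cball 0 R)"
    by (intro compact_imp_bounded compact_continuous_image continuous_on_subset[OF a_continuous]) auto
  then obtain M3 where M3: "M3 > 0" "\<forall>y\<in>a ` cball 0 R. norm y \<le> M3"
    using bounded_pos by blast
  define C where "C = \<bar>h\<bar> * (M2 + M1 * M3)"
  have G: "norm (- h *\<^sub>R G t x) \<le> indicator (cball 0 R) x * C" if t: "t \<in> {0..1}" for t x
  proof (cases "norm x \<le> R")
    case True
    let ?y = "x - (t * h) *\<^sub>R axis j 1"
    have "norm (G t x) = norm (complex_of_real (partial_deriv j \<phi> ?y) - \<i> * (\<phi> ?y * a x))"
      unfolding G_def by (subst norm_mult) simp
    also have "\<dots> \<le> norm (complex_of_real (partial_deriv j \<phi> ?y)) + norm (\<i> * (\<phi> ?y * a x))"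
      by (rule norm_triangle_ineq4)
    also have "\<dots> = \<bar>partial_deriv j \<phi> ?y\<bar> + \<bar>\<phi> ?y\<bar> * \<bar>a x\<bar>"
      by (simp add: norm_mult)
    also have "\<dots> \<le> M2 + M1 * M3"
      using M1 M2 M3 True by (intro add_mono mult_mono) auto
    finally show ?thesis
      using True by (simp add: C_def mult_left_mono)
  next
    case False
    have "norm x \<le> norm (x - (t * h) *\<^sub>R axis j 1) + norm ((t * h) *\<^sub>R axis j (1::real) :: real^2)"
      by (metis diff_add_cancel norm_triangle_ineq)
    moreover have "norm ((t * h) *\<^sub>R axis j (1::real) :: real^2) \<le> \<bar>h\<bar>"
      using t by (simp add: abs_mult mult_left_le_one_le)
    ultimately have "norm (x - (t * h) *\<^sub>R axis j 1) \<ge> max R1 R2"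
      using False unfolding R_def by linarith
    then show ?thesis
      using R1(2) R2(2) by (simp add: G_def False)
  qed
  show ?thesis
  proof (rule Bochner_Integration.integrable_bound)
    note [measurable] = test_function_measurable[OF \<phi>] test_function_measurable[OF \<phi>']
    show "integrable (lborel \<Otimes>\<^sub>M lborel) (\<lambda>(t, x). indicator {0..1::real} t * (C * norm (indicator (cball 0 R) x *\<^sub>R \<psi> x)))"
    proof (rule integrable_tensor)
      show "integrable lborel (\<lambda>t. indicator {0..1::real} t :: real)" by simp
      show "integrable lborel (\<lambda>x. C * norm (indicator (cball 0 R) x *\<^sub>R \<psi> x))"
        by (intro integrable_mult_right integrable_norm locally_integrable_ball
            square_integrable_locally_integrable \<psi>)
    qed
    show "(\<lambda>(t, x). (indicator {0..1::real} t *\<^sub>R (- h *\<^sub>R G t x)) * \<psi> x) \<in> borel_measurable (lborel \<Otimes>\<^sub>M lborel)"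
      unfolding G_def by measurable
    have "norm ((indicator {0..1::real} t *\<^sub>R (- h *\<^sub>R G t x)) * \<psi> x)
        \<le> indicator {0..1::real} t * (C * norm (indicator (cball 0 R) x *\<^sub>R \<psi> x))" for t x
    proof (cases "t \<in> {0..1}")
      case True
      have "norm (- h *\<^sub>R G t x) * norm (\<psi> x) \<le> indicator (cball 0 R) x * C * norm (\<psi> x)"
        by (intro mult_right_mono G True) simp
      then show ?thesis using True by (simp add: norm_mult mult_ac)
    qed simp
    then show "AE p in lborel \<Otimes>\<^sub>M lborel. norm (case p of (t, x) \<Rightarrow> (indicator {0..1::real} t *\<^sub>R (- h *\<^sub>R G t x)) * \<psi> x)
        \<le> norm (case p of (t, x) \<Rightarrow> indicator {0..1::real} t * (C * norm (indicator (cball 0 R) x *\<^sub>R \<psi> x)))"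
      by (intro AE_I2) (force split: prod.split intro: order_trans[OF _ abs_ge_self])
  qed
qed

text \<open>Integrated form of d/ds U_j(s) \<psi> = U_j(s) D. Since \<psi> has only weak
  derivatives, the identity is tested: the shifts move to \<phi>, where the fundamental theorem of
  calculus holds, \<open>weak_phase\<close> exchanges \<psi> for \<open>D\<close> at each t, and
  Fubini puts the pieces together.\<close>

lemma mag_shift_eq_shift_average:
  "AE x in lborel. mag_shift a j h \<psi> x - \<psi> x - h *\<^sub>R shift_average h x = 0"
proof (rule AE_eq_0_if_test_integrals_eq_0)
  note li = square_integrable_locally_integrable[OF \<psi>]
    square_integrable_locally_integrable[OF square_integrable_mag_shift(1)[OF a_measurable \<psi>]]
  show "locally_integrable (\<lambda>x. mag_shift a j h \<psi> x - \<psi> x - h *\<^sub>R shift_average h x)"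
    by (intro locally_integrable_diff locally_integrable_scaleR li locally_integrable_shift_average)
  fix \<phi> assume \<phi>: "test_function \<phi>"
  let ?e = "axis j 1 :: real^2"
  define G where "G = (\<lambda>t x. cis (t * h * a x) *
      (complex_of_real (partial_deriv j \<phi> (x - (t * h) *\<^sub>R ?e)) - \<i> * (\<phi> (x - (t * h) *\<^sub>R ?e) * a x)))"
  note int = integrable_test_function_scaleR[OF \<phi> li(1)] integrable_test_function_scaleR[OF \<phi> li(2)]
    integrable_shift_average(1)[OF test_function_square_integrable[OF \<phi>]]
  have intG: "integrable (lborel \<Otimes>\<^sub>M lborel)
      (\<lambda>(t, x). (indicator {0..1::real} t *\<^sub>R (- h *\<^sub>R G t x)) * \<psi> x)"
    unfolding G_def by (rule integrable_shift_test_pair[OF \<phi>])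
  have "(LINT x|lborel. \<phi> x *\<^sub>R mag_shift a j s D x) = - (LINT x|lborel. cis (s * a x) *
      (complex_of_real (partial_deriv j \<phi> (x - s *\<^sub>R ?e)) - \<i> * (\<phi> (x - s *\<^sub>R ?e) * a x)) * \<psi> x)" for s
    unfolding integral_mag_shift_test[OF D_measurable \<phi>]
    using weak_phase[OF test_function_shift(1)[OF \<phi>], of s "s *\<^sub>R ?e"]
    by (simp add: test_function_shift(2)[OF \<phi>])
  then have "(LINT x|lborel. \<phi> x *\<^sub>R shift_average h x) =
      (LINT t|lborel. indicator {0..1::real} t *\<^sub>R - (LINT x|lborel. G t x * \<psi> x))"
    by (simp add: integrable_shift_average(2)[OF test_function_square_integrable[OF \<phi>]] G_def)
  then have A: "h *\<^sub>R (LINT x|lborel. \<phi> x *\<^sub>R shift_average h x) =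
      (LINT t|lborel. h *\<^sub>R indicator {0..1::real} t *\<^sub>R - (LINT x|lborel. G t x * \<psi> x))"
    by (simp only: integral_scaleR_right)
  have "(LINT x|lborel. \<phi> x *\<^sub>R mag_shift a j h \<psi> x) - (LINT x|lborel. \<phi> x *\<^sub>R \<psi> x)
      = (LINT x|lborel. cis (h * a x) * \<phi> (x - h *\<^sub>R ?e) * \<psi> x) - (LINT x|lborel. \<phi> x *\<^sub>R \<psi> x)"
    by (simp only: integral_mag_shift_test[OF \<psi>_measurable \<phi>])
  also have "\<dots> = (LINT x|lborel. cis (h * a x) * \<phi> (x - h *\<^sub>R ?e) * \<psi> x - \<phi> x *\<^sub>R \<psi> x)"
  proof (rule Bochner_Integration.integral_diff[symmetric, OF _ int(1)])
    show "integrable lborel (\<lambda>x. cis (h * a x) * \<phi> (x - h *\<^sub>R ?e) * \<psi> x)"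
    proof (rule Bochner_Integration.integrable_bound)
      show "integrable lborel (\<lambda>x. \<phi> (x - h *\<^sub>R ?e) *\<^sub>R \<psi> x)"
        by (intro integrable_test_function_scaleR test_function_shift \<phi> li)
      note [measurable] = test_function_measurable[OF \<phi>]
      show "(\<lambda>x. cis (h * a x) * \<phi> (x - h *\<^sub>R ?e) * \<psi> x) \<in> borel_measurable lborel" by measurable
    qed (simp add: norm_mult)
  qed
  also have "\<dots> = (LINT x|lborel. LINT t|lborel. (indicator {0..1::real} t *\<^sub>R (- h *\<^sub>R G t x)) * \<psi> x)"
  proof (rule Bochner_Integration.integral_cong[OF refl])
    fix x
    have "(LINT t|lborel. (indicator {0..1::real} t *\<^sub>R (- h *\<^sub>R G t x)) * \<psi> x) =
        (LINT t|lborel. indicator {0..1::real} t *\<^sub>R (- h *\<^sub>R G t x)) * \<psi> x"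
      by (rule integral_mult_left_zero)
    also have "\<dots> = (cis (h * a x) * \<phi> (x - h *\<^sub>R ?e) - \<phi> x) * \<psi> x"
      unfolding G_def shift_test_FTC[OF \<phi>] ..
    finally show "cis (h * a x) * \<phi> (x - h *\<^sub>R ?e) * \<psi> x - \<phi> x *\<^sub>R \<psi> x =
        (LINT t|lborel. (indicator {0..1::real} t *\<^sub>R (- h *\<^sub>R G t x)) * \<psi> x)"
      by (simp add: algebra_simps scaleR_conv_of_real[of "\<phi> _"])
  qed
  also have "\<dots> = (LINT t|lborel. LINT x|lborel. (indicator {0..1::real} t *\<^sub>R (- h *\<^sub>R G t x)) * \<psi> x)"
    by (rule lborel_pair.Fubini_integral[OF intG])
  also have "\<dots> = (LINT t|lborel. h *\<^sub>R indicator {0..1::real} t *\<^sub>R - (LINT x|lborel. G t x * \<psi> x))"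
    by (rule Bochner_Integration.integral_cong) (simp_all add: mult.assoc)
  finally have B: "(LINT x|lborel. \<phi> x *\<^sub>R mag_shift a j h \<psi> x) - (LINT x|lborel. \<phi> x *\<^sub>R \<psi> x)
      = h *\<^sub>R (LINT x|lborel. \<phi> x *\<^sub>R shift_average h x)"
    unfolding A .
  have "(LINT x|lborel. \<phi> x *\<^sub>R (mag_shift a j h \<psi> x - \<psi> x - h *\<^sub>R shift_average h x)) =
      (LINT x|lborel. \<phi> x *\<^sub>R mag_shift a j h \<psi> x - \<phi> x *\<^sub>R \<psi> x - h *\<^sub>R (\<phi> x *\<^sub>R shift_average h x))"
    by (simp add: scaleR_diff_right mult.commute)
  also have "\<dots> = (LINT x|lborel. \<phi> x *\<^sub>R mag_shift a j h \<psi> x) - (LINT x|lborel. \<phi> x *\<^sub>R \<psi> x)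
      - h *\<^sub>R (LINT x|lborel. \<phi> x *\<^sub>R shift_average h x)"
    by (simp add: int del: scaleR_scaleR)
  finally show "(LINT x|lborel. \<phi> x *\<^sub>R (mag_shift a j h \<psi> x - \<psi> x - h *\<^sub>R shift_average h x)) = 0"
    using B by simp
qed

section \<open>L^2 convergence of the magnetic difference quotients\<close>

definition quotient :: "real \<Rightarrow> real^2 \<Rightarrow> complex" where
  "quotient h x = (1 / h) *\<^sub>R (mag_shift a j h \<psi> x - \<psi> x)"

lemma square_integrable_quotient: "square_integrable (quotient h)"
  unfolding quotient_def
  by (intro square_integrable_scaleR square_integrable_diff square_integrable_mag_shift \<psi> a_measurable)

text \<open>The quotient minus \<open>D\<close> is the average over t of U_j(t h) D - D, so the
  squared norm is controlled, by Cauchy-Schwarz in t and Fubini, by the modulus of continuity of s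
  \<mapsto> U_j(s) D.\<close>

lemma quotient_bound:
  assumes h: "h \<noteq> 0" and e: "e \<ge> 0"
    and le: "\<And>s. \<bar>s\<bar> \<le> \<bar>h\<bar> \<Longrightarrow> norm2_sq (\<lambda>x. mag_shift a j s D x - D x) \<le> e"
  shows "norm2_sq (\<lambda>x. quotient h x - D x) \<le> e"
proof -
  let ?q = "\<lambda>t x. mag_shift a j (t * h) D x - D x"
  let ?i = "indicator {0..1::real} :: real \<Rightarrow> ennreal"
  have meas: "(\<lambda>(t, x). ?i t * ennreal ((norm (?q t x))\<^sup>2)) \<in> borel_measurable (lborel \<Otimes>\<^sub>M lborel)"
    unfolding mag_shift_def by measurable
  have sq: "square_integrable (?q t)" for t
    by (intro square_integrable_diff square_integrable_mag_shift D a_measurable)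
  have "(\<integral>\<^sup>+x. \<integral>\<^sup>+t. ?i t * ennreal ((norm (?q t x))\<^sup>2) \<partial>lborel \<partial>lborel) =
      (\<integral>\<^sup>+t. \<integral>\<^sup>+x. ?i t * ennreal ((norm (?q t x))\<^sup>2) \<partial>lborel \<partial>lborel)"
    by (rule lborel_pair.Fubini'[OF meas])
  also have "\<dots> = (\<integral>\<^sup>+t. ?i t * ennreal (norm2_sq (?q t)) \<partial>lborel)"
    using square_integrable_measurable[OF sq]
    by (simp add: nn_integral_cmult nn_integral_norm2_sq[OF sq])
  also have "\<dots> \<le> (\<integral>\<^sup>+t. ennreal e * ?i t \<partial>lborel)"
  proof (rule nn_integral_mono)
    fix t
    show "?i t * ennreal (norm2_sq (?q t)) \<le> ennreal e * ?i t"
      using le[of "t * h"] by (cases "t \<in> {0..1}") (auto simp: abs_mult mult_left_le_one_le intro!: ennreal_leI)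
  qed
  also have "\<dots> = ennreal e"
    by (subst nn_integral_cmult_indicator) auto
  finally have tot: "(\<integral>\<^sup>+x. \<integral>\<^sup>+t. ?i t * ennreal ((norm (?q t x))\<^sup>2) \<partial>lborel \<partial>lborel) \<le> ennreal e" .
  have "(\<lambda>x. \<integral>\<^sup>+t. ?i t * ennreal ((norm (?q t x))\<^sup>2) \<partial>lborel) \<in> borel_measurable lborel"
    unfolding mag_shift_def by measurable
  moreover have "(\<integral>\<^sup>+x. \<integral>\<^sup>+t. ?i t * ennreal ((norm (?q t x))\<^sup>2) \<partial>lborel \<partial>lborel) \<noteq> \<infinity>"
    using tot by (auto simp: top_unique)
  ultimately have "AE x in lborel. (\<integral>\<^sup>+t. ?i t * ennreal ((norm (?q t x))\<^sup>2) \<partial>lborel) \<noteq> \<infinity>"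
    by (rule nn_integral_PInf_AE)
  with mag_shift_eq_shift_average[of h]
  have "AE x in lborel. ennreal ((norm (quotient h x - D x))\<^sup>2)
      \<le> (\<integral>\<^sup>+t. ?i t * ennreal ((norm (?q t x))\<^sup>2) \<partial>lborel)"
  proof eventually_elim
    case (elim x)
    have [measurable]: "(\<lambda>t. mag_shift a j (t * h) D x) \<in> borel_measurable borel"
      unfolding mag_shift_def by measurable
    \<comment> \<open>Splitting \<open>D x\<close> off the Bochner average needs integrability in t,
      which holds for almost every x: finiteness of the integral of the square suffices on an
      interval of finite length.\<close>
    have int: "integrable lborel (\<lambda>t. indicator {0..1::real} t *\<^sub>R ?q t x)"
    proof (rule integrableI_bounded)
      have "(\<integral>\<^sup>+t. ennreal (norm (indicator {0..1::real} t *\<^sub>R ?q t x)) \<partial>lborel)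
          \<le> (\<integral>\<^sup>+t. ?i t + ?i t * ennreal ((norm (?q t x))\<^sup>2) \<partial>lborel)"
      proof (rule nn_integral_mono)
        fix t
        have "norm (?q t x) \<le> 1 + (norm (?q t x))\<^sup>2"
          using sum_squares_bound[of 1 "norm (?q t x)"] norm_ge_zero[of "?q t x"]
          by (simp only: power_one mult_1_right)
        then have "ennreal (norm (?q t x)) \<le> 1 + ennreal ((norm (?q t x))\<^sup>2)"
          by (metis ennreal_1 ennreal_leI ennreal_plus zero_le_one zero_le_power2)
        then show "ennreal (norm (indicator {0..1::real} t *\<^sub>R ?q t x)) \<le> ?i t + ?i t * ennreal ((norm (?q t x))\<^sup>2)"
          by (cases "t \<in> {0..1}") auto
      qed
      also have "\<dots> = 1 + (\<integral>\<^sup>+t. ?i t * ennreal ((norm (?q t x))\<^sup>2) \<partial>lborel)"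
        by (subst nn_integral_add) auto
      also have "\<dots> < \<infinity>"
        using elim(2) by (simp add: less_top)
      finally show "(\<integral>\<^sup>+t. ennreal (norm (indicator {0..1::real} t *\<^sub>R ?q t x)) \<partial>lborel) < \<infinity>" .
    qed measurable
    have int_D: "integrable lborel (\<lambda>t. indicator {0..1::real} t *\<^sub>R D x)"
      by (rule integrable_scaleR_left) simp
    have "shift_average h x = (LINT t|lborel. indicator {0..1::real} t *\<^sub>R ?q t x + indicator {0..1::real} t *\<^sub>R D x)"
      unfolding shift_average_def by (rule Bochner_Integration.integral_cong) (simp_all add: algebra_simps)
    also have "\<dots> = (LINT t|lborel. indicator {0..1::real} t *\<^sub>R ?q t x) + D x"
      by (subst Bochner_Integration.integral_add[OF int int_D]) simp
    finally have "quotient h x - D x = (LINT t|lborel. indicator {0..1::real} t *\<^sub>R ?q t x)"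
      using elim(1) h by (simp add: quotient_def)
    then show ?case
      using norm_integral_sq_le[of "\<lambda>t. ?q t x"] by simp
  qed
  then have "(\<integral>\<^sup>+x. ennreal ((norm (quotient h x - D x))\<^sup>2) \<partial>lborel) \<le> ennreal e"
    by (rule order_trans[OF nn_integral_mono_AE tot])
  then show ?thesis
    using e by (simp add: nn_integral_norm2_sq square_integrable_diff square_integrable_quotient D)
qed

lemma quotient_tendsto: "((\<lambda>h. norm2_sq (\<lambda>x. quotient h x - D x)) \<longlongrightarrow> 0) (at 0)"
proof (rule tendstoI)
  fix e :: real assume e: "e > 0"
  have "\<forall>\<^sub>F s in at 0. norm2_sq (\<lambda>x. mag_shift a j s D x - D x) < e / 2"
    using e by (intro order_tendstoD(2)[OF mag_shift_tendsto[OF a_continuous D]]) auto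
  then obtain d where d: "d > 0" "\<And>s. s \<noteq> 0 \<Longrightarrow> \<bar>s\<bar> < d \<Longrightarrow> norm2_sq (\<lambda>x. mag_shift a j s D x - D x) < e / 2"
    unfolding eventually_at by (auto simp: dist_real_def)
  \<comment> \<open>The filter \<open>at 0\<close> says nothing about s = 0, where the shift is the
    identity, whereas \<open>quotient_bound\<close> asks for all small s.\<close>
  have d': "norm2_sq (\<lambda>x. mag_shift a j s D x - D x) \<le> e / 2" if "\<bar>s\<bar> < d" for s
    using d(2)[of s] that e by (cases "s = 0") (auto simp: mag_shift_def norm2_sq_def)
  show "\<forall>\<^sub>F h in at 0. dist (norm2_sq (\<lambda>x. quotient h x - D x)) 0 < e"
    unfolding eventually_at
  proof (intro exI[of _ d] conjI ballI impI d(1))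
    fix h :: real assume "h \<noteq> 0 \<and> dist h 0 < d"
    then have "norm2_sq (\<lambda>x. quotient h x - D x) \<le> e / 2"
      using e by (intro quotient_bound d') (auto simp: dist_real_def)
    then show "dist (norm2_sq (\<lambda>x. quotient h x - D x)) 0 < e" using e by simp
  qed
qed

end

section \<open>The weak gradient of the modulus\<close>

text \<open>
  Where \<open>z = 0\<close>, the one-sided quotients of \<open>|z + h w|\<close> tend to \<open>|w|\<close> and \<open>- |w|\<close>; the symmetric quotient
  avoids having to show that the weak gradient vanishes almost everywhere on the zero set.
\<close>
lemma symmetric_quotient_norm_tendsto:
  fixes z w :: complex
  shows "((\<lambda>h. (norm (z + h *\<^sub>R w) - norm (z - h *\<^sub>R w)) / (2 * h)) \<longlongrightarrow> inner w (sgn z)) (at 0)"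
proof (cases "z = 0")
  case False
  let ?f = "\<lambda>h. norm (z + h *\<^sub>R w)"
  have "((\<lambda>h. z + h *\<^sub>R w) has_derivative (\<lambda>h. h *\<^sub>R w)) (at 0)"
    by (auto intro!: derivative_eq_intros)
  then have "(?f has_derivative (\<lambda>h. inner (h *\<^sub>R w) (sgn (z + 0 *\<^sub>R w)))) (at 0)"
    by (rule has_derivative_compose) (use has_derivative_norm[of "z + 0 *\<^sub>R w"] False in auto)
  then have "(?f has_real_derivative inner w (sgn z)) (at 0)"
    by (simp add: has_field_derivative_def mult.commute[of _ "inner w _"])
  then have 1: "((\<lambda>h. (?f h - norm z) / h) \<longlongrightarrow> inner w (sgn z)) (at 0)"
    by (simp add: has_field_derivative_iff)
  have "filterlim uminus (at 0) (at (0::real))"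
    by (rule filterlim_atI) (auto intro!: tendsto_eq_intros simp: eventually_at_filter)
  from filterlim_compose[OF 1 this]
  have 2: "((\<lambda>h. (?f (- h) - norm z) / (- h)) \<longlongrightarrow> inner w (sgn z)) (at 0)" .
  have "((\<lambda>h. ((?f h - norm z) / h + (?f (- h) - norm z) / (- h)) / 2) \<longlongrightarrow>
      (inner w (sgn z) + inner w (sgn z)) / 2) (at 0)"
    by (intro tendsto_intros 1 2) auto
  then have "((\<lambda>h. ((?f h - norm z) / h + (?f (- h) - norm z) / (- h)) / 2) \<longlongrightarrow> inner w (sgn z)) (at 0)"
    by simp
  moreover have eq: "((?f h - norm z) / h + (?f (- h) - norm z) / (- h)) / 2 =
      (norm (z + h *\<^sub>R w) - norm (z - h *\<^sub>R w)) / (2 * h)" for h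
    by (cases "h = 0") (auto simp: field_simps)
  ultimately show ?thesis by (simp only: eq)
qed simp

context magnetic_direction
begin

text \<open>This is \<partial>_j |\<psi>|: the term i a \<psi> in \<open>D\<close> is orthogonal to
  \<psi> over the reals and drops out, so \<open>D\<close> may stand in for \<partial>_j \<psi>. On
  the zero set of \<psi>, \<open>sgn 0 = 0\<close> assigns the value 0.\<close>

definition abs_deriv :: "real^2 \<Rightarrow> real" where
  "abs_deriv x = inner (D x) (sgn (\<psi> x))"

lemma abs_deriv_measurable [measurable]: "abs_deriv \<in> borel_measurable borel"
  unfolding abs_deriv_def sgn_div_norm by measurable

lemma abs_deriv_le: "\<bar>abs_deriv x\<bar> \<le> norm (D x)"
  using Cauchy_Schwarz_ineq2[of "D x" "sgn (\<psi> x)"] unfolding abs_deriv_def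
  by (cases "\<psi> x = 0") (auto simp: norm_sgn)

lemma square_integrable_abs_deriv: "square_integrable abs_deriv"
proof (rule square_integrable_bound(1))
  show "integrable lborel (\<lambda>x. (norm (D x))\<^sup>2)" using D by (simp add: square_integrable_def)
  show "(norm (abs_deriv x))\<^sup>2 \<le> (norm (D x))\<^sup>2" for x
    using abs_deriv_le[of x] by (intro power_mono) auto
qed measurable

lemma square_integrable_abs: "square_integrable (\<lambda>x. norm (\<psi> x))"
  using \<psi> by (auto simp: square_integrable_def)

text \<open>The moduli of the two translates are compared with those of the first-order models
  \<psi> + h D and \<psi> - h D. The models have a pointwise limit, and the error is controlled by
  the L^2 convergence of the quotients.\<close>

lemma symmetric_quotient_error:
  assumes h: "h > 0"
  shows "\<bar>(norm (mag_shift a j h \<psi> x) - norm (mag_shift a j (- h) \<psi> x)) / (2 * h)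
      - (norm (\<psi> x + h *\<^sub>R D x) - norm (\<psi> x - h *\<^sub>R D x)) / (2 * h)\<bar>
    \<le> (norm (quotient h x - D x) + norm (quotient (- h) x - D x)) / 2"
proof -
  have "mag_shift a j h \<psi> x - (\<psi> x + h *\<^sub>R D x) = h *\<^sub>R (quotient h x - D x)"
    "mag_shift a j (- h) \<psi> x - (\<psi> x - h *\<^sub>R D x) = - h *\<^sub>R (quotient (- h) x - D x)"
    using h by (simp_all add: quotient_def algebra_simps)
  then have "\<bar>norm (mag_shift a j h \<psi> x) - norm (\<psi> x + h *\<^sub>R D x)\<bar> \<le> h * norm (quotient h x - D x)"
    "\<bar>norm (mag_shift a j (- h) \<psi> x) - norm (\<psi> x - h *\<^sub>R D x)\<bar> \<le> h * norm (quotient (- h) x - D x)"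
    using h norm_triangle_ineq3[of "mag_shift a j h \<psi> x" "\<psi> x + h *\<^sub>R D x"]
      norm_triangle_ineq3[of "mag_shift a j (- h) \<psi> x" "\<psi> x - h *\<^sub>R D x"] by simp_all
  then have "\<bar>(norm (mag_shift a j h \<psi> x) - norm (mag_shift a j (- h) \<psi> x))
      - (norm (\<psi> x + h *\<^sub>R D x) - norm (\<psi> x - h *\<^sub>R D x))\<bar>
      \<le> h * (norm (quotient h x - D x) + norm (quotient (- h) x - D x))"
    by (simp add: distrib_left)
  then have "\<bar>(norm (mag_shift a j h \<psi> x) - norm (mag_shift a j (- h) \<psi> x))
      - (norm (\<psi> x + h *\<^sub>R D x) - norm (\<psi> x - h *\<^sub>R D x))\<bar> / (2 * h)
      \<le> h * (norm (quotient h x - D x) + norm (quotient (- h) x - D x)) / (2 * h)"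
    using h by (intro divide_right_mono) auto
  then show ?thesis
    using h by (simp add: diff_divide_distrib[symmetric] abs_divide)
qed

text \<open>Discrete integration by parts: the phase does not affect the modulus, so translation
  invariance moves the shift to \<phi>. The result is split into one-sided quotients with steps h
  and -h to fit \<open>test_quotient_tendsto\<close>.\<close>

lemma integral_symmetric_quotient_test:
  assumes \<phi>: "test_function \<phi>"
  shows "(LINT x|lborel. \<phi> x * ((norm (mag_shift a j h \<psi> x) - norm (mag_shift a j (- h) \<psi> x)) / (2 * h))) =
    - ((LINT x|lborel. ((\<phi> (x + h *\<^sub>R axis j 1) - \<phi> x) / h) *\<^sub>R norm (\<psi> x)) +
       (LINT x|lborel. ((\<phi> (x + (- h) *\<^sub>R axis j 1) - \<phi> x) / (- h)) *\<^sub>R norm (\<psi> x))) / 2"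
proof -
  note [measurable] = test_function_measurable[OF \<phi>]
  note li = square_integrable_locally_integrable[OF square_integrable_abs]
  let ?e = "axis j 1 :: real^2"
  have int0: "integrable lborel (\<lambda>x. \<phi> x * norm (\<psi> x))"
    using integrable_test_function_scaleR[OF \<phi> li] by simp
  have int: "integrable lborel (\<lambda>x. \<phi> (x + s *\<^sub>R ?e) * norm (\<psi> x))" for s
    using integrable_test_function_scaleR[OF test_function_shift(1)[OF \<phi>, of "- s *\<^sub>R ?e"] li] by simp
  have tr: "(LINT x|lborel. \<phi> x * norm (\<psi> (x + s *\<^sub>R ?e))) = (LINT x|lborel. \<phi> (x + (- s) *\<^sub>R ?e) * norm (\<psi> x))"
    "integrable lborel (\<lambda>x. \<phi> x * norm (\<psi> (x + s *\<^sub>R ?e)))" for s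
  proof -
    have m: "(\<lambda>x. \<phi> (x + (- s) *\<^sub>R ?e) * norm (\<psi> x)) \<in> borel_measurable borel" by measurable
    show "(LINT x|lborel. \<phi> x * norm (\<psi> (x + s *\<^sub>R ?e))) = (LINT x|lborel. \<phi> (x + (- s) *\<^sub>R ?e) * norm (\<psi> x))"
      "integrable lborel (\<lambda>x. \<phi> x * norm (\<psi> (x + s *\<^sub>R ?e)))"
      using lborel_translate[OF m, of "s *\<^sub>R ?e"] int[of "- s"] by simp_all
  qed
  have "(LINT x|lborel. \<phi> x * ((norm (mag_shift a j h \<psi> x) - norm (mag_shift a j (- h) \<psi> x)) / (2 * h))) =
      (LINT x|lborel. (\<phi> x * norm (\<psi> (x + h *\<^sub>R ?e)) - \<phi> x * norm (\<psi> (x + (- h) *\<^sub>R ?e))) / (2 * h))"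
    by (simp add: mag_shift_def norm_mult right_diff_distrib)
  also have "\<dots> = ((LINT x|lborel. \<phi> (x + (- h) *\<^sub>R ?e) * norm (\<psi> x)) -
      (LINT x|lborel. \<phi> (x + h *\<^sub>R ?e) * norm (\<psi> x))) / (2 * h)"
    unfolding integral_divide_zero Bochner_Integration.integral_diff[OF tr(2) tr(2)] tr(1) by simp
  finally have L: "(LINT x|lborel. \<phi> x * ((norm (mag_shift a j h \<psi> x) - norm (mag_shift a j (- h) \<psi> x)) / (2 * h))) = \<dots>" .
  have R: "(LINT x|lborel. ((\<phi> (x + s *\<^sub>R ?e) - \<phi> x) / s) *\<^sub>R norm (\<psi> x)) =
      ((LINT x|lborel. \<phi> (x + s *\<^sub>R ?e) * norm (\<psi> x)) - (LINT x|lborel. \<phi> x * norm (\<psi> x))) / s" for s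
  proof -
    have "(LINT x|lborel. ((\<phi> (x + s *\<^sub>R ?e) - \<phi> x) / s) *\<^sub>R norm (\<psi> x)) =
        (LINT x|lborel. (\<phi> (x + s *\<^sub>R ?e) * norm (\<psi> x) - \<phi> x * norm (\<psi> x)) / s)"
      by (simp add: left_diff_distrib)
    then show ?thesis
      unfolding integral_divide_zero Bochner_Integration.integral_diff[OF int int0] .
  qed
  show ?thesis
    unfolding L R by (cases "h = 0") (simp_all add: field_simps)
qed

text \<open>\<open>?T\<close> is the symmetric quotient of the translated modulus, to which discrete
  integration by parts applies; \<open>?S\<close> is its first-order model, dominated by the norm of
  \<open>D\<close> and pointwise convergent to \<open>abs_deriv\<close>. Tested against \<phi> their
  difference tends to 0, so the two limits agree.\<close>

lemma weak_deriv_abs: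
  assumes \<phi>: "test_function \<phi>"
  shows "(LINT x|lborel. partial_deriv j \<phi> x *\<^sub>R norm (\<psi> x)) = - (LINT x|lborel. \<phi> x *\<^sub>R abs_deriv x)"
proof -
  note [measurable] = test_function_measurable[OF \<phi>]
  note sq\<phi> = test_function_square_integrable[OF \<phi>]
  note li = square_integrable_locally_integrable[OF square_integrable_abs]
  define h where "h = (\<lambda>n. inverse (real (Suc n)))"
  have h: "h \<longlonglongrightarrow> 0" "h n > 0" "h n \<noteq> 0" "\<bar>h n\<bar> \<le> 1" for n
    unfolding h_def by (auto simp: LIMSEQ_inverse_real_of_nat inverse_le_1_iff simp del: of_nat_Suc)
  have h': "(\<lambda>n. - h n) \<longlonglongrightarrow> 0"
    using tendsto_minus[OF h(1)] by simp
  have h0: "filterlim h (at 0) sequentially" "filterlim (\<lambda>n. - h n) (at 0) sequentially"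
    using h h' by (auto intro!: filterlim_atI)
  let ?T = "\<lambda>n x. (norm (mag_shift a j (h n) \<psi> x) - norm (mag_shift a j (- h n) \<psi> x)) / (2 * h n)"
  let ?S = "\<lambda>n x. (norm (\<psi> x + h n *\<^sub>R D x) - norm (\<psi> x - h n *\<^sub>R D x)) / (2 * h n)"
  let ?I = "LINT x|lborel. partial_deriv j \<phi> x *\<^sub>R norm (\<psi> x)"
  have "(\<lambda>n. LINT x|lborel. \<phi> x * ?T n x) \<longlonglongrightarrow> - (?I + ?I) / 2"
    unfolding integral_symmetric_quotient_test[OF \<phi>]
    by (intro tendsto_intros test_quotient_tendsto[OF \<phi> li, of h] test_quotient_tendsto[OF \<phi> li, of "\<lambda>n. - h n"])
       (use h h' in auto)
  then have lim1: "(\<lambda>n. LINT x|lborel. \<phi> x * ?T n x) \<longlonglongrightarrow> - ?I" by simp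
  have S_le: "\<bar>?S n x\<bar> \<le> norm (D x)" for n x
  proof -
    have eq: "\<psi> x + h n *\<^sub>R D x - (\<psi> x - h n *\<^sub>R D x) = (2 * h n) *\<^sub>R D x"
      by (simp add: complex_eq_iff)
    have "\<bar>norm (\<psi> x + h n *\<^sub>R D x) - norm (\<psi> x - h n *\<^sub>R D x)\<bar> \<le> norm ((2 * h n) *\<^sub>R D x)"
      using norm_triangle_ineq3[of "\<psi> x + h n *\<^sub>R D x" "\<psi> x - h n *\<^sub>R D x"] unfolding eq .
    also have "\<dots> = norm (D x) * (2 * h n)"
      using h(2)[of n] by simp
    finally show ?thesis
      using h(2)[of n] by (simp add: abs_divide pos_divide_le_eq)
  qed
  have \<phi>S_le: "norm (\<phi> x * ?S n x) \<le> norm (\<phi> x) * norm (D x)" for n x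
    unfolding real_norm_def abs_mult by (intro mult_left_mono S_le) simp
  have int\<phi>D: "integrable lborel (\<lambda>x. norm (\<phi> x) * norm (D x))"
    by (intro square_integrable_norm_mult sq\<phi> D)
  have intS: "integrable lborel (\<lambda>x. \<phi> x * ?S n x)" for n
  proof (rule Bochner_Integration.integrable_bound[OF int\<phi>D])
    show "AE x in lborel. norm (\<phi> x * ?S n x) \<le> norm (norm (\<phi> x) * norm (D x))"
      by (intro AE_I2 order_trans[OF \<phi>S_le]) simp
  qed measurable
  have lim2: "(\<lambda>n. LINT x|lborel. \<phi> x * ?S n x) \<longlonglongrightarrow> (LINT x|lborel. \<phi> x * abs_deriv x)"
  proof (rule integral_dominated_convergence[OF _ _ int\<phi>D])
    show "AE x in lborel. (\<lambda>n. \<phi> x * ?S n x) \<longlonglongrightarrow> \<phi> x * abs_deriv x"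
      unfolding abs_deriv_def
      by (intro AE_I2 tendsto_intros filterlim_compose[OF symmetric_quotient_norm_tendsto h0(1)])
    show "AE x in lborel. norm (\<phi> x * ?S n x) \<le> norm (\<phi> x) * norm (D x)" for n
      by (intro AE_I2 \<phi>S_le)
  qed measurable
  let ?E = "\<lambda>n. sqrt (norm2_sq \<phi>) * (sqrt (norm2_sq (\<lambda>x. quotient (h n) x - D x)) +
      sqrt (norm2_sq (\<lambda>x. quotient (- h n) x - D x))) / 2"
  have "(\<lambda>n. (LINT x|lborel. \<phi> x * ?T n x) - (LINT x|lborel. \<phi> x * ?S n x)) \<longlonglongrightarrow> 0"
  proof (rule Lim_null_comparison)
    show "\<forall>\<^sub>F n in sequentially. norm ((LINT x|lborel. \<phi> x * ?T n x) - (LINT x|lborel. \<phi> x * ?S n x)) \<le> ?E n"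
    proof (intro always_eventually allI)
      fix n
      let ?w = "\<lambda>x. (norm (\<phi> x) * norm (quotient (h n) x - D x) + norm (\<phi> x) * norm (quotient (- h n) x - D x)) / 2"
      note sqd = square_integrable_diff(1)[OF square_integrable_quotient D]
      have w: "integrable lborel ?w"
        by (intro integrable_divide Bochner_Integration.integrable_add square_integrable_norm_mult sq\<phi> sqd)
      have le: "norm (\<phi> x * ?T n x - \<phi> x * ?S n x) \<le> ?w x" for x
      proof -
        have "norm (\<phi> x * ?T n x - \<phi> x * ?S n x) = \<bar>\<phi> x\<bar> * \<bar>?T n x - ?S n x\<bar>"
          unfolding right_diff_distrib[symmetric] by (simp add: abs_mult)
        also have "\<dots> \<le> \<bar>\<phi> x\<bar> * ((norm (quotient (h n) x - D x) + norm (quotient (- h n) x - D x)) / 2)"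
          by (intro mult_left_mono symmetric_quotient_error h) simp
        finally show ?thesis by (simp add: algebra_simps)
      qed
      have diff: "integrable lborel (\<lambda>x. \<phi> x * ?T n x - \<phi> x * ?S n x)"
        by (rule Bochner_Integration.integrable_bound[OF w])
           (measurable, intro AE_I2 order_trans[OF le], simp)
      have intT: "integrable lborel (\<lambda>x. \<phi> x * ?T n x)"
        using Bochner_Integration.integrable_add[OF diff intS[of n]] by simp
      have "norm (LINT x|lborel. \<phi> x * ?T n x - \<phi> x * ?S n x) \<le> (LINT x|lborel. ?w x)"
        by (rule Bochner_Integration.integral_norm_bound_integral[OF diff w le])
      also have "(LINT x|lborel. ?w x) = ((LINT x|lborel. norm (\<phi> x) * norm (quotient (h n) x - D x)) +
          (LINT x|lborel. norm (\<phi> x) * norm (quotient (- h n) x - D x))) / 2"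
        by (simp only: integral_divide_zero
            Bochner_Integration.integral_add[OF square_integrable_norm_mult[OF sq\<phi> sqd] square_integrable_norm_mult[OF sq\<phi> sqd]])
      also have "\<dots> \<le> (sqrt (norm2_sq \<phi>) * sqrt (norm2_sq (\<lambda>x. quotient (h n) x - D x)) +
          sqrt (norm2_sq \<phi>) * sqrt (norm2_sq (\<lambda>x. quotient (- h n) x - D x))) / 2"
        by (intro divide_right_mono add_mono Cauchy_Schwarz_norm2_sq sq\<phi> sqd) simp
      finally show "norm ((LINT x|lborel. \<phi> x * ?T n x) - (LINT x|lborel. \<phi> x * ?S n x)) \<le> ?E n"
        unfolding Bochner_Integration.integral_diff[OF intT intS] by (simp add: distrib_left)
    qed
    have "?E \<longlonglongrightarrow> sqrt (norm2_sq \<phi>) * (sqrt 0 + sqrt 0) / 2"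
      by (intro tendsto_intros filterlim_compose[OF quotient_tendsto h0(1)]
          filterlim_compose[OF quotient_tendsto h0(2)]) auto
    then show "?E \<longlonglongrightarrow> 0" by simp
  qed
  from tendsto_add[OF this lim2]
  have "(\<lambda>n. LINT x|lborel. \<phi> x * ?T n x) \<longlonglongrightarrow> (LINT x|lborel. \<phi> x * abs_deriv x)" by simp
  with lim1 have "- ?I = (LINT x|lborel. \<phi> x * abs_deriv x)"
    by (rule LIMSEQ_unique)
  then show ?thesis by simp
qed

end

section \<open>The commutator of the magnetic derivatives\<close>

lemma measurable_cnj [measurable]: "cnj \<in> borel_measurable borel"
  by (intro borel_measurable_continuous_onI continuous_intros)

lemma integrable_cnj_mult:
  fixes f g :: "real^2 \<Rightarrow> complex"
  assumes "square_integrable f" "square_integrable g"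
  shows "integrable lborel (\<lambda>x. cnj (f x) * g x)"
proof -
  note [measurable] = assms[THEN square_integrable_measurable]
  show ?thesis
    by (rule Bochner_Integration.integrable_bound[OF square_integrable_norm_mult[OF assms]])
       (measurable, simp add: norm_mult)
qed

lemma integral_cnj_mag_shift_left:
  assumes [measurable]: "a \<in> borel_measurable borel" "f \<in> borel_measurable borel" "g \<in> borel_measurable borel"
    and a: "\<And>x s. a (x + s *\<^sub>R axis j 1) = a x"
  shows "(LINT x|lborel. cnj (mag_shift a j s f x) * g x) = (LINT x|lborel. cnj (f x) * mag_shift a j (- s) g x)"
proof -
  let ?F = "\<lambda>x. cnj (f x) * mag_shift a j (- s) g x"
  have "?F \<in> borel_measurable borel" by measurable
  from lborel_translate(1)[OF this, of "s *\<^sub>R axis j 1"]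
  show ?thesis
    by (simp add: mag_shift_def a cis_cnj mult_ac)
qed

text \<open>The commutation phase is the magnetic flux through a square of side h, hence quadratic
  in h, and survives division by the area. The substitution t = h^2 reduces the limit to a
  derivative at 0.\<close>

lemma cis_quotient_tendsto: "((\<lambda>h. (1 - cis (- (c * h\<^sup>2))) / complex_of_real (h\<^sup>2)) \<longlongrightarrow> \<i> * c) (at 0)"
proof -
  have sq: "filterlim (\<lambda>h::real. h\<^sup>2) (at 0) (at 0)"
    by (rule filterlim_atI) (auto intro!: tendsto_eq_intros simp: eventually_at_filter)
  have d: "((\<lambda>t. (1 - cos (c * t)) / t) \<longlongrightarrow> 0) (at 0)" "((\<lambda>t. sin (c * t) / t) \<longlongrightarrow> c) (at 0)"
  proof -
    have "((\<lambda>t. 1 - cos (c * t)) has_real_derivative 0) (at 0)" "((\<lambda>t. sin (c * t)) has_real_derivative c) (at 0)"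
      by (auto intro!: derivative_eq_intros)
    then show "((\<lambda>t. (1 - cos (c * t)) / t) \<longlongrightarrow> 0) (at 0)" "((\<lambda>t. sin (c * t) / t) \<longlongrightarrow> c) (at 0)"
      by (auto simp: has_field_derivative_iff)
  qed
  show ?thesis
    unfolding tendsto_complex_iff
    using filterlim_compose[OF d(1) sq] filterlim_compose[OF d(2) sq]
    by (simp add: Re_divide_of_real Im_divide_of_real)
qed

lemma integral_cnj_mult_self: "(LINT x|lborel. cnj (f x) * f x) = complex_of_real (norm2_sq f)"
proof -
  have "cnj (f x) * f x = complex_of_real ((norm (f x))\<^sup>2)" for x
    by (metis complex_norm_square mult.commute)
  then show ?thesis by (simp add: norm2_sq_def del: of_real_power)
qed

text \<open>Translating by the diagonal of a square of side h brings both integrands to the same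
  pair of corners, x + h e_1 and x + h e_2. Each potential changes by b h in absolute value under
  this translation, and the two contributions add up to the flux 2 b h^2.\<close>

lemma magnetic_commutator_difference:
  fixes b h :: real
  defines "a1 \<equiv> \<lambda>x :: real^2. b * x $ 2" and "a2 \<equiv> \<lambda>x :: real^2. - b * x $ 1"
  assumes [measurable]: "\<psi> \<in> borel_measurable borel"
  shows "(LINT x|lborel. cnj (mag_shift a2 2 (- h) \<psi> x) * mag_shift a1 1 (- h) \<psi> x) =
    cis (- (2 * b * h\<^sup>2)) * (LINT x|lborel. cnj (mag_shift a1 1 h \<psi> x) * mag_shift a2 2 h \<psi> x)"
proof -
  have [measurable]: "a1 \<in> borel_measurable borel" "a2 \<in> borel_measurable borel"
    unfolding a1_def a2_def by (intro borel_measurable_continuous_onI continuous_intros)+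
  let ?e = "h *\<^sub>R axis 1 1 + h *\<^sub>R axis 2 1 :: real^2"
  let ?F = "\<lambda>x. cnj (mag_shift a2 2 (- h) \<psi> x) * mag_shift a1 1 (- h) \<psi> x"
  have "?F \<in> borel_measurable borel" by measurable
  from lborel_translate(1)[OF this, of ?e]
  have "(LINT x|lborel. ?F x) = (LINT x|lborel. ?F (x + ?e))" by simp
  also have "\<dots> = (LINT x|lborel. cis (- (2 * b * h\<^sup>2)) * (cnj (mag_shift a1 1 h \<psi> x) * mag_shift a2 2 h \<psi> x))"
  proof (rule Bochner_Integration.integral_cong[OF refl])
    fix x
    have a: "a1 (x + ?e) = a1 x + b * h" "a2 (x + ?e) = a2 x - b * h"
      by (simp_all add: a1_def a2_def axis_def algebra_simps)
    have v: "x + ?e + (- h) *\<^sub>R axis 2 1 = x + h *\<^sub>R axis 1 1" "x + ?e + (- h) *\<^sub>R axis 1 1 = x + h *\<^sub>R axis 2 1"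
      by simp_all
    have c: "cnj (cis (- h * (a2 x - b * h))) * cis (- h * (a1 x + b * h)) =
        cis (- (2 * b * h\<^sup>2)) * (cnj (cis (h * a1 x)) * cis (h * a2 x))"
      by (simp add: cis_cnj cis_mult algebra_simps power2_eq_square)
    have "?F (x + ?e) = (cnj (cis (- h * (a2 x - b * h))) * cis (- h * (a1 x + b * h))) *
        (cnj (\<psi> (x + h *\<^sub>R axis 1 1)) * \<psi> (x + h *\<^sub>R axis 2 1))"
      unfolding mag_shift_def a v by (simp add: mult_ac)
    then show "?F (x + ?e) = cis (- (2 * b * h\<^sup>2)) * (cnj (mag_shift a1 1 h \<psi> x) * mag_shift a2 2 h \<psi> x)"
      unfolding c mag_shift_def by (simp add: mult_ac)
  qed
  finally show ?thesis by simp
qed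

text \<open>Formally, 2 i Im <D_1 \<psi>, D_2 \<psi>> = - <\<psi>, [D_1, D_2] \<psi>> with
  [D_1, D_2] = - 2 i b. As \<psi> has no second derivatives, the difference quotients take the place
  of D_1 and D_2, and the limit is taken only in their inner products.\<close>

proposition magnetic_commutator:
  fixes b :: real
  assumes M1: "magnetic_direction (\<lambda>x. b * x $ 2) 1 \<psi> D1"
    and M2: "magnetic_direction (\<lambda>x. - b * x $ 1) 2 \<psi> D2"
  shows "(LINT x|lborel. Im (cnj (D1 x) * D2 x)) = b * norm2_sq \<psi>"
proof -
  interpret M1: magnetic_direction "\<lambda>x. b * x $ 2" 1 \<psi> D1 by (rule M1)
  interpret M2: magnetic_direction "\<lambda>x. - b * x $ 1" 2 \<psi> D2 by (rule M2)
  define U1 where "U1 = (\<lambda>h. mag_shift (\<lambda>x. b * x $ 2) 1 h \<psi>)"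
  define U2 where "U2 = (\<lambda>h. mag_shift (\<lambda>x. - b * x $ 1) 2 h \<psi>)"
  define I :: "(real^2 \<Rightarrow> complex) \<Rightarrow> (real^2 \<Rightarrow> complex) \<Rightarrow> complex"
    where "I = (\<lambda>f g. LINT x|lborel. cnj (f x) * g x)"
  note sq = M1.\<psi> M1.D M2.D
  have sqU: "square_integrable (U1 h)" "square_integrable (U2 h)" for h
    unfolding U1_def U2_def
    by (intro square_integrable_mag_shift M1.\<psi> M1.a_measurable M2.a_measurable)+
  have q: "M1.quotient h = (\<lambda>x. (1 / h) *\<^sub>R (U1 h x - \<psi> x))" "M2.quotient h = (\<lambda>x. (1 / h) *\<^sub>R (U2 h x - \<psi> x))" for h
    unfolding U1_def U2_def by (rule ext, rule M1.quotient_def) (rule ext, rule M2.quotient_def)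
  have I_quot: "I (\<lambda>x. (1 / h) *\<^sub>R (f x - \<psi> x)) (\<lambda>x. (1 / h) *\<^sub>R (g x - \<psi> x)) =
      (I f g - I f \<psi> - I \<psi> g + I \<psi> \<psi>) / complex_of_real (h\<^sup>2)"
    if "square_integrable f" "square_integrable g" for f g h
  proof -
    note int = integrable_cnj_mult[OF that] integrable_cnj_mult[OF that(1) sq(1)]
      integrable_cnj_mult[OF sq(1) that(2)] integrable_cnj_mult[OF sq(1) sq(1)]
    have "I (\<lambda>x. (1 / h) *\<^sub>R (f x - \<psi> x)) (\<lambda>x. (1 / h) *\<^sub>R (g x - \<psi> x)) =
        (LINT x|lborel. (cnj (f x) * g x - cnj (f x) * \<psi> x - cnj (\<psi> x) * g x + cnj (\<psi> x) * \<psi> x) / complex_of_real (h\<^sup>2))"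
      unfolding I_def
      by (rule Bochner_Integration.integral_cong)
         (auto simp: scaleR_conv_of_real power2_eq_square divide_simps algebra_simps)
    then show ?thesis
      by (simp add: I_def int)
  qed
  have adj: "I (U1 h) \<psi> = I \<psi> (U1 (- h))" "I (U2 (- h)) \<psi> = I \<psi> (U2 h)" for h
    unfolding I_def U1_def U2_def
    using integral_cnj_mag_shift_left[OF M1.a_measurable M1.\<psi>_measurable M1.\<psi>_measurable M1.a_invariant, of h]
      integral_cnj_mag_shift_left[OF M2.a_measurable M1.\<psi>_measurable M1.\<psi>_measurable M2.a_invariant, of "- h"]
    by simp_all
  have comm: "I (U2 (- h)) (U1 (- h)) = cis (- (2 * b * h\<^sup>2)) * I (U1 h) (U2 h)" for h
    unfolding I_def U1_def U2_def by (rule magnetic_commutator_difference) simp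
  \<comment> \<open>The adjoint of U_j(h) is U_j(-h), so subtracting the pairing with steps -h in
    the opposite order cancels all the cross terms with \<psi> and leaves only the commutation
    phase.\<close>
  have diff: "I (M1.quotient h) (M2.quotient h) - I (M2.quotient (- h)) (M1.quotient (- h)) =
      (1 - cis (- (2 * b * h\<^sup>2))) / complex_of_real (h\<^sup>2) * I (U1 h) (U2 h)" for h
    unfolding q I_quot[OF sqU] I_quot[OF sqU(2) sqU(1)] comm adj
    by (simp add: diff_divide_distrib add_divide_distrib left_diff_distrib)
  have um: "filterlim uminus (at 0) (at (0::real))"
    by (rule filterlim_atI) (auto intro!: tendsto_eq_intros simp: eventually_at_filter)
  note sqq = M1.square_integrable_quotient M2.square_integrable_quotient
  have 1: "((\<lambda>h. I (M1.quotient h) (M2.quotient h)) \<longlongrightarrow> I D1 D2) (at 0)"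
    unfolding I_def
    by (rule tendsto_integral_cnj_mult[OF sqq sq(2,3) M1.quotient_tendsto M2.quotient_tendsto])
  have "((\<lambda>h. I (M2.quotient h) (M1.quotient h)) \<longlongrightarrow> I D2 D1) (at 0)"
    unfolding I_def
    by (rule tendsto_integral_cnj_mult[OF sqq(2,1) sq(3,2) M2.quotient_tendsto M1.quotient_tendsto])
  from filterlim_compose[OF this um]
  have 2: "((\<lambda>h. I (M2.quotient (- h)) (M1.quotient (- h))) \<longlongrightarrow> I D2 D1) (at 0)" .
  have 3: "((\<lambda>h. I (U1 h) (U2 h)) \<longlongrightarrow> I \<psi> \<psi>) (at 0)"
    unfolding I_def
  proof (rule tendsto_integral_cnj_mult[OF sqU sq(1) sq(1)])
    show "((\<lambda>h. norm2_sq (\<lambda>x. U1 h x - \<psi> x)) \<longlongrightarrow> 0) (at 0)" "((\<lambda>h. norm2_sq (\<lambda>x. U2 h x - \<psi> x)) \<longlongrightarrow> 0) (at 0)"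
      unfolding U1_def U2_def by (rule mag_shift_tendsto[OF M1.a_continuous sq(1)] mag_shift_tendsto[OF M2.a_continuous sq(1)])+
  qed
  have "((\<lambda>h. I (M1.quotient h) (M2.quotient h) - I (M2.quotient (- h)) (M1.quotient (- h))) \<longlongrightarrow> I D1 D2 - I D2 D1) (at 0)"
    by (intro tendsto_intros 1 2)
  moreover have "((\<lambda>h. I (M1.quotient h) (M2.quotient h) - I (M2.quotient (- h)) (M1.quotient (- h))) \<longlongrightarrow>
      \<i> * complex_of_real (2 * b) * I \<psi> \<psi>) (at 0)"
    unfolding diff by (intro tendsto_mult cis_quotient_tendsto 3)
  ultimately have eq: "I D1 D2 - I D2 D1 = \<i> * complex_of_real (2 * b) * I \<psi> \<psi>"
    by (rule LIM_unique)
  have "I D2 D1 = cnj (I D1 D2)"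
    using Bochner_Integration.integral_cnj[of lborel "\<lambda>x. cnj (D1 x) * D2 x"] by (simp add: I_def mult.commute)
  with eq have "2 * Im (I D1 D2) = 2 * b * norm2_sq \<psi>"
    by (auto simp: I_def integral_cnj_mult_self complex_eq_iff)
  moreover have "Im (I D1 D2) = (LINT x|lborel. Im (cnj (D1 x) * D2 x))"
    unfolding I_def by (rule integral_Im[symmetric, OF integrable_cnj_mult[OF sq(2,3)]])
  ultimately show ?thesis by simp
qed

section \<open>Scaling the Gagliardo--Nirenberg inequality\<close>

lemma norm_vec2_sq: "(norm (v :: 'b::real_normed_vector^2))\<^sup>2 = (norm (v $ 1))\<^sup>2 + (norm (v $ 2))\<^sup>2"
  by (simp add: norm_vec_def L2_set_def sum_2)

lemma square_integrable_component:
  fixes G :: "real^2 \<Rightarrow> 'b::euclidean_space^2"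
  assumes "square_integrable G" shows "square_integrable (\<lambda>x. G x $ j)"
proof (rule square_integrable_bound(1))
  show "integrable lborel (\<lambda>x. (norm (G x))\<^sup>2)" using assms by (simp add: square_integrable_def)
  have "(\<lambda>v :: 'b^2. v $ j) \<in> borel_measurable borel"
    by (intro borel_measurable_continuous_onI continuous_intros)
  from measurable_compose[OF square_integrable_measurable[OF assms] this]
  show "(\<lambda>x. G x $ j) \<in> borel_measurable borel" .
  show "(norm (G x $ j))\<^sup>2 \<le> (norm (G x))\<^sup>2" for x
    by (intro power_mono Finite_Cartesian_Product.norm_nth_le) auto
qed

lemma square_integrable_vec:
  fixes G :: "real^2 \<Rightarrow> 'b::euclidean_space^2"
  assumes "\<And>j. square_integrable (\<lambda>x. G x $ j)"
  shows "square_integrable G"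
proof (rule square_integrable_bound(1))
  show "integrable lborel (\<lambda>x. (norm (G x $ 1))\<^sup>2 + (norm (G x $ 2))\<^sup>2)"
    using assms by (auto simp: square_integrable_def)
  have "(\<lambda>y. axis j y :: 'b^2) \<in> borel_measurable borel" for j
  proof -
    have "continuous_on UNIV (\<lambda>y :: 'b. if i = j then y else 0)" for i by (cases "i = j") auto
    then show ?thesis
      unfolding axis_def by (intro borel_measurable_continuous_onI continuous_on_vec_lambda)
  qed
  then have "(\<lambda>x. axis 1 (G x $ 1) + axis 2 (G x $ 2) :: 'b^2) \<in> borel_measurable borel"
    using assms[THEN square_integrable_measurable]
    by (intro borel_measurable_add) (auto intro: measurable_compose)
  moreover have "axis 1 (G x $ 1) + axis 2 (G x $ 2) = G x" for x
    by (simp add: vec_eq_iff forall_2 axis_def)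
  ultimately show "G \<in> borel_measurable borel" by simp
  show "(norm (G x))\<^sup>2 \<le> (norm (G x $ 1))\<^sup>2 + (norm (G x $ 2))\<^sup>2" for x
    by (simp add: norm_vec2_sq)
qed

lemma square_integrable_weak_grad:
  assumes G: "is_weak_grad u G" and sq: "square_integrable G"
  shows "square_integrable (weak_grad u)" and "norm2_sq (weak_grad u) = norm2_sq G"
proof -
  have "is_weak_grad u (weak_grad u)"
    using G is_weak_grad_weak_grad by blast
  then have m: "weak_grad u \<in> borel_measurable borel"
    by (auto simp: is_weak_grad_def intro: locally_integrable_measurable)
  have ae: "AE x in lborel. (norm (weak_grad u x))\<^sup>2 = (norm (G x))\<^sup>2"
    using weak_grad_AE_eq[OF G] by eventually_elim simp
  have "integrable lborel (\<lambda>x. (norm (weak_grad u x))\<^sup>2) \<longleftrightarrow> integrable lborel (\<lambda>x. (norm (G x))\<^sup>2)"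
    using m square_integrable_measurable[OF sq] by (intro integrable_cong_AE ae) auto
  then show "square_integrable (weak_grad u)"
    using m sq by (simp add: square_integrable_def)
  show "norm2_sq (weak_grad u) = norm2_sq G"
    unfolding norm2_sq_def using m square_integrable_measurable[OF sq] by (intro integral_cong_AE ae) auto
qed

text \<open>If \<open>Lq_norm p u\<close> is 0, be it the default value for a non-integrable power,
  the left-hand side vanishes. Otherwise \<open>u\<close> is not null and competes in the infimum
  defining \<open>C_p\<close>, which is a genuine lower bound because the quotients are
  nonnegative.\<close>

lemma C_p_le:
  fixes u :: "real^2 \<Rightarrow> real"
  assumes u: "square_integrable u" and G: "is_weak_grad u G" "square_integrable G"
  shows "C_p p * (Lq_norm p u)\<^sup>2 \<le> norm2_sq G + norm2_sq u"
proof (cases "Lq_norm p u = 0")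
  case False
  then have "\<not> (AE x in lborel. u x = 0)"
  proof (rule contrapos_nn)
    assume "AE x in lborel. u x = 0"
    then have "AE x in lborel. norm (u x) powr p = 0" by eventually_elim simp
    then have "(LINT x|lborel. norm (u x) powr p) = (LINT x|(lborel :: (real^2) measure). 0)"
      using square_integrable_measurable[OF u] by (intro integral_cong_AE) auto
    then show "Lq_norm p u = 0" by (simp add: Lq_norm_def)
  qed
  moreover have "u \<in> H1"
    using u G square_integrable_weak_grad(1)[OF G] by (auto simp: H1_def in_Lq_2_iff)
  ultimately have "C_p p \<le> ((Lq_norm 2 (weak_grad u))\<^sup>2 + (Lq_norm 2 u)\<^sup>2) / (Lq_norm p u)\<^sup>2"
    unfolding C_p_def by (intro cInf_lower bdd_belowI[of _ 0]) auto
  then show ?thesis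
    using False by (simp add: Lq_norm_2_sq square_integrable_weak_grad(2)[OF G] field_simps)
qed simp

section \<open>Dilations of the plane\<close>

lemma lborel_scale:
  fixes f :: "real^2 \<Rightarrow> 'b::{banach, second_countable_topology}"
  assumes f: "f \<in> borel_measurable borel" and s: "s > 0"
  shows "(LINT x|lborel. f (s *\<^sub>R x)) = (1 / s\<^sup>2) *\<^sub>R (LINT x|lborel. f x)"
    and "integrable lborel (\<lambda>x. f (s *\<^sub>R x)) \<longleftrightarrow> integrable lborel f"
proof -
  have eq: "lborel = density (distr lborel borel (\<lambda>x :: real^2. s *\<^sub>R x)) (\<lambda>_. ennreal (s\<^sup>2))"
    using lborel_affine[of s "0 :: real^2"] s by (simp add: ennreal_power)
  have [measurable]: "(\<lambda>x :: real^2. s *\<^sub>R x) \<in> borel_measurable borel" by measurable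
  have "(LINT x|lborel. f x) = (LINT x|distr lborel borel (\<lambda>x :: real^2. s *\<^sub>R x). s\<^sup>2 *\<^sub>R f x)"
    by (subst eq, subst integral_density) (use f in auto)
  also have "\<dots> = s\<^sup>2 *\<^sub>R (LINT x|lborel. f (s *\<^sub>R x))"
    using f by (subst integral_distr) auto
  finally show "(LINT x|lborel. f (s *\<^sub>R x)) = (1 / s\<^sup>2) *\<^sub>R (LINT x|lborel. f x)"
    using s by simp
  have scaleR_iff: "integrable lborel (\<lambda>x. s\<^sup>2 *\<^sub>R g x) \<longleftrightarrow> integrable lborel g" for g :: "real^2 \<Rightarrow> 'b"
    using integrable_scaleR_right[of "1 / s\<^sup>2" lborel "\<lambda>x. s\<^sup>2 *\<^sub>R g x"] s by auto
  have "integrable lborel f \<longleftrightarrow> integrable (distr lborel borel (\<lambda>x :: real^2. s *\<^sub>R x)) (\<lambda>x. s\<^sup>2 *\<^sub>R f x)"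
    by (subst eq, subst integrable_density) (use f in auto)
  also have "\<dots> \<longleftrightarrow> integrable lborel (\<lambda>x. f (s *\<^sub>R x))"
    using f by (subst integrable_distr_eq) (auto simp: scaleR_iff)
  finally show "integrable lborel (\<lambda>x. f (s *\<^sub>R x)) \<longleftrightarrow> integrable lborel f" by simp
qed

lemma square_integrable_scale:
  assumes u: "square_integrable u" and s: "s > 0"
  shows "square_integrable (\<lambda>x. u (s *\<^sub>R x))" "norm2_sq (\<lambda>x. u (s *\<^sub>R x)) = norm2_sq u / s\<^sup>2"
proof -
  note [measurable] = square_integrable_measurable[OF u]
  have "(\<lambda>x. (norm (u x))\<^sup>2) \<in> borel_measurable borel" by measurable
  from lborel_scale[OF this s] u
  show "square_integrable (\<lambda>x. u (s *\<^sub>R x))" "norm2_sq (\<lambda>x. u (s *\<^sub>R x)) = norm2_sq u / s\<^sup>2"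
    by (simp_all add: square_integrable_def norm2_sq_def)
qed

lemma is_weak_grad_scale:
  fixes u :: "real^2 \<Rightarrow> real"
  assumes u: "square_integrable u" and G: "is_weak_grad u G" "square_integrable G" and s: "s > 0"
  shows "is_weak_grad (\<lambda>x. u (s *\<^sub>R x)) (\<lambda>x. s *\<^sub>R G (s *\<^sub>R x))"
  unfolding is_weak_grad_def
proof (intro conjI allI impI)
  show "locally_integrable (\<lambda>x. u (s *\<^sub>R x))" "locally_integrable (\<lambda>x. s *\<^sub>R G (s *\<^sub>R x))"
    by (intro square_integrable_locally_integrable square_integrable_scaleR square_integrable_scale u G s)+
  fix \<phi> j assume \<phi>: "test_function \<phi>"
  note [measurable] = square_integrable_measurable[OF u] test_function_measurable[OF \<phi>]
    square_integrable_measurable[OF square_integrable_component[OF G(2), of j]]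
    test_function_measurable[OF test_function_partial_deriv[OF \<phi>]]
  \<comment> \<open>The inverse dilation of the test function; the summand 0 matches the form of the
    affine-argument lemmas.\<close>
  define \<theta> where "\<theta> = (\<lambda>x. \<phi> (0 + (1 / s) *\<^sub>R x))"
  have \<theta>: "test_function \<theta>"
    unfolding \<theta>_def using s by (intro test_function_affine_arg \<phi>) auto
  note [measurable] = test_function_measurable[OF \<theta>]
    test_function_measurable[OF test_function_partial_deriv[OF \<theta>]]
  have d: "partial_deriv j \<theta> = (\<lambda>x. (1 / s) * partial_deriv j \<phi> ((1 / s) *\<^sub>R x))"
    unfolding \<theta>_def by (subst partial_deriv_affine[OF test_function_differentiable[OF \<phi>]]) simp
  have 1: "(\<lambda>x. s * (partial_deriv j \<theta> x *\<^sub>R u x)) \<in> borel_measurable borel"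
    and 2: "(\<lambda>x. s * (\<theta> x *\<^sub>R (G x $ j))) \<in> borel_measurable borel" by measurable
  have "(LINT x|lborel. partial_deriv j \<phi> x *\<^sub>R u (s *\<^sub>R x)) =
      (1 / s\<^sup>2) * (s * (LINT x|lborel. partial_deriv j \<theta> x *\<^sub>R u x))"
    using lborel_scale(1)[OF 1 s] s by (simp add: d)
  also have "(LINT x|lborel. partial_deriv j \<theta> x *\<^sub>R u x) = - (LINT x|lborel. \<theta> x *\<^sub>R (G x $ j))"
    using G(1) \<theta> by (simp add: is_weak_grad_def)
  also have "(1 / s\<^sup>2) * (s * - (LINT x|lborel. \<theta> x *\<^sub>R (G x $ j))) =
      - (LINT x|lborel. \<phi> x *\<^sub>R (s *\<^sub>R G (s *\<^sub>R x)) $ j)"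
    using lborel_scale(1)[OF 2 s] s by (simp add: \<theta>_def mult_ac)
  finally show "(LINT x|lborel. partial_deriv j \<phi> x *\<^sub>R u (s *\<^sub>R x)) =
      - (LINT x|lborel. \<phi> x *\<^sub>R (s *\<^sub>R G (s *\<^sub>R x)) $ j)" .
qed

lemma Lq_norm_scale:
  assumes [measurable]: "u \<in> borel_measurable borel" and s: "s > 0"
  shows "Lq_norm p (\<lambda>x. u (s *\<^sub>R x)) = (1 / s\<^sup>2) powr (1 / p) * Lq_norm p u"
proof -
  have "(\<lambda>x. norm (u x) powr p) \<in> borel_measurable borel" by measurable
  from lborel_scale(1)[OF this s] show ?thesis
    unfolding Lq_norm_def using s by (simp add: powr_mult powr_divide)
qed

text \<open>In the plane the Dirichlet integral is invariant under dilations, while the squared L^2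
  norm of u(s x) carries the factor 1/s^2. The choice s^2 = k/l therefore produces the weights in
  the ratio of k to l, and multiplication by k restores them.\<close>

lemma weighted_C_p_le:
  fixes u :: "real^2 \<Rightarrow> real"
  assumes u: "square_integrable u" and G: "is_weak_grad u G" "square_integrable G"
    and k: "k > 0" and l: "l > 0"
  shows "C_p p * k powr (1 - 2 / p) * l powr (2 / p) * (Lq_norm p u)\<^sup>2 \<le> k * norm2_sq G + l * norm2_sq u"
proof -
  define s where "s = sqrt (k / l)"
  have s: "s > 0" "1 / s\<^sup>2 = l / k" using k l by (simp_all add: s_def)
  have "C_p p * (Lq_norm p (\<lambda>x. u (s *\<^sub>R x)))\<^sup>2
      \<le> norm2_sq (\<lambda>x. s *\<^sub>R G (s *\<^sub>R x)) + norm2_sq (\<lambda>x. u (s *\<^sub>R x))"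
    by (intro C_p_le is_weak_grad_scale[OF u G s(1)] square_integrable_scale square_integrable_scaleR u G s)
  also have "norm2_sq (\<lambda>x. s *\<^sub>R G (s *\<^sub>R x)) = norm2_sq G"
    using s(1) by (simp add: square_integrable_scale[OF G(2)] square_integrable_scaleR)
  also have "norm2_sq (\<lambda>x. u (s *\<^sub>R x)) = l / k * norm2_sq u"
    using s by (simp add: square_integrable_scale(2)[OF u] flip: s(2))
  also have "(Lq_norm p (\<lambda>x. u (s *\<^sub>R x)))\<^sup>2 = (l / k) powr (2 / p) * (Lq_norm p u)\<^sup>2"
  proof -
    have "((l / k) powr (1 / p))\<^sup>2 = (l / k) powr (2 / p)"
      by (simp add: power2_eq_square flip: powr_add)
    then show ?thesis
      by (simp add: Lq_norm_scale[OF square_integrable_measurable[OF u] s(1)] s(2) power_mult_distrib)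
  qed
  finally have "k * (C_p p * ((l / k) powr (2 / p) * (Lq_norm p u)\<^sup>2)) \<le> k * (norm2_sq G + l / k * norm2_sq u)"
    using k by (intro mult_left_mono) auto
  moreover have "k * (l / k) powr (2 / p) = k powr (1 - 2 / p) * l powr (2 / p)"
    using k l by (simp add: powr_divide powr_diff)
  then have "k * (C_p p * ((l / k) powr (2 / p) * (Lq_norm p u)\<^sup>2)) =
      C_p p * k powr (1 - 2 / p) * l powr (2 / p) * (Lq_norm p u)\<^sup>2"
    by (metis mult.assoc mult.commute)
  ultimately show ?thesis
    using k by (simp add: distrib_left)
qed

section \<open>The magnetic interpolation inequality\<close>

lemma magnetic_direction_linear:
  assumes ij: "i \<noteq> j" and \<psi>: "square_integrable \<psi>" and D: "square_integrable D"
    and weak: "\<And>\<phi>. test_function \<phi> \<Longrightarrow> (LINT x|lborel. partial_deriv j \<phi> x *\<^sub>R \<psi> x) =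
      - (LINT x|lborel. \<phi> x *\<^sub>R (D x - \<i> * complex_of_real (b * x $ i) * \<psi> x))"
  shows "magnetic_direction (\<lambda>x. b * x $ i) j \<psi> D"
proof
  show "continuous_on UNIV (\<lambda>x :: real^2. b * x $ i)" by (intro continuous_intros)
  show "b * (x + s *\<^sub>R axis j 1) $ i = b * x $ i" for x :: "real^2" and s
    using ij by (simp add: axis_def)
  show "Ck k (\<lambda>x. cos (s * (b * x $ i)))" "Ck k (\<lambda>x. sin (s * (b * x $ i)))" for k s
    using Ck_sin_cos[of k "s * b" i 0] by (simp_all add: mult.assoc)
qed (use assms in auto)

lemma H1_mag_magnetic_direction:
  assumes "\<psi> \<in> H1_mag (A_const B)"
  shows "magnetic_direction (\<lambda>x. (B / 2) * x $ 2) 1 \<psi> (\<lambda>x. mag_grad (A_const B) \<psi> x $ 1)"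
    and "magnetic_direction (\<lambda>x. - (B / 2) * x $ 1) 2 \<psi> (\<lambda>x. mag_grad (A_const B) \<psi> x $ 2)"
proof -
  have \<psi>: "square_integrable \<psi>" and D: "square_integrable (mag_grad (A_const B) \<psi>)"
    and G: "is_weak_grad \<psi> (weak_grad \<psi>)"
    using assms is_weak_grad_weak_grad[of \<psi>] by (auto simp: H1_mag_def in_Lq_2_iff)
  have A: "A_const B x $ 1 = (B / 2) * x $ 2" "A_const B x $ 2 = - (B / 2) * x $ 1" for x
    by (simp_all add: A_const_def)
  have eq: "mag_grad (A_const B) \<psi> x $ j - \<i> * complex_of_real (A_const B x $ j) * \<psi> x = weak_grad \<psi> x $ j" for x j
    by (simp add: mag_grad_def)
  have weak: "(LINT x|lborel. partial_deriv j \<phi> x *\<^sub>R \<psi> x) = - (LINT x|lborel. \<phi> x *\<^sub>R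
      (mag_grad (A_const B) \<psi> x $ j - \<i> * complex_of_real (A_const B x $ j) * \<psi> x))"
    if "test_function \<phi>" for \<phi> j
    unfolding eq using G that unfolding is_weak_grad_def by blast
  show "magnetic_direction (\<lambda>x. (B / 2) * x $ 2) 1 \<psi> (\<lambda>x. mag_grad (A_const B) \<psi> x $ 1)"
    using weak[where j=1] unfolding A
    by (intro magnetic_direction_linear \<psi> square_integrable_component[OF D]) auto
  show "magnetic_direction (\<lambda>x. - (B / 2) * x $ 1) 2 \<psi> (\<lambda>x. mag_grad (A_const B) \<psi> x $ 2)"
    using weak[where j=2] unfolding A
    by (intro magnetic_direction_linear \<psi> square_integrable_component[OF D]) auto
qed

text \<open>Rotating by the phase of z turns d_j into e_j, whose real part is the derivative of the
  modulus and whose imaginary part is the current; the term Im (cnj d1 d2) is invariant under this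
  rotation. At z = 0 the modulus term vanishes, and c \<le> 1 with the arithmetic-geometric mean
  inequality suffices.\<close>

lemma diamagnetic_pointwise:
  fixes z d1 d2 :: complex
  assumes c: "0 \<le> c" "c \<le> 1"
  shows "(1 - c\<^sup>2) * ((inner d1 (sgn z))\<^sup>2 + (inner d2 (sgn z))\<^sup>2) + 2 * c * Im (cnj d1 * d2)
    \<le> (norm d1)\<^sup>2 + (norm d2)\<^sup>2"
proof (cases "z = 0")
  case True
  have "Im (cnj d1 * d2) \<le> norm d1 * norm d2"
    using abs_Im_le_cmod[of "cnj d1 * d2"] by (simp add: norm_mult)
  then have "c * Im (cnj d1 * d2) \<le> c * (norm d1 * norm d2)"
    using c by (intro mult_left_mono)
  also have "\<dots> \<le> 1 * (norm d1 * norm d2)"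
    using c by (intro mult_right_mono) auto
  finally show ?thesis
    using True sum_squares_bound[of "norm d1" "norm d2"] by simp
next
  case False
  define s where "s = sgn z"
  have s: "cnj s * s = 1"
    using False complex_norm_square[of s] by (simp add: s_def norm_sgn mult.commute)
  define e1 e2 where "e1 = d1 * cnj s" and "e2 = d2 * cnj s"
  have d: "inner d1 s = Re e1" "inner d2 s = Re e2"
    by (simp_all add: e1_def e2_def inner_complex_def)
  have n: "norm d1 = norm e1" "norm d2 = norm e2"
    using False by (simp_all add: e1_def e2_def norm_mult s_def norm_sgn)
  have "cnj e1 * e2 = cnj d1 * d2 * (cnj s * s)"
    by (simp add: e1_def e2_def mult_ac)
  then have i: "cnj d1 * d2 = cnj e1 * e2" using s by simp
  \<comment> \<open>The right-hand side minus the left is exactly this sum of squares, because Im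
    (cnj e1 e2) = Re e1 Im e2 - Im e1 Re e2.\<close>
  have "0 \<le> (Im e2 - c * Re e1)\<^sup>2 + (Im e1 + c * Re e2)\<^sup>2" by simp
  then show ?thesis
    unfolding s_def[symmetric] d n i cmod_power2
    by (simp add: power2_eq_square algebra_simps)
qed

text \<open>An interpolation between two classical bounds: c = 0 is the integrated diamagnetic
  inequality, and c = 1 is the lowest Landau level bound, the squared norm of the magnetic gradient
  being at least B times that of \<psi>.\<close>

proposition diamagnetic_inequality:
  assumes \<psi>: "\<psi> \<in> H1_mag (A_const B)" and c: "0 \<le> c" "c \<le> 1"
  obtains G where "is_weak_grad (\<lambda>x. norm (\<psi> x)) G" "square_integrable G"
    "(1 - c\<^sup>2) * norm2_sq G + c * B * norm2_sq \<psi> \<le> norm2_sq (mag_grad (A_const B) \<psi>)"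
proof -
  let ?D = "mag_grad (A_const B) \<psi>"
  note M = H1_mag_magnetic_direction[OF \<psi>]
  interpret M1: magnetic_direction "\<lambda>x. (B / 2) * x $ 2" 1 \<psi> "\<lambda>x. ?D x $ 1" by (rule M)
  interpret M2: magnetic_direction "\<lambda>x. - (B / 2) * x $ 1" 2 \<psi> "\<lambda>x. ?D x $ 2" by (rule M)
  have D: "square_integrable ?D"
    using \<psi> by (simp add: H1_mag_def in_Lq_2_iff)
  define G :: "real^2 \<Rightarrow> real^2" where "G = (\<lambda>x. \<chi> j. inner (?D x $ j) (sgn (\<psi> x)))"
  have G1: "(\<lambda>x. G x $ 1) = M1.abs_deriv" and G2: "(\<lambda>x. G x $ 2) = M2.abs_deriv"
    by (rule ext, simp add: G_def M1.abs_deriv_def[abs_def] M2.abs_deriv_def[abs_def])+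
  have G: "square_integrable G"
  proof (rule square_integrable_vec)
    show "square_integrable (\<lambda>x. G x $ j)" for j
      using exhaust_2[of j] G1 G2 M1.square_integrable_abs_deriv M2.square_integrable_abs_deriv by auto
  qed
  have "is_weak_grad (\<lambda>x. norm (\<psi> x)) G"
    unfolding is_weak_grad_def
  proof (intro conjI allI impI)
    show "locally_integrable (\<lambda>x. norm (\<psi> x))" "locally_integrable G"
      by (intro square_integrable_locally_integrable M1.square_integrable_abs G)+
    fix \<phi> and j :: 2 assume \<phi>: "test_function \<phi>"
    show "(LINT x|lborel. partial_deriv j \<phi> x *\<^sub>R norm (\<psi> x)) = - (LINT x|lborel. \<phi> x *\<^sub>R G x $ j)"
      using exhaust_2[of j] M1.weak_deriv_abs[OF \<phi>] M2.weak_deriv_abs[OF \<phi>]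
        fun_cong[OF G1] fun_cong[OF G2] by auto
  qed
  moreover have "(1 - c\<^sup>2) * norm2_sq G + c * B * norm2_sq \<psi> \<le> norm2_sq ?D"
  proof -
    have int: "integrable lborel (\<lambda>x. (norm (G x))\<^sup>2)" "integrable lborel (\<lambda>x. (norm (?D x))\<^sup>2)"
      using G D by (simp_all add: square_integrable_def)
    have intI: "integrable lborel (\<lambda>x. Im (cnj (?D x $ 1) * ?D x $ 2))"
      by (rule integrable_Im[OF integrable_cnj_mult[OF M1.D M2.D]])
    have "(LINT x|lborel. (1 - c\<^sup>2) * (norm (G x))\<^sup>2 + 2 * c * Im (cnj (?D x $ 1) * ?D x $ 2))
        \<le> (LINT x|lborel. (norm (?D x))\<^sup>2)"
    proof (rule integral_mono)
      show "(1 - c\<^sup>2) * (norm (G x))\<^sup>2 + 2 * c * Im (cnj (?D x $ 1) * ?D x $ 2) \<le> (norm (?D x))\<^sup>2" for x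
        using diamagnetic_pointwise[OF c, of "?D x $ 1" "\<psi> x" "?D x $ 2"]
        by (simp only: norm_vec2_sq G_def vec_lambda_beta real_norm_def power2_abs)
    qed (intro Bochner_Integration.integrable_add integrable_mult_right int intI)+
    also have "(LINT x|lborel. (1 - c\<^sup>2) * (norm (G x))\<^sup>2 + 2 * c * Im (cnj (?D x $ 1) * ?D x $ 2)) =
        (1 - c\<^sup>2) * norm2_sq G + 2 * c * (LINT x|lborel. Im (cnj (?D x $ 1) * ?D x $ 2))"
      unfolding norm2_sq_def
      by (subst Bochner_Integration.integral_add[OF integrable_mult_right[OF int(1)] integrable_mult_right[OF intI]])
         (simp only: integral_mult_right_zero)
    \<comment> \<open>The potential has coefficient b = B / 2, so the factor 2 c in front turns this
      into c B.\<close>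
    also have "(LINT x|lborel. Im (cnj (?D x $ 1) * ?D x $ 2)) = B / 2 * norm2_sq \<psi>"
      by (rule magnetic_commutator[OF M])
    finally show ?thesis by (simp add: norm2_sq_def mult.assoc)
  qed
  ultimately show ?thesis using G that by blast
qed

text \<open>
  The witness \<open>\<psi>0\<close> bounds the admissible constants from above; without it \<open>GREATEST\<close> could be a junk value.
\<close>
lemma lower_bound_le_Greatest:
  fixes E n :: "'a \<Rightarrow> real"
  assumes low: "\<And>\<psi>. \<psi> \<in> X \<Longrightarrow> \<mu>0 * n \<psi> \<le> E \<psi>" and n: "\<And>\<psi>. \<psi> \<in> X \<Longrightarrow> n \<psi> \<ge> 0"
    and \<psi>0: "\<psi>0 \<in> X" "n \<psi>0 > 0"
  shows "\<mu>0 \<le> (GREATEST \<mu>. \<forall>\<psi>\<in>X. \<mu> * n \<psi> \<le> E \<psi>)"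
proof -
  define S where "S = {\<mu>. \<forall>\<psi>\<in>X. \<mu> * n \<psi> \<le> E \<psi>}"
  have "\<mu>0 \<in> S" using low by (simp add: S_def)
  have bdd: "bdd_above S"
    using \<psi>0 by (intro bdd_aboveI[of _ "E \<psi>0 / n \<psi>0"]) (auto simp: S_def pos_le_divide_eq)
  \<comment> \<open>\<open>GREATEST\<close> requires the supremum to be admissible itself. Each
    constraint is closed in the constant, and where \<open>n \<psi>\<close> is 0 it does not involve
    the constant, so it is inherited from \<open>\<mu>0\<close>.\<close>
  have "Sup S * n \<psi> \<le> E \<psi>" if \<psi>: "\<psi> \<in> X" for \<psi>
  proof (cases "n \<psi> = 0")
    case True
    then show ?thesis using low[OF \<psi>] by simp
  next
    case False
    then have "n \<psi> > 0" using n[OF \<psi>] by simp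
    moreover from this have "Sup S \<le> E \<psi> / n \<psi>"
      using \<open>\<mu>0 \<in> S\<close> \<psi> by (intro cSup_least) (auto simp: S_def pos_le_divide_eq)
    ultimately show ?thesis by (simp add: pos_le_divide_eq)
  qed
  then have "(GREATEST \<mu>. \<forall>\<psi>\<in>X. \<mu> * n \<psi> \<le> E \<psi>) = Sup S"
    using bdd by (intro Greatest_equality) (auto simp: S_def intro: cSup_upper)
  then show ?thesis
    using cSup_upper[OF \<open>\<mu>0 \<in> S\<close> bdd] by simp
qed

section \<open>A nonzero element of the magnetic Sobolev space\<close>

lemma is_weak_grad_test_function:
  assumes \<phi>: "test_function \<phi>"
  shows "is_weak_grad (\<lambda>x. complex_of_real (\<phi> x)) (\<lambda>x. \<chi> j. complex_of_real (partial_deriv j \<phi> x))"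
  unfolding is_weak_grad_def
proof (intro conjI allI impI)
  have "continuous_on UNIV (\<lambda>x. \<chi> j. complex_of_real (partial_deriv j \<phi> x))"
    by (intro continuous_intros test_function_continuous test_function_partial_deriv \<phi>)
  then show "locally_integrable (\<lambda>x. \<chi> j. complex_of_real (partial_deriv j \<phi> x))"
    by (rule locally_integrable_continuous)
  show "locally_integrable (\<lambda>x. complex_of_real (\<phi> x))"
    by (intro locally_integrable_continuous continuous_intros test_function_continuous \<phi>)
  fix \<theta> j assume \<theta>: "test_function \<theta>"
  have int: "integrable lborel (\<lambda>x. f x * g x)" if "test_function f" "test_function g" for f g
    using integrable_test_function_scaleR[OF that(1) locally_integrable_continuous[OF test_function_continuous[OF that(2)]]]
    by simp
  note d = test_function_partial_deriv[where j=j]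
  have "(LINT x|lborel. \<theta> x * partial_deriv j \<phi> x + partial_deriv j \<theta> x * \<phi> x) = 0"
    using integral_partial_deriv_eq_0[OF test_function_mult[OF \<phi> test_function_Ck[OF \<theta>]], of j]
    by (simp add: partial_deriv_mult test_function_differentiable \<phi> \<theta>)
  then have "(LINT x|lborel. partial_deriv j \<theta> x * \<phi> x) = - (LINT x|lborel. \<theta> x * partial_deriv j \<phi> x)"
    by (simp add: int d \<phi> \<theta>)
  then show "(LINT x|lborel. partial_deriv j \<theta> x *\<^sub>R complex_of_real (\<phi> x)) =
      - (LINT x|lborel. \<theta> x *\<^sub>R (\<chi> j. complex_of_real (partial_deriv j \<phi> x)) $ j)"
    by (simp add: scaleR_conv_of_real flip: of_real_mult)
qed

lemma test_function_H1_mag: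
  assumes \<phi>: "test_function \<phi>"
  shows "(\<lambda>x. complex_of_real (\<phi> x)) \<in> H1_mag (A_const B)"
proof -
  let ?\<psi> = "\<lambda>x. complex_of_real (\<phi> x)"
  note [measurable] = test_function_measurable[OF \<phi>]
  define G where "G = (\<lambda>x. \<chi> j. complex_of_real (partial_deriv j \<phi> x))"
  have wg: "is_weak_grad ?\<psi> G"
    unfolding G_def by (rule is_weak_grad_test_function[OF \<phi>])
  have sq_of_real: "square_integrable (\<lambda>x. complex_of_real (f x))" if "test_function f" for f
  proof -
    note [measurable] = test_function_measurable[OF that]
    have "(\<lambda>x. complex_of_real (f x)) \<in> borel_measurable borel" by measurable
    then show ?thesis
      using test_function_square_integrable[OF that] by (simp add: square_integrable_def)
  qed
  have G: "square_integrable G"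
    by (rule square_integrable_vec) (simp add: G_def sq_of_real test_function_partial_deriv \<phi>)
  have A: "test_function (\<lambda>x. A_const B x $ j * \<phi> x)" for j
  proof -
    have "Ck k (\<lambda>x. A_const B x $ j)" for k
    proof -
      \<comment> \<open>Linear coordinates are smooth because the identity together with the
        constants is closed under differentiation; the summand 0 matches the form of
        \<open>Ck_coordinate\<close>.\<close>
      have "Ck k (\<lambda>x. c * x $ i + 0)" for c i
      proof (rule Ck_coordinate[where F="\<lambda>t. t" and S="insert (\<lambda>t. t) (range (\<lambda>c _. c))"])
        show "\<exists>F'\<in>insert (\<lambda>t. t) (range (\<lambda>c _. c)). \<forall>t. (F has_real_derivative F' t) (at t)"
          if "F \<in> insert (\<lambda>t. t) (range (\<lambda>c _. c))" for F
          using that by (auto intro!: derivative_eq_intros)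
      qed simp
      from this[of "B / 2" 2] this[of "- (B / 2)" 1] show ?thesis
        using exhaust_2[of j] by (auto simp: A_const_def)
    qed
    then show ?thesis by (rule test_function_mult[OF \<phi>])
  qed
  note wsq = square_integrable_weak_grad(1)[OF wg G]
  have "square_integrable (mag_grad (A_const B) ?\<psi>)"
  proof (rule square_integrable_vec)
    fix j
    have "mag_grad (A_const B) ?\<psi> x $ j = weak_grad ?\<psi> x $ j + \<i> * complex_of_real (A_const B x $ j * \<phi> x)" for x
      by (simp add: mag_grad_def mult.assoc)
    moreover have "square_integrable (\<lambda>x. \<i> * complex_of_real (A_const B x $ j * \<phi> x))"
      using sq_of_real[OF A[of j]] borel_measurable_times[OF borel_measurable_const]
      by (auto simp: square_integrable_def norm_mult)
    ultimately show "square_integrable (\<lambda>x. mag_grad (A_const B) ?\<psi> x $ j)"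
      using square_integrable_add(1)[OF square_integrable_component[OF wsq, of j]] by simp
  qed
  then show ?thesis
    using wg sq_of_real[OF \<phi>] by (auto simp: H1_mag_def in_Lq_2_iff)
qed

lemma Lq_norm_box_bump_pos:
  assumes p: "p > 0"
  shows "Lq_norm p (\<lambda>x. complex_of_real (box_bump 1 (vec 0) (vec 1) x)) > 0"
proof -
  let ?b = "box_bump 1 (vec 0) (vec 1)" and ?Q = "box (vec 0) (vec 1) :: (real^2) set"
  have [measurable]: "?b \<in> borel_measurable borel"
    by (intro test_function_measurable test_function_box_bump) simp
  have b: "0 \<le> ?b x" "?b x \<le> 1" "?b x = 0 \<longleftrightarrow> x \<notin> ?Q" for x
    using box_bump_bounds box_bump_eq_0_iff[of 1] by auto
  \<comment> \<open>Integrability has to be established, as a non-integrable power would give the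
    norm its default value 0.\<close>
  have int: "integrable lborel (\<lambda>x. ?b x powr p)"
  proof (rule Bochner_Integration.integrable_bound)
    show "integrable lborel (\<lambda>x. indicator ?Q x :: real)"
      by (intro integrable_real_indicator emeasure_bounded_finite bounded_box) simp
    show "AE x in lborel. norm (?b x powr p) \<le> norm (indicator ?Q x :: real)"
    proof (rule AE_I2)
      fix x
      show "norm (?b x powr p) \<le> norm (indicator ?Q x :: real)"
        using b[of x] p by (cases "x \<in> ?Q") (auto intro: powr_le1)
    qed
  qed measurable
  have "(LINT x|lborel. ?b x powr p) \<noteq> 0"
  proof
    assume "(LINT x|lborel. ?b x powr p) = 0"
    then have "AE x in lborel. ?b x powr p = 0"
      using integral_nonneg_eq_0_iff_AE[OF int] by simp
    then have "AE x in lborel. x \<notin> ?Q"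
      by eventually_elim (use b(3) in simp)
    then have "?Q \<in> null_sets lborel"
      using AE_iff_null_sets[of ?Q lborel] by simp
    then have "negligible ?Q"
      by (simp add: negligible_iff_null_sets null_sets_completionI)
    moreover have "(\<chi> i. 1 / 2) \<in> ?Q"
      by (simp add: mem_box_cart)
    ultimately show False
      using open_not_negligible[OF open_box, of "vec 0 :: real^2" "vec 1"] by auto
  qed
  moreover have "(LINT x|lborel. ?b x powr p) \<ge> 0" by simp
  ultimately show ?thesis
    using b(1) by (simp add: Lq_norm_def)
qed

text \<open>Everything rests on the two forms c (p - 1) = r - \<eta> and c (r + \<eta>) = 1, with r
  the square root. If 1 - \<eta> > 0, then c < 1 amounts to (1 - \<eta>)^2 < r^2, that is 2 \<eta> >
  2 - p, which is the hypothesis \<alpha> > -B in other units.\<close>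

lemma coupling_constant:
  fixes p B \<alpha> \<eta> c :: real
  assumes p: "p > 2" and B: "B > 0" and \<alpha>: "\<alpha> > - B"
    and \<eta>: "\<eta> = \<alpha> * (p - 2) / (2 * B)" and c: "c = (sqrt (\<eta>\<^sup>2 + p - 1) - \<eta>) / (p - 1)"
  shows "c = 1 / (\<eta> + sqrt (\<eta>\<^sup>2 + p - 1))" "0 < c" "c < 1" "0 < \<alpha> + c * B"
proof -
  define r where "r = sqrt (\<eta>\<^sup>2 + p - 1)"
  have "\<eta>\<^sup>2 + p - 1 \<ge> 0"
    using p zero_le_power2[of \<eta>] by linarith
  then have r2: "r\<^sup>2 = \<eta>\<^sup>2 + p - 1" and r0: "r \<ge> 0"
    by (simp_all add: r_def)
  have r: "r > \<bar>\<eta>\<bar>"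
    using p r2 r0 by (intro power_less_imp_less_base[of "\<bar>\<eta>\<bar>" 2 r]) auto
  have prod: "(r - \<eta>) * (\<eta> + r) = p - 1"
    using r2 by (simp add: algebra_simps power2_eq_square)
  have pos: "\<eta> + r > 0" "r - \<eta> > 0" using r by auto
  have c': "c * (p - 1) = r - \<eta>" using p by (simp add: c r_def)
  have c1: "c = 1 / (\<eta> + r)"
  proof -
    have "(p - 1) * (c * (\<eta> + r)) = (p - 1) * 1"
      using prod c' by algebra
    then have "c * (\<eta> + r) = 1" using p by (simp only: mult_cancel_left) simp
    then show ?thesis using pos by (simp add: field_simps)
  qed
  then show "c = 1 / (\<eta> + sqrt (\<eta>\<^sup>2 + p - 1))" by (simp add: r_def)
  show c0: "0 < c" using c1 pos by simp
  have \<alpha>\<eta>: "\<alpha> * (p - 2) = 2 * B * \<eta>" using B by (simp add: \<eta>)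
  have \<eta>_low: "2 * \<eta> > - (p - 2)"
  proof -
    have "(- B) * (p - 2) < \<alpha> * (p - 2)" using \<alpha> p by (intro mult_strict_right_mono) auto
    then have "B * (- (p - 2)) < B * (2 * \<eta>)" using \<alpha>\<eta> by (simp add: algebra_simps)
    then show ?thesis using B by (simp only: mult_less_cancel_left_pos)
  qed
  have "r > 1 - \<eta>"
  proof (cases "1 - \<eta> \<le> 0")
    case True
    then show ?thesis using r by linarith
  next
    case False
    have "(1 - \<eta>)\<^sup>2 < r\<^sup>2" using \<eta>_low r2 by (simp add: power2_eq_square algebra_simps)
    then show ?thesis using r0 by (rule power_less_imp_less_base)
  qed
  then show "c < 1" using c1 pos by simp
  \<comment> \<open>This quantity is (p - 2) (\<alpha> + c B) / B. The quadratic equation for c says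
    that c times it equals 1 - c^2, so it cannot fail to be positive when 0 < c < 1.\<close>
  have "c * (p - 2) + 2 * \<eta> > 0"
  proof (rule ccontr)
    assume "\<not> ?thesis"
    then have le: "c * (p - 2) \<le> - 2 * \<eta>" by simp
    have quad: "c\<^sup>2 * (p - 1) + 2 * \<eta> * c = 1"
    proof -
      have "c * (\<eta> + r) = 1" using c1 pos by simp
      moreover have "r = c * (p - 1) + \<eta>" using c' by simp
      ultimately show ?thesis by (simp add: algebra_simps power2_eq_square)
    qed
    have "c * (c * (p - 2)) \<le> c * (- 2 * \<eta>)" using le c0 by (intro mult_left_mono) auto
    then have "c\<^sup>2 \<ge> 1" using quad by (simp add: algebra_simps power2_eq_square)
    moreover have "c\<^sup>2 < 1" using \<open>c < 1\<close> c0 by (simp add: abs_square_less_1)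
    ultimately show False by linarith
  qed
  then have "B * (c * (p - 2) + 2 * \<eta>) > 0" using B by simp
  then have "(\<alpha> + c * B) * (p - 2) > 0" using \<alpha>\<eta> by (simp add: algebra_simps)
  then show "0 < \<alpha> + c * B" using p by (simp add: zero_less_mult_iff)
qed

theorem proposition4p2:
  fixes p B \<alpha> \<eta> c :: real
  assumes "p > 2" and "B > 0" and "\<alpha> > - B"
    and "\<eta> = \<alpha> * (p - 2) / (2 * B)"
    and "c = (sqrt (\<eta>\<^sup>2 + p - 1) - \<eta>) / (p - 1)"
  shows "mu_B p B \<alpha> \<ge> C_p p * (1 - c\<^sup>2) powr (1 - 2 / p) * (\<alpha> + c * B) powr (2 / p)
    \<and> c = 1 / (\<eta> + sqrt (\<eta>\<^sup>2 + p - 1)) \<and> 0 < c \<and> c < 1"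
proof -
  note c = coupling_constant[OF assms]
  have c2: "1 - c\<^sup>2 > 0" using c by (simp add: abs_square_less_1)
  have "C_p p * (1 - c\<^sup>2) powr (1 - 2 / p) * (\<alpha> + c * B) powr (2 / p) \<le> mu_B p B \<alpha>"
    unfolding mu_B_def
  proof (rule lower_bound_le_Greatest)
    let ?\<psi>0 = "\<lambda>x. complex_of_real (box_bump 1 (vec 0) (vec 1) x)"
    show "?\<psi>0 \<in> H1_mag (A_const B)"
      by (intro test_function_H1_mag test_function_box_bump) simp
    show "(Lq_norm p ?\<psi>0)\<^sup>2 > 0"
      using Lq_norm_box_bump_pos[of p] assms(1) by simp
    fix \<psi> assume \<psi>: "\<psi> \<in> H1_mag (A_const B)"
    obtain G where G: "is_weak_grad (\<lambda>x. norm (\<psi> x)) G" "square_integrable G"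
      "(1 - c\<^sup>2) * norm2_sq G + c * B * norm2_sq \<psi> \<le> norm2_sq (mag_grad (A_const B) \<psi>)"
      using diamagnetic_inequality[OF \<psi>, of c] c by auto
    have u: "square_integrable (\<lambda>x. norm (\<psi> x))" "norm2_sq (\<lambda>x. norm (\<psi> x)) = norm2_sq \<psi>"
      "Lq_norm p (\<lambda>x. norm (\<psi> x)) = Lq_norm p \<psi>"
      using \<psi> by (auto simp: H1_mag_def in_Lq_2_iff square_integrable_def norm2_sq_def Lq_norm_def)
    have "C_p p * (1 - c\<^sup>2) powr (1 - 2 / p) * (\<alpha> + c * B) powr (2 / p) * (Lq_norm p \<psi>)\<^sup>2
        \<le> (1 - c\<^sup>2) * norm2_sq G + (\<alpha> + c * B) * norm2_sq \<psi>"
      using weighted_C_p_le[OF u(1) G(1,2) c2 c(4), of p] by (simp only: u)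
    also have "\<dots> \<le> norm2_sq (mag_grad (A_const B) \<psi>) + \<alpha> * norm2_sq \<psi>"
      using G(3) by (simp add: algebra_simps)
    finally show "C_p p * (1 - c\<^sup>2) powr (1 - 2 / p) * (\<alpha> + c * B) powr (2 / p) * (Lq_norm p \<psi>)\<^sup>2
        \<le> (Lq_norm 2 (mag_grad (A_const B) \<psi>))\<^sup>2 + \<alpha> * (Lq_norm 2 \<psi>)\<^sup>2"
      unfolding Lq_norm_2_sq .
  qed simp
  with c show ?thesis by blast
qed

end
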